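(* Let $p$ be a prime, $n\geq1$, and let $G$ be a profinite group such that $G\cong S/N$ for a free profinite group $S$ and a closed normal subgroup $N$ of $S$ with $N\leq S_n$. If $n\geq 2$, assume moreover that $G$ satisfies the $n$-th Massey kernel condition, i.e. the kernel of the inflation map $\inf\colon H^2(G/G_n)_{n\text{-Massey}}\to H^2(G)$ is generated by $n$-fold Massey products in $H^2(G/G_n)$. Then $G_{n+1}=\bigcap_\rho\operatorname{Ker}(\rho)$, where $\rho$ ranges over all continuous homomorphisms $\rho\colon G\to \mathrm{U}_{n+1}(\mathbb{F}_p)$.
   Context: For a profinite group $G$, the $p$-Zassenhaus filtration is $G_1=G$, $G_n=G_{\lceil n/p\rceil}^p\prod_{i+j=n}[G_i,G_j]$ ($n\geq 2$), with $[H,K]$, $H^p$ the closed subgroups generated by commutators, resp. $p$-th powers. $\mathrm{U}_{k}(\mathbb{F}_p)$ is the (discrete) group of upper-triangular unipotent $k\times k$ matrices over $\mathbb{F}_p$. Cohomology $H^i(\Gamma)=H^i(\Gamma,\mathbb{Z}/p)$ is the profinite cohomology with trivial action, computed by the complex $C^\bullet(\Gamma,\mathbb{Z}/p)$ of continuous inhomogeneous cochains, with $(\partial c)(\sigma,\tau)=c(\sigma)+c(\tau)-c(\sigma\tau)$ for $c\in C^1$ and cup product $(c\cup c')(\sigma,\tau)=c(\sigma)c'(\tau)$ for $c,c'\in C^1$. A defining system of size $n$ in $C^\bullet(\Gamma,\mathbb{Z}/p)$ is a family $c_{ij}\in C^1(\Gamma,\mathbb{Z}/p)$, $1\leq i\leq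 j\leq n$, $(i,j)\neq(1,n)$, such that $\partial c_{ij}=\widetilde c_{ij}$ for all such $(i,j)$, where for all $1\le i\le j\le n$ one sets $\widetilde c_{ij}=-\sum_{r=i}^{j-1}c_{ir}\cup c_{r+1,j}$. Then $\widetilde c_{1n}$ is a 2-cocycle, and its class $[\widetilde c_{1n}]\in H^2(\Gamma)$ is called an $n$-fold Massey product (of $[c_{11}],\dots,[c_{nn}]$). $H^2(\Gamma)_{n\text{-Massey}}$ denotes the subgroup of $H^2(\Gamma)$ generated by all $n$-fold Massey products. *)

theory Defs
  imports
    "HOL-Analysis.Analysis"
    "HOL-Algebra.Generated_Groups"
    "Jordan_Normal_Form.Matrix"
    "Berlekamp_Zassenhaus.Finite_Field"
begin

section \<open>Profinite groups\<close>

locale topological_group = group G for G (structure) +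
  fixes T :: "'a topology"
  assumes topspace_eq: "topspace T = carrier G"
    and continuous_mult: "continuous_map (prod_topology T T) T (\<lambda>(x, y). x \<otimes> y)"
    and continuous_inv: "continuous_map T T (\<lambda>x. inv x)"

locale profinite_group = topological_group +
  assumes compact: "compact_space T"
    and Hausdorff: "Hausdorff_space T"
    and totally_disconnected: "\<And>C. connectedin T C \<Longrightarrow> \<exists>x. C \<subseteq> {x}"

definition continuous_hom ::
  "('a, 'm) monoid_scheme \<Rightarrow> 'a topology \<Rightarrow> ('b, 'k) monoid_scheme \<Rightarrow> 'b topology \<Rightarrow> ('a \<Rightarrow> 'b) set"
  where "continuous_hom G T H U = {f \<in> hom G H. continuous_map T U f}"

definition topological_group_iso ::
  "('a, 'm) monoid_scheme \<Rightarrow> 'a topology \<Rightarrow> ('b, 'k) monoid_scheme \<Rightarrow> 'b topology \<Rightarrow> bool"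
  where "topological_group_iso G T H U \<longleftrightarrow> (\<exists>f \<in> iso G H. homeomorphic_map T U f)"

definition closed_subgroup_generated ::
  "('a, 'm) monoid_scheme \<Rightarrow> 'a topology \<Rightarrow> 'a set \<Rightarrow> 'a set"
  where "closed_subgroup_generated G T A = (\<lambda>H. subgroup H G \<and> closedin T H) hull A"

definition image_topology :: "'a topology \<Rightarrow> ('a \<Rightarrow> 'b) \<Rightarrow> 'b topology"
  where "image_topology T q =
    topology (\<lambda>U. U \<subseteq> q ` topspace T \<and> openin T {x \<in> topspace T. q x \<in> U})"

lemma openin_image_topology:
  "openin (image_topology T q) U \<longleftrightarrow>
    U \<subseteq> q ` topspace T \<and> openin T {x \<in> topspace T. q x \<in> U}"
proof -
  have "istopology (\<lambda>U. U \<subseteq> q ` topspace T \<and> openin T {x \<in> topspace T. q x \<in> U})"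
    unfolding istopology_def
  proof (intro conjI allI impI)
    fix U V
    assume *: "U \<subseteq> q ` topspace T \<and> openin T {x \<in> topspace T. q x \<in> U}"
      "V \<subseteq> q ` topspace T \<and> openin T {x \<in> topspace T. q x \<in> V}"
    then show "U \<inter> V \<subseteq> q ` topspace T"
      by blast
    have "{x \<in> topspace T. q x \<in> U \<inter> V} =
        {x \<in> topspace T. q x \<in> U} \<inter> {x \<in> topspace T. q x \<in> V}"
      by auto
    then show "openin T {x \<in> topspace T. q x \<in> U \<inter> V}"
      using * by (simp only: openin_Int)
  next
    fix \<U>
    assume *: "\<forall>U\<in>\<U>. U \<subseteq> q ` topspace T \<and> openin T {x \<in> topspace T. q x \<in> U}"
    then show "\<Union>\<U> \<subseteq> q ` topspace T"
      by blast
    have eq: "{x \<in> topspace T. q x \<in> \<Union>\<U>} = \<Union> ((\<lambda>U. {x \<in> topspace T. q x \<in> U}) ` \<U>)"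
      by auto
    show "openin T {x \<in> topspace T. q x \<in> \<Union>\<U>}"
      unfolding eq using * by (intro openin_Union) blast
  qed
  then show ?thesis
    unfolding image_topology_def by (simp add: topology_inverse')
qed

lemma quotient_map_image_topology: "quotient_map T (image_topology T q) q"
proof -
  have "{x \<in> topspace T. q x \<in> q ` topspace T} = topspace T"
    by auto
  then have "openin (image_topology T q) (q ` topspace T)"
    by (simp add: openin_image_topology)
  then have "topspace (image_topology T q) = q ` topspace T"
    by (metis openin_image_topology openin_subset openin_topspace subset_antisym)
  then show ?thesis
    by (simp add: quotient_map_def openin_image_topology)
qed

definition quotient_topology ::
  "('a, 'm) monoid_scheme \<Rightarrow> 'a topology \<Rightarrow> 'a set \<Rightarrow> 'a set topology"
  where "quotient_topology G T N = image_topology T (\<lambda>x. N #>\<^bsub>G\<^esub> x)"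

section \<open>Free profinite groups\<close>

definition converges_to_one ::
  "'x set \<Rightarrow> ('x \<Rightarrow> 'a) \<Rightarrow> ('a, 'm) monoid_scheme \<Rightarrow> 'a topology \<Rightarrow> bool"
  where "converges_to_one B \<alpha> H U \<longleftrightarrow>
    (\<forall>V. subgroup V H \<and> openin U V \<longrightarrow> finite {x \<in> B. \<alpha> x \<notin> V})"

text \<open>
  The test group \<open>H\<close> in the universal property ranges over the profinite groups carried by
  subsets of the type \<open>('s + nat) set\<close>. This amounts to all profinite groups: it is enough to test
  \<open>H\<close> topologically generated by \<open>\<alpha> ` B\<close>, such an \<open>H\<close> has at most \<open>max (card B) \<aleph>\<^sub>0\<close> open
  subgroups because \<open>\<alpha>\<close> converges to 1, and so its underlying set embeds into \<open>('s + nat) set\<close>.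
\<close>

definition free_profinite_on ::
  "'s set \<Rightarrow> ('s, 'm) monoid_scheme \<Rightarrow> 's topology \<Rightarrow> bool"
  where "free_profinite_on B S T \<longleftrightarrow>
    profinite_group S T \<and>
    B \<subseteq> carrier S \<and>
    converges_to_one B (\<lambda>x. x) S T \<and>
    closed_subgroup_generated S T B = carrier S \<and>
    (\<forall>(H :: ('s + nat) set monoid) U \<alpha>.
      profinite_group H U \<and> \<alpha> ` B \<subseteq> carrier H \<and> converges_to_one B \<alpha> H U \<longrightarrow>
      (\<exists>!f. f \<in> extensional (carrier S) \<and> f \<in> continuous_hom S T H U \<and> (\<forall>x\<in>B. f x = \<alpha> x)))"

definition free_profinite_group :: "('s, 'm) monoid_scheme \<Rightarrow> 's topology \<Rightarrow> bool"
  where "free_profinite_group S T \<longleftrightarrow> (\<exists>B. free_profinite_on B S T)"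

section \<open>The Zassenhaus filtration\<close>

definition closed_commutator ::
  "('a, 'm) monoid_scheme \<Rightarrow> 'a topology \<Rightarrow> 'a set \<Rightarrow> 'a set \<Rightarrow> 'a set"
  where "closed_commutator G T H K = closed_subgroup_generated G T
    {h \<otimes>\<^bsub>G\<^esub> k \<otimes>\<^bsub>G\<^esub> inv\<^bsub>G\<^esub> h \<otimes>\<^bsub>G\<^esub> inv\<^bsub>G\<^esub> k | h k. h \<in> H \<and> k \<in> K}"

definition closed_power ::
  "('a, 'm) monoid_scheme \<Rightarrow> 'a topology \<Rightarrow> 'a set \<Rightarrow> nat \<Rightarrow> 'a set"
  where "closed_power G T H p = closed_subgroup_generated G T {h [^]\<^bsub>G\<^esub> p | h. h \<in> H}"

text \<open>
  Only \<open>n \<ge> 1\<close> and \<open>p \<ge> 2\<close> are meaningful; the other cases are dummy values ensuring termination.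
\<close>

function zassenhaus :: "nat \<Rightarrow> ('a, 'm) monoid_scheme \<Rightarrow> 'a topology \<Rightarrow> nat \<Rightarrow> 'a set"
  where "zassenhaus p G T n =
    (if n \<le> 1 \<or> p < 2 then carrier G
     else closed_power G T (zassenhaus p G T (nat \<lceil>real n / real p\<rceil>)) p <#>\<^bsub>G\<^esub>
       foldr (\<lambda>i A. closed_commutator G T (zassenhaus p G T i) (zassenhaus p G T (n - i)) <#>\<^bsub>G\<^esub> A)
         [1..<n] {\<one>\<^bsub>G\<^esub>})"
  by pat_completeness auto
termination
proof (relation "Wellfounded.measure (\<lambda>(p, G, T, n). n)", goal_cases)
  case (2 p G T n)
  then have "2 \<le> p" "2 \<le> n"
    by auto
  then have "real n / real p \<le> real n / 2"
    by (intro divide_left_mono) auto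
  also have "\<dots> \<le> real n - 1"
    using \<open>2 \<le> n\<close> by simp
  finally have "\<lceil>real n / real p\<rceil> \<le> int n - 1"
    unfolding ceiling_le_iff by simp
  then show ?case
    using \<open>2 \<le> n\<close> by simp
qed auto

declare zassenhaus.simps [simp del]

section \<open>Continuous cochains and the second cohomology group\<close>

text \<open>
  The type \<open>'p mod_ring\<close> is \<open>\<int>/p\<close> for \<open>p = CARD('p)\<close>. Cochains are normalised to vanish outside the
  carrier, so that equal cochains are equal as functions.
\<close>

definition cochains1 :: "('a, 'm) monoid_scheme \<Rightarrow> 'a topology \<Rightarrow> ('a \<Rightarrow> 'p::prime_card mod_ring) set"
  where "cochains1 G T =
    {c. continuous_map T (discrete_topology UNIV) c \<and> (\<forall>x. x \<notin> carrier G \<longrightarrow> c x = 0)}"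

definition cochains2 ::
  "('a, 'm) monoid_scheme \<Rightarrow> 'a topology \<Rightarrow> ('a \<times> 'a \<Rightarrow> 'p::prime_card mod_ring) set"
  where "cochains2 G T =
    {f. continuous_map (prod_topology T T) (discrete_topology UNIV) f \<and>
        (\<forall>x. x \<notin> carrier G \<times> carrier G \<longrightarrow> f x = 0)}"

definition coboundary ::
  "('a, 'm) monoid_scheme \<Rightarrow> ('a \<Rightarrow> 'p::prime_card mod_ring) \<Rightarrow> 'a \<times> 'a \<Rightarrow> 'p mod_ring"
  where "coboundary G c = (\<lambda>(\<sigma>, \<tau>).
    if \<sigma> \<in> carrier G \<and> \<tau> \<in> carrier G then c \<sigma> + c \<tau> - c (\<sigma> \<otimes>\<^bsub>G\<^esub> \<tau>) else 0)"

definition cup ::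
  "('a \<Rightarrow> 'p::prime_card mod_ring) \<Rightarrow> ('a \<Rightarrow> 'p mod_ring) \<Rightarrow> 'a \<times> 'a \<Rightarrow> 'p mod_ring"
  where "cup c c' = (\<lambda>(\<sigma>, \<tau>). c \<sigma> * c' \<tau>)"

definition cocycles2 ::
  "('a, 'm) monoid_scheme \<Rightarrow> 'a topology \<Rightarrow> ('a \<times> 'a \<Rightarrow> 'p::prime_card mod_ring) set"
  where "cocycles2 G T =
    {f \<in> cochains2 G T. \<forall>\<rho>\<in>carrier G. \<forall>\<sigma>\<in>carrier G. \<forall>\<tau>\<in>carrier G.
      f (\<sigma>, \<tau>) - f (\<rho> \<otimes>\<^bsub>G\<^esub> \<sigma>, \<tau>) + f (\<rho>, \<sigma> \<otimes>\<^bsub>G\<^esub> \<tau>) - f (\<rho>, \<sigma>) = 0}"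

definition cocycle_group2 ::
  "('a, 'm) monoid_scheme \<Rightarrow> 'a topology \<Rightarrow> ('a \<times> 'a \<Rightarrow> 'p::prime_card mod_ring) monoid"
  where "cocycle_group2 G T =
    \<lparr>carrier = cocycles2 G T, mult = (\<lambda>f g x. f x + g x), one = (\<lambda>_. 0)\<rparr>"

definition coboundaries2 ::
  "('a, 'm) monoid_scheme \<Rightarrow> 'a topology \<Rightarrow> ('a \<times> 'a \<Rightarrow> 'p::prime_card mod_ring) set"
  where "coboundaries2 G T = coboundary G ` cochains1 G T"

definition H2 ::
  "('a, 'm) monoid_scheme \<Rightarrow> 'a topology \<Rightarrow> ('a \<times> 'a \<Rightarrow> 'p::prime_card mod_ring) set monoid"
  where "H2 G T = cocycle_group2 G T Mod coboundaries2 G T"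

definition H2_class ::
  "('a, 'm) monoid_scheme \<Rightarrow> 'a topology \<Rightarrow> ('a \<times> 'a \<Rightarrow> 'p::prime_card mod_ring) \<Rightarrow>
    ('a \<times> 'a \<Rightarrow> 'p mod_ring) set"
  where "H2_class G T f = coboundaries2 G T #>\<^bsub>cocycle_group2 G T\<^esub> f"

text \<open>
  All representatives \<open>f\<close> of a cohomology class \<open>C\<close> of \<open>G/N\<close> inflate to the same class of \<open>G\<close>, so
  the union below is that class.
\<close>

definition inflation ::
  "('a, 'm) monoid_scheme \<Rightarrow> 'a topology \<Rightarrow> 'a set \<Rightarrow>
    ('a set \<times> 'a set \<Rightarrow> 'p::prime_card mod_ring) set \<Rightarrow> ('a \<times> 'a \<Rightarrow> 'p mod_ring) set"
  where "inflation G T N C = (\<Union>f\<in>C. H2_class G T (\<lambda>(\<sigma>, \<tau>).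
    if \<sigma> \<in> carrier G \<and> \<tau> \<in> carrier G then f (N #>\<^bsub>G\<^esub> \<sigma>, N #>\<^bsub>G\<^esub> \<tau>) else 0))"

section \<open>Massey products\<close>

definition massey_tilde ::
  "(nat \<Rightarrow> nat \<Rightarrow> 'a \<Rightarrow> 'p::prime_card mod_ring) \<Rightarrow> nat \<Rightarrow> nat \<Rightarrow> 'a \<times> 'a \<Rightarrow> 'p mod_ring"
  where "massey_tilde c i j = (\<lambda>x. - (\<Sum>r\<in>{i..<j}. cup (c i r) (c (r + 1) j) x))"

definition defining_system ::
  "('a, 'm) monoid_scheme \<Rightarrow> 'a topology \<Rightarrow> nat \<Rightarrow>
    (nat \<Rightarrow> nat \<Rightarrow> 'a \<Rightarrow> 'p::prime_card mod_ring) \<Rightarrow> bool"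
  where "defining_system G T n c \<longleftrightarrow>
    (\<forall>i j. 1 \<le> i \<and> i \<le> j \<and> j \<le> n \<and> (i, j) \<noteq> (1, n) \<longrightarrow>
      c i j \<in> cochains1 G T \<and> coboundary G (c i j) = massey_tilde c i j)"

definition massey_products ::
  "('a, 'm) monoid_scheme \<Rightarrow> 'a topology \<Rightarrow> nat \<Rightarrow> ('a \<times> 'a \<Rightarrow> 'p::prime_card mod_ring) set set"
  where "massey_products G T n = {H2_class G T (massey_tilde c 1 n) | c. defining_system G T n c}"

definition H2_Massey ::
  "('a, 'm) monoid_scheme \<Rightarrow> 'a topology \<Rightarrow> nat \<Rightarrow> ('a \<times> 'a \<Rightarrow> 'p::prime_card mod_ring) set set"
  where "H2_Massey G T n = generate (H2 G T) (massey_products G T n)"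

definition massey_kernel_condition ::
  "'p::prime_card itself \<Rightarrow> ('a, 'm) monoid_scheme \<Rightarrow> 'a topology \<Rightarrow> nat \<Rightarrow> bool"
  where "massey_kernel_condition _ G T n \<longleftrightarrow>
    (let N = zassenhaus CARD('p) G T n;
         Q = G Mod N;
         U = quotient_topology G T N
     in \<exists>A :: ('a set \<times> 'a set \<Rightarrow> 'p mod_ring) set set.
          A \<subseteq> massey_products Q U n \<and>
          kernel ((H2 Q U)\<lparr>carrier := H2_Massey Q U n\<rparr>) (H2 G T) (inflation G T N) =
            generate (H2 Q U) A)"

section \<open>Unipotent matrices\<close>

definition unipotent_group :: "nat \<Rightarrow> 'p::prime_card mod_ring mat monoid"
  where "unipotent_group k =
    \<lparr>carrier = {A \<in> carrier_mat k k. upper_triangular A \<and> (\<forall>i<k. A $$ (i, i) = 1)},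
     mult = (*), one = 1\<^sub>m k\<rparr>"

end

theory Submission
  imports Defs "Jordan_Normal_Form.Determinant" "HOL-Algebra.Weak_Morphisms"
begin

text \<open>
  Let \<open>S\<close> be the free group and \<open>\<pi> : S \<rightarrow> G\<close> the projection. First, \<open>S\<^sub>n\<close> is the intersection of the
  kernels of the representations of \<open>S\<close> in the unipotent group of size \<open>n\<close>. For this one uses a dual
  form of Jennings' theorem: an element outside \<open>S\<^sub>n\<close> is separated from 1 by a locally constant function
  with values in \<open>\<int>/p\<close> all of whose \<open>n\<close>-fold differences vanish, and freeness makes every such
  function a linear combination of matrix entries of unipotent representations.

  Now let \<open>\<sigma> \<in> S\<^sub>n\<close> be such that \<open>\<pi> \<sigma>\<close> is killed by all representations of \<open>G\<close> of size \<open>n + 1\<close>. Sums \<open>f\<close>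
  of upper right entries of representations of \<open>S\<close> of size \<open>n + 1\<close> are homomorphisms on \<open>S\<^sub>n\<close> which
  separate the points of \<open>S\<^sub>n/S\<^sub>n\<^sub>+\<^sub>1\<close>. If \<open>f\<close> vanishes on \<open>N\<close>, it descends to a cochain of \<open>G\<close> whose
  coboundary is inflated from a sum of Massey products of \<open>G/G\<^sub>n\<close>. By the kernel condition this sum is
  cohomologous to a sum of Massey products that become trivial in \<open>G\<close>, that is, whose defining
  systems come from representations of \<open>G\<close>; hence \<open>f \<sigma> = 0\<close>. By duality \<open>\<sigma> \<in> N S\<^sub>n\<^sub>+\<^sub>1\<close>.
\<close>

section \<open>Functions of bounded degree with respect to a filtration\<close>

text \<open>Jennings' theorem concerns the group algebra; dually one asks how far
  \<open>g - 1\<close> lowers the degree of a function. For locally constant functions such a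
  condition on \<open>g\<close> is closed, so the closures in the filtration cost nothing. Two
  degrees occur: one weighted by a filtration, which carries the induction over subgroups that
  builds a separating function, and the plain difference degree, which unipotent matrix entries have
  and which freeness allows to integrate. The kernel condition enters through one remark: a Massey
  product in a generating set of the kernel lies in the kernel itself, so a cochain trivialising it
  over G completes its defining system to a representation of G. The trivialisation obtained in this
  way differs from the given one by an inflated cochain and a homomorphism
  \<open>G \<rightarrow> \<int>/p\<close>. The latter vanishes on \<open>G\<^sub>n\<close> because
  \<open>n \<ge> 2\<close>; for \<open>n = 1\<close> the given function is itself such a
  homomorphism. The separating functions form a possibly infinite-dimensional space, so duality is
  applied to finitely many of them, selected by compactness.\<close>

definition left_diff :: "('a, 'm) monoid_scheme \<Rightarrow> 'a \<Rightarrow> ('a \<Rightarrow> 'b::ab_group_add) \<Rightarrow> 'a \<Rightarrow> 'b"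
  where "left_diff G h f = (\<lambda>x. f (h \<otimes>\<^bsub>G\<^esub> x) - f x)"

text \<open>
  \<open>f\<close> has degree less than \<open>k\<close> if its linear extension to the group algebra of \<open>K\<close> vanishes on all
  products \<open>(h\<^sub>1 - 1) \<dots> (h\<^sub>r - 1)\<close> with \<open>h\<^sub>j \<in> K \<inter> H i\<^sub>j\<close> and \<open>i\<^sub>1 + \<dots> + i\<^sub>r \<ge> k\<close>.
\<close>

fun filtered_degree_less ::
  "('a, 'm) monoid_scheme \<Rightarrow> (nat \<Rightarrow> 'a set) \<Rightarrow> 'a set \<Rightarrow> nat \<Rightarrow> ('a \<Rightarrow> 'b::ab_group_add) \<Rightarrow> bool"
  where
    "filtered_degree_less G H K 0 f \<longleftrightarrow> (\<forall>x\<in>K. f x = 0)"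
  | "filtered_degree_less G H K (Suc k) f \<longleftrightarrow>
      (\<forall>i. \<forall>h \<in> K \<inter> H (Suc i). filtered_degree_less G H K (k - i) (left_diff G h f))"

lemma (in group) inv_mult_cancel_left [simp]:
  "x \<in> carrier G \<Longrightarrow> y \<in> carrier G \<Longrightarrow> inv x \<otimes> (x \<otimes> y) = y"
  "x \<in> carrier G \<Longrightarrow> y \<in> carrier G \<Longrightarrow> x \<otimes> (inv x \<otimes> y) = y"
  by (simp_all flip: m_assoc)

text \<open>No commutator condition is imposed here, so that the same lemmas also serve the
  weighting that gives every nontrivial element weight 1 only, which is how
  \<open>difference_degree_less\<close> arises.\<close>

locale weighted_group = group G for G :: "('a, 'm) monoid_scheme" (structure) +
  fixes H :: "nat \<Rightarrow> 'a set"
  assumes filtration_1: "H 1 = carrier G"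
begin

abbreviation deg :: "'a set \<Rightarrow> nat \<Rightarrow> ('a \<Rightarrow> 'c::ab_group_add) \<Rightarrow> bool"
  where "deg \<equiv> filtered_degree_less G H"

lemma deg_cong:
  assumes "subgroup K G" "\<And>x. x \<in> K \<Longrightarrow> f x = f' x"
  shows "deg K k f \<longleftrightarrow> deg K k f'"
  using assms(2)
proof (induction k arbitrary: f f' rule: less_induct)
  case (less k)
  show ?case
  proof (cases k)
    case 0
    then show ?thesis using less.prems by simp
  next
    case (Suc l)
    have "deg K (l - i) (left_diff G h f) = deg K (l - i) (left_diff G h f')"
      if "h \<in> K" for i h
      by (rule less.IH)
        (use Suc that less.prems assms(1) in \<open>auto simp: left_diff_def subgroup.m_closed\<close>)
    then show ?thesis
      by (auto simp: Suc)
  qed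
qed

lemma deg_zero: "subgroup K G \<Longrightarrow> (\<And>x. x \<in> K \<Longrightarrow> f x = 0) \<Longrightarrow> deg K k f"
proof (induction k arbitrary: f rule: less_induct)
  case (less k)
  then show ?case
    by (cases k) (auto simp: left_diff_def subgroup.m_closed)
qed

lemma deg_add: "deg K k f \<Longrightarrow> deg K k f' \<Longrightarrow> deg K k (\<lambda>x. f x + f' x)"
proof (induction k arbitrary: f f' rule: less_induct)
  case (less k)
  show ?case
  proof (cases k)
    case 0
    then show ?thesis using less.prems by simp
  next
    case (Suc l)
    have "left_diff G h (\<lambda>x. f x + f' x) = (\<lambda>x. left_diff G h f x + left_diff G h f' x)" for h
      by (auto simp: left_diff_def)
    then show ?thesis
      using Suc less by auto
  qed
qed

lemma deg_additive_map:
  assumes "\<And>a b. \<phi> (a - b) = \<phi> a - \<phi> b" "deg K k f"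
  shows "deg K k (\<lambda>x. \<phi> (f x))"
  using assms(2)
proof (induction k arbitrary: f rule: less_induct)
  case (less k)
  have "\<phi> 0 = 0"
    using assms(1)[of 0 0] by simp
  show ?case
  proof (cases k)
    case 0
    then show ?thesis using less.prems \<open>\<phi> 0 = 0\<close> by simp
  next
    case (Suc l)
    have "left_diff G h (\<lambda>x. \<phi> (f x)) = (\<lambda>x. \<phi> (left_diff G h f x))" for h
      by (auto simp: left_diff_def assms(1))
    then show ?thesis
      using Suc less by auto
  qed
qed

lemma deg_uminus: "deg K k f \<Longrightarrow> deg K k (\<lambda>x. - f x)"
  by (rule deg_additive_map) auto

lemma deg_diff: "deg K k f \<Longrightarrow> deg K k f' \<Longrightarrow> deg K k (\<lambda>x. f x - f' x)"
  using deg_add[OF _ deg_uminus, of K k f f'] by simp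

lemma deg_mono:
  assumes "subgroup K G" "deg K k f" "k \<le> l"
  shows "deg K l f"
  using assms(2,3)
proof (induction l arbitrary: k f rule: less_induct)
  case (less l)
  show ?case
  proof (cases k)
    case 0
    show ?thesis
      by (rule deg_zero[OF assms(1)]) (use less.prems 0 in simp)
  next
    case (Suc k')
    then obtain l' where l': "l = Suc l'"
      using less.prems by (cases l) auto
    have "deg K (l' - i) (left_diff G h f)" if "h \<in> K \<inter> H (Suc i)" for h i
      by (rule less.IH[of _ "k' - i"]) (use that less.prems Suc l' in auto)
    then show ?thesis
      using l' by simp
  qed
qed

lemma deg_left_diff: "deg K k f \<Longrightarrow> h \<in> K \<Longrightarrow> h \<in> H i \<Longrightarrow> i \<ge> 1 \<Longrightarrow> subgroup K G \<Longrightarrow>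
    deg K (k - i) (left_diff G h f)"
  by (cases k; cases i) (auto simp: left_diff_def subgroup.m_closed)

text \<open>Truncated subtraction makes the degree bound 0 once \<open>k \<le> i\<close>, and bound
  0 means that the difference vanishes on \<open>K\<close>.\<close>

lemma deg_left_diff_zero:
  assumes "deg K k f" "h \<in> K" "h \<in> H i" "i \<ge> 1" "subgroup K G" "k \<le> i" "x \<in> K"
  shows "f (h \<otimes> x) = f x"
  using deg_left_diff[OF assms(1-5)] assms(6,7) by (simp add: left_diff_def)

lemma deg_translate:
  assumes "deg K k f" "h \<in> K" "subgroup K G"
  shows "deg K k (\<lambda>x. f (h \<otimes> x))"
proof -
  have "deg K (k - 1) (left_diff G h f)"
    using assms filtration_1 by (intro deg_left_diff) (auto simp: subgroup.mem_carrier)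
  then have "deg K k (left_diff G h f)"
    using assms(3) deg_mono by (metis diff_le_self)
  from deg_add[OF this assms(1)] show ?thesis
    by (simp add: left_diff_def)
qed

lemma deg_const:
  assumes "k \<ge> 1" "subgroup K G"
  shows "deg K k (\<lambda>_. c)"
proof -
  obtain l where "k = Suc l"
    using assms(1) by (cases k) auto
  moreover have "deg K j (left_diff G h (\<lambda>_. c))" for j h
    by (rule deg_zero[OF assms(2)]) (simp add: left_diff_def)
  ultimately show ?thesis
    by simp
qed

end

text \<open>An N-series. Together with \<open>pth_power_filtration\<close> below it becomes a
  restricted one, the setting of Jennings' theorem.\<close>

locale group_filtration = weighted_group +
  assumes subgroup_filtration: "i \<ge> 1 \<Longrightarrow> subgroup (H i) G"
    and filtration_Suc: "i \<ge> 1 \<Longrightarrow> H (Suc i) \<subseteq> H i"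
    and commutator_filtration:
      "\<lbrakk>i \<ge> 1; j \<ge> 1; x \<in> H i; y \<in> H j\<rbrakk> \<Longrightarrow> x \<otimes> y \<otimes> inv x \<otimes> inv y \<in> H (i + j)"
begin

lemma filtration_antimono: "1 \<le> i \<Longrightarrow> i \<le> j \<Longrightarrow> H j \<subseteq> H i"
proof (induction j)
  case (Suc j)
  show ?case
  proof (cases "i = Suc j")
    case False
    with Suc.prems have "i \<le> j"
      by linarith
    with Suc.prems(1) have "1 \<le> j"
      by linarith
    from filtration_Suc[OF this] Suc.IH[OF Suc.prems(1) \<open>i \<le> j\<close>] show ?thesis
      by (rule subset_trans)
  qed simp
qed simp

lemma filtration_carrier: "1 \<le> i \<Longrightarrow> x \<in> H i \<Longrightarrow> x \<in> carrier G"
  by (rule subgroup.mem_carrier[OF subgroup_filtration])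

text \<open>Normality of the terms comes from commutators with \<open>H 1\<close>, which is the
  whole group.\<close>

lemma conj_filtration:
  assumes "x \<in> H i" "i \<ge> 1" "g \<in> carrier G"
  shows "g \<otimes> x \<otimes> inv g \<in> H i"
proof -
  have "x \<in> carrier G"
    using assms filtration_carrier by auto
  have "g \<otimes> x \<otimes> inv g \<otimes> inv x \<in> H (1 + i)"
    using assms filtration_1 by (intro commutator_filtration) auto
  then have "g \<otimes> x \<otimes> inv g \<otimes> inv x \<in> H i"
    using filtration_Suc[OF \<open>i \<ge> 1\<close>] by auto
  then have "g \<otimes> x \<otimes> inv g \<otimes> inv x \<otimes> x \<in> H i"
    using assms subgroup_filtration subgroup.m_closed by metis
  then show ?thesis
    using \<open>x \<in> carrier G\<close> assms by (simp add: m_assoc)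
qed

text \<open>The degree is defined by left differences only. Right differences commute with them,
  which drives the induction; at its end \<open>x z = (x z x^-1) x\<close>, and the conjugate has
  the same weight as \<open>z\<close>.\<close>

lemma deg_right_diff:
  assumes "deg K k f" "z \<in> K" "z \<in> H i" "i \<ge> 1" "subgroup K G"
  shows "deg K (k - i) (\<lambda>x. f (x \<otimes> z) - f x)"
  using assms(1)
proof (induction k arbitrary: f rule: less_induct)
  case (less k)
  interpret K: subgroup K G by fact
  show ?case
  proof (cases "k \<le> i")
    case True
    have "f (x \<otimes> z) = f x" if "x \<in> K" for x
    proof -
      have "x \<otimes> z = (x \<otimes> z \<otimes> inv x) \<otimes> x"
        using that assms(2) by (simp add: m_assoc)
      moreover have "f ((x \<otimes> z \<otimes> inv x) \<otimes> x) = f x"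
        by (rule deg_left_diff_zero[OF less.prems, of _ i])
          (use True that assms conj_filtration[of z i x] in auto)
      ultimately show ?thesis by simp
    qed
    then show ?thesis
      using True by simp
  next
    case False
    then obtain m where m: "k - i = Suc m"
      by (metis diff_is_0_eq not0_implies_Suc)
    have "deg K (m - j) (left_diff G h (\<lambda>x. f (x \<otimes> z) - f x))" if h: "h \<in> K \<inter> H (Suc j)" for j h
    proof -
      have "deg K (k - Suc j - i) (\<lambda>x. left_diff G h f (x \<otimes> z) - left_diff G h f x)"
        using h less.prems m assms(5) by (intro less.IH deg_left_diff) auto
      moreover have "k - Suc j - i = m - j"
        using m by simp
      moreover have "left_diff G h (\<lambda>x. f (x \<otimes> z) - f x) x = left_diff G h f (x \<otimes> z) - left_diff G h f x"
        if "x \<in> K" for x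
        using that h assms(2) by (simp add: left_diff_def m_assoc)
      ultimately show ?thesis
        by (subst deg_cong[OF assms(5)]) auto
    qed
    then show ?thesis
      by (simp add: m)
  qed
qed

text \<open>Conjugation by \<open>g\<close> moves \<open>h\<close> by the commutator
  \<open>c h\<close>, whose weight exceeds that of \<open>h\<close> by \<open>w\<close>. The element
  \<open>g\<close> has to normalise \<open>K\<close> but may lie outside it.\<close>

lemma deg_conj_diff:
  assumes "deg K k f" "g \<in> H w" "w \<ge> 1" "subgroup K G" "\<And>x. x \<in> K \<Longrightarrow> g \<otimes> x \<otimes> inv g \<in> K"
  shows "deg K (k - w) (\<lambda>x. f (g \<otimes> x \<otimes> inv g) - f x)"
  using assms(1)
proof (induction k arbitrary: f rule: less_induct)
  case (less k)
  interpret K: subgroup K G by fact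
  have g: "g \<in> carrier G"
    using assms filtration_carrier by auto
  define c where "c h = g \<otimes> h \<otimes> inv g \<otimes> inv h" for h
  have c: "c h \<in> K" "c h \<in> H (w + i)" "g \<otimes> h \<otimes> inv g = c h \<otimes> h"
    if "h \<in> K" "h \<in> H i" "i \<ge> 1" for h i
  proof -
    show "c h \<in> K"
      unfolding c_def by (intro K.m_closed K.m_inv_closed assms(5) that)
    show "c h \<in> H (w + i)"
      unfolding c_def using that assms by (intro commutator_filtration)
    show "g \<otimes> h \<otimes> inv g = c h \<otimes> h"
      using that g by (simp add: c_def m_assoc)
  qed
  show ?case
  proof (cases "k \<le> w")
    case True
    have "f (g \<otimes> x \<otimes> inv g) = f x" if "x \<in> K" for x
    proof -
      have "x \<in> H 1" using that filtration_1 by simp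
      note cx = c[OF that this]
      show ?thesis
        unfolding cx(3)[simplified]
        by (rule deg_left_diff_zero[OF less.prems, of _ "w + 1"])
          (use True that assms cx in auto)
    qed
    then show ?thesis
      using True by simp
  next
    case False
    then obtain m where m: "k - w = Suc m"
      by (metis diff_is_0_eq not0_implies_Suc)
    have "deg K (m - j) (left_diff G h (\<lambda>x. f (g \<otimes> x \<otimes> inv g) - f x))" if h: "h \<in> K \<inter> H (Suc j)" for j h
    proof -
      define h' where "h' = g \<otimes> h \<otimes> inv g"
      have h': "h' \<in> K" "h' \<in> H (Suc j)"
        using h g assms conj_filtration by (auto simp: h'_def)
      have hc: "c h \<in> K" "c h \<in> H (w + Suc j)" "h' = c h \<otimes> h"
        using c[of h "Suc j"] h by (auto simp: h'_def)
      have 1: "deg K (k - Suc j - w) (\<lambda>x. left_diff G h' f (g \<otimes> x \<otimes> inv g) - left_diff G h' f x)"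
        using h' less.prems m assms(4) by (intro less.IH deg_left_diff) auto
      have "deg K (k - (w + Suc j)) (left_diff G (c h) f)"
        using hc less.prems assms by (intro deg_left_diff) auto
      then have 2: "deg K (k - (w + Suc j)) (\<lambda>x. left_diff G (c h) f (h \<otimes> x))"
        using h assms(4) by (intro deg_translate) auto
      have eq: "k - Suc j - w = m - j" "k - (w + Suc j) = m - j"
        using m by simp_all
      \<comment> \<open>The conjugate of \<open>h x\<close> starts with
        \<open>h' = c h \<otimes> h\<close> rather than with \<open>h\<close>. Correcting this costs
        a difference by \<open>c h\<close>, whose weight \<open>w + Suc j\<close> lowers the degree
        far enough.\<close>
      have "left_diff G h (\<lambda>x. f (g \<otimes> x \<otimes> inv g) - f x) x =
          left_diff G h' f (g \<otimes> x \<otimes> inv g) - left_diff G h' f x + left_diff G (c h) f (h \<otimes> x)"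
        if "x \<in> K" for x
      proof -
        have x: "x \<in> carrier G" "h \<in> carrier G" "c h \<in> carrier G" using that h hc(1) by auto
        have "h' \<otimes> (g \<otimes> x \<otimes> inv g) = g \<otimes> (h \<otimes> x) \<otimes> inv g"
          using x g by (simp add: h'_def m_assoc)
        moreover have "h' \<otimes> x = c h \<otimes> (h \<otimes> x)"
          using x by (simp add: hc(3) m_assoc)
        ultimately show ?thesis
          by (simp add: left_diff_def)
      qed
      then show ?thesis
        by (subst deg_cong[OF assms(4)]) (use deg_add[OF 1[unfolded eq] 2[unfolded eq]] in auto)
    qed
    then show ?thesis
      by (simp add: m)
  qed
qed

lemma deg_conj:
  assumes "deg K k f" "g \<in> carrier G" "subgroup K G" "\<And>x. x \<in> K \<Longrightarrow> g \<otimes> x \<otimes> inv g \<in> K"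
  shows "deg K k (\<lambda>x. f (g \<otimes> x \<otimes> inv g))"
proof -
  have "deg K (k - 1) (\<lambda>x. f (g \<otimes> x \<otimes> inv g) - f x)"
    by (rule deg_conj_diff) (use assms filtration_1 in auto)
  then have "deg K k (\<lambda>x. f (g \<otimes> x \<otimes> inv g) - f x)"
    by (rule deg_mono[OF assms(3)]) simp
  from deg_add[OF this assms(1)] show ?thesis
    by simp
qed

end

section \<open>Dual of Jennings' theorem for a restricted filtration\<close>

lemma of_nat_choose_prime_card_eq_0:
  assumes "0 < e" "e < CARD('p)"
  shows "of_nat (CARD('p::prime_card) choose e) = (0 :: 'p mod_ring)"
proof -
  have "CARD('p) dvd (CARD('p) choose e)"
    using assms prime_card by (intro dvd_choose_prime) auto
  then show ?thesis
    by (auto simp: dvd_def)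
qed

lemma (in group) subgroup_nat_pow_closed:
  "subgroup K G \<Longrightarrow> x \<in> K \<Longrightarrow> x [^] (n :: nat) \<in> K"
  by (induction n) (auto simp: subgroup.one_closed subgroup.m_closed)

context group_filtration
begin

definition pth_power_filtration :: "nat \<Rightarrow> bool"
  where "pth_power_filtration p \<longleftrightarrow> (\<forall>i\<ge>1. \<forall>x\<in>H i. x [^] p \<in> H (p * i))"

text \<open>
  In the group algebra, \<open>F e\<close> below is the function \<open>x \<mapsto> f (x (g - 1)\<^sup>e)\<close> on \<open>K\<close>, where \<open>g\<close> generates \<open>P/K\<close>.
\<close>

lemma deg_induced:
  fixes f :: "'a \<Rightarrow> 'p::prime_card mod_ring" and F :: "nat \<Rightarrow> 'a \<Rightarrow> 'p mod_ring"
  assumes pth: "pth_power_filtration CARD('p)"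
    and P: "subgroup P G" and K: "subgroup K G" "K \<subseteq> P"
    and w: "w \<ge> 1" "P \<subseteq> H w" "P \<inter> H (Suc w) \<subseteq> K"
    and g: "g \<in> P" "g [^] CARD('p) \<in> K"
    and decomp: "\<And>y. y \<in> P \<Longrightarrow> \<exists>x\<in>K. \<exists>a<CARD('p). y = x \<otimes> g [^] a"
    and F: "\<And>e. e < CARD('p) \<Longrightarrow> deg K (k - e * w) (F e)"
    and f: "\<And>x a. x \<in> K \<Longrightarrow> a < CARD('p) \<Longrightarrow>
      f (x \<otimes> g [^] a) = (\<Sum>e<CARD('p). of_nat (a choose e) * F e x)"
  shows "deg P k f"
  using F f
proof (induction k arbitrary: f F rule: less_induct)
  case (less k)
  interpret P: subgroup P G by fact
  interpret K: subgroup K G by fact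
  let ?p = "CARD('p)"
  have "prime ?p"
    by (rule prime_card)
  then obtain q where q: "?p = Suc q"
    using prime_gt_0_nat gr0_implies_Suc by blast
  have gG: "g \<in> carrier G"
    using g by auto
  \<comment> \<open>Commutators of elements of \<open>P\<close> have weight at least
    \<open>w + w\<close>, hence lie in \<open>P \<inter> H (Suc w)\<close> and so in
    \<open>K\<close>.\<close>
  have norm: "g \<otimes> x \<otimes> inv g \<in> K" if "x \<in> K" for x
  proof -
    have x: "x \<in> carrier G"
      using that by auto
    have "g \<otimes> x \<otimes> inv g \<otimes> inv x \<in> H (w + w)"
      using that g w K by (intro commutator_filtration) auto
    moreover have "H (w + w) \<subseteq> H (Suc w)"
      using w by (intro filtration_antimono) auto
    moreover have "g \<otimes> x \<otimes> inv g \<otimes> inv x \<in> P"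
      using that g K by auto
    ultimately have "g \<otimes> x \<otimes> inv g \<otimes> inv x \<in> K"
      using w by auto
    then have "g \<otimes> x \<otimes> inv g \<otimes> inv x \<otimes> x \<in> K"
      using that by auto
    then show ?thesis
      using x gG by (simp add: m_assoc)
  qed
  show ?case
  proof (cases k)
    case 0
    have "f y = 0" if y: "y \<in> P" for y
    proof -
      obtain x a where xa: "x \<in> K" "a < ?p" "y = x \<otimes> g [^] a"
        using decomp[OF y] by blast
      have "F e x = 0" if "e < ?p" for e
        using less.prems(1)[OF that] xa 0 by simp
      then show ?thesis
        using less.prems(2)[OF xa(1,2)] xa(3) by simp
    qed
    then show ?thesis
      using 0 by simp
  next
    case (Suc l)
    \<comment> \<open>A left difference by an element of \<open>K\<close> acts on each coefficient
      \<open>F e\<close> separately.\<close>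
    have case_K: "deg P (k - j) (left_diff G h f)" if h: "h \<in> K" "h \<in> H j" "j \<ge> 1" for h j
    proof (rule less.IH[of "k - j" "\<lambda>e. left_diff G h (F e)"])
      show "k - j < k"
        using Suc that by simp
      show "deg K (k - j - e * w) (left_diff G h (F e))" if "e < ?p" for e
        using deg_left_diff[OF less.prems(1)[OF that] h K(1)] by (simp add: add.commute)
      fix x a assume xa: "x \<in> K" "a < ?p"
      then have "h \<otimes> (x \<otimes> g [^] a) = (h \<otimes> x) \<otimes> g [^] a"
        using h gG by (simp add: m_assoc)
      then show "left_diff G h f (x \<otimes> g [^] a) = (\<Sum>e<?p. of_nat (a choose e) * left_diff G h (F e) x)"
        using less.prems(2)[of "h \<otimes> x" a] less.prems(2)[of x a] xa h
        by (simp add: left_diff_def right_diff_distrib sum_subtractf)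
    qed
    have case_g: "deg P (k - w) (left_diff G g f)"
    proof -
      \<comment> \<open>The value at \<open>e = p\<close> continues the sequence: in characteristic
        p one has \<open>(g - 1)^p = g^p - 1\<close>, and \<open>g^p\<close> lies in
        \<open>K\<close>, so this coefficient is a right difference of \<open>F 0\<close>. Its
        degree is controlled by the weight \<open>p * w\<close> of \<open>g^p\<close>.\<close>
      define F' where "F' e = (if e < ?p then F e else (\<lambda>x. F 0 (x \<otimes> g [^] ?p) - F 0 x))" for e
      have F': "deg K (k - e * w) (F' e)" if "e \<le> ?p" for e
      proof (cases "e < ?p")
        case True
        then show ?thesis
          using less.prems(1) by (simp add: F'_def)
      next
        case False
        have "g [^] ?p \<in> H (?p * w)"
          using pth w g unfolding pth_power_filtration_def by blast
        then have "deg K (k - ?p * w) (\<lambda>x. F 0 (x \<otimes> g [^] ?p) - F 0 x)"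
          using less.prems(1)[of 0] g w q K by (intro deg_right_diff) auto
        then show ?thesis
          using False that by (simp add: F'_def)
      qed
      \<comment> \<open>This is \<open>g^(a+1) = g^a (1 + (g - 1))\<close>, i.e. Pascal's rule. The
        exponent \<open>a = p - 1\<close> is special because the expansion of \<open>f\<close> is
        available only below p; there the power wraps around into \<open>K\<close>.\<close>
      have shift: "f (y \<otimes> g [^] Suc a) = (\<Sum>e<?p. of_nat (a choose e) * (F e y + F' (Suc e) y))"
        if "y \<in> K" "a < ?p" for y a
      proof (cases "a = q")
        case False
        then have a: "Suc a < ?p" "a choose q = 0"
          using that q by auto
        have "f (y \<otimes> g [^] Suc a) = (\<Sum>e<?p. of_nat (Suc a choose e) * F e y)"
          by (rule less.prems(2)[OF that(1) a(1)])
        also have "\<dots> = F 0 y + (\<Sum>e<q. of_nat (Suc a choose Suc e) * F (Suc e) y)"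
          unfolding q by (subst sum.lessThan_Suc_shift) simp
        also have "\<dots> = F 0 y + (\<Sum>e<q. of_nat (a choose Suc e) * F (Suc e) y) +
            (\<Sum>e<q. of_nat (a choose e) * F (Suc e) y)"
          by (simp add: algebra_simps sum.distrib)
        also have "F 0 y + (\<Sum>e<q. of_nat (a choose Suc e) * F (Suc e) y) =
            (\<Sum>e<?p. of_nat (a choose e) * F e y)"
          unfolding q by (subst sum.lessThan_Suc_shift) simp
        also have "(\<Sum>e<q. of_nat (a choose e) * F (Suc e) y) =
            (\<Sum>e<?p. of_nat (a choose e) * F' (Suc e) y)"
          using a(2) unfolding q by (simp add: F'_def q binomial_eq_0)
        finally show ?thesis
          by (simp add: algebra_simps sum.distrib)
      next
        case True
        have "y \<otimes> g [^] ?p \<in> K"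
          using that g by auto
        then have "f (y \<otimes> g [^] Suc a) = (\<Sum>e<?p. of_nat (0 choose e) * F e (y \<otimes> g [^] ?p))"
          using less.prems(2)[of "y \<otimes> g [^] ?p" 0] q True by simp
        also have "\<dots> = F 0 (y \<otimes> g [^] ?p)"
          unfolding q by (subst sum.lessThan_Suc_shift) simp
        finally have 1: "f (y \<otimes> g [^] Suc a) = F 0 (y \<otimes> g [^] ?p)" .
        let ?S = "\<Sum>e<q. of_nat (q choose Suc e) * F (Suc e) y" and ?T = "\<Sum>e<q. of_nat (q choose e) * F (Suc e) y"
        \<comment> \<open>Pascal's rule combines both sums into the inner binomial coefficients of
          p, which vanish modulo p.\<close>
        have "?S + ?T = (\<Sum>e<q. of_nat (?p choose Suc e) * F (Suc e) y)"
          by (simp add: q algebra_simps sum.distrib)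
        also have "\<dots> = 0"
          by (rule sum.neutral)
            (use of_nat_choose_prime_card_eq_0[where 'p='p] q in \<open>auto simp del: binomial_Suc_Suc\<close>)
        finally have 0: "?S + ?T = 0" .
        have "(\<Sum>e<?p. of_nat (a choose e) * (F e y + F' (Suc e) y)) =
            (\<Sum>e<?p. of_nat (a choose e) * F e y) + (\<Sum>e<?p. of_nat (a choose e) * F' (Suc e) y)"
          by (simp only: distrib_left sum.distrib)
        also have "(\<Sum>e<?p. of_nat (a choose e) * F e y) = F 0 y + ?S"
          unfolding q True by (subst sum.lessThan_Suc_shift) simp
        also have "(\<Sum>e<?p. of_nat (a choose e) * F' (Suc e) y) = ?T + (F 0 (y \<otimes> g [^] ?p) - F 0 y)"
          unfolding q True by (simp add: F'_def q)
        also have "F 0 y + ?S + \<dots> = F 0 (y \<otimes> g [^] ?p) + (?S + ?T)"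
          by (simp only: algebra_simps)
        finally show ?thesis
          unfolding 0 1 by simp
      qed
      show ?thesis
      \<comment> \<open>Moving \<open>g\<close> past \<open>x\<close> replaces \<open>x\<close> by
        its conjugate and raises the exponent of \<open>g\<close> by one. The bracket is controlled
        by \<open>deg_conj_diff\<close>; the other term gains its weight \<open>w\<close> by passing
        from \<open>e\<close> to \<open>Suc e\<close>.\<close>
      proof (rule less.IH[of "k - w" "\<lambda>e x. (F e (g \<otimes> x \<otimes> inv g) - F e x) + F' (Suc e) (g \<otimes> x \<otimes> inv g)"])
        show "k - w < k"
          using Suc w by simp
        show "deg K (k - w - e * w) (\<lambda>x. (F e (g \<otimes> x \<otimes> inv g) - F e x) + F' (Suc e) (g \<otimes> x \<otimes> inv g))"
          if "e < ?p" for e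
        proof (rule deg_add)
          have "deg K (k - e * w - w) (\<lambda>x. F e (g \<otimes> x \<otimes> inv g) - F e x)"
            using less.prems(1)[OF that] g w K norm by (intro deg_conj_diff) auto
          then show "deg K (k - w - e * w) (\<lambda>x. F e (g \<otimes> x \<otimes> inv g) - F e x)"
            by (simp add: add.commute)
          have "deg K (k - Suc e * w) (\<lambda>x. F' (Suc e) (g \<otimes> x \<otimes> inv g))"
            using that gG K norm by (intro deg_conj F') auto
          then show "deg K (k - w - e * w) (\<lambda>x. F' (Suc e) (g \<otimes> x \<otimes> inv g))"
            by simp
        qed
        fix x a assume xa: "x \<in> K" "a < ?p"
        have "g \<otimes> (x \<otimes> g [^] a) = (g \<otimes> x \<otimes> inv g) \<otimes> g [^] Suc a"
          unfolding nat_pow_Suc2[OF gG] using xa gG by (simp add: m_assoc)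
        then show "left_diff G g f (x \<otimes> g [^] a) = (\<Sum>e<?p. of_nat (a choose e) *
            ((F e (g \<otimes> x \<otimes> inv g) - F e x) + F' (Suc e) (g \<otimes> x \<otimes> inv g)))"
          using shift[of "g \<otimes> x \<otimes> inv g" a] less.prems(2)[OF xa] norm xa
          by (simp add: left_diff_def algebra_simps sum.distrib sum_subtractf)
      qed
    qed
    \<comment> \<open>From \<open>h h' - 1 = (h - 1) h' + (h' - 1)\<close>: lowering the degree by
      \<open>w\<close> passes to products, hence from \<open>K\<close> and \<open>g\<close> to all
      of \<open>P\<close>.\<close>
    have mult: "deg P (k - w) (left_diff G (h \<otimes> h') f)"
      if "h \<in> P" "h' \<in> P" "deg P (k - w) (left_diff G h f)" "deg P (k - w) (left_diff G h' f)" for h h'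
    proof -
      have 1: "deg P (k - w) (\<lambda>x. left_diff G h f (h' \<otimes> x) + left_diff G h' f x)"
        using that P by (intro deg_add deg_translate) auto
      show ?thesis
        by (subst deg_cong[OF P, where f' = "\<lambda>x. left_diff G h f (h' \<otimes> x) + left_diff G h' f x"])
          (use 1 that in \<open>auto simp: left_diff_def m_assoc\<close>)
    qed
    have pow: "deg P (k - w) (left_diff G (g [^] a) f)" for a :: nat
    proof (induction a)
      case 0
      show ?case
        by (rule deg_zero[OF P]) (auto simp: left_diff_def)
    next
      case (Suc a)
      then show ?case
        using mult[of "g [^] a" g] case_g g subgroup_nat_pow_closed[OF P g(1), of a] by simp
    qed
    have "deg P (l - i) (left_diff G h f)" if h: "h \<in> P" "h \<in> H (Suc i)" for h i
    proof (cases "h \<in> K")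
      case True
      then show ?thesis
        using case_K[of h "Suc i"] h Suc by simp
    next
      case False
      \<comment> \<open>An element of \<open>P\<close> outside \<open>K\<close> has weight at most
        \<open>w\<close>, so the drop by \<open>w\<close> available for every element of
        \<open>P\<close> suffices.\<close>
      have "Suc i \<le> w"
      proof (rule ccontr)
        assume "\<not> Suc i \<le> w"
        then have "H (Suc i) \<subseteq> H (Suc w)"
          by (intro filtration_antimono) auto
        then show False
          using False h w by blast
      qed
      obtain x a where xa: "x \<in> K" "a < ?p" "h = x \<otimes> g [^] a"
        using decomp[OF h(1)] by blast
      have "deg P (k - w) (left_diff G h f)"
        unfolding xa(3) using xa K w g by (intro mult pow case_K subgroup_nat_pow_closed[OF P]) auto
      then show ?thesis
        by (rule deg_mono[OF P]) (use \<open>Suc i \<le> w\<close> Suc in simp)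
    qed
    then show ?thesis
      by (simp add: Suc)
  qed
qed

text \<open>Induction on the number of cosets of \<open>H n\<close> met by \<open>P\<close>. Choose
  \<open>K\<close> of index p in \<open>P\<close>, generated modulo \<open>K\<close> by
  \<open>g\<close>, and write \<open>h = \<kappa> g^a\<close>. Either a function on \<open>K\<close>
  separating \<open>\<kappa>\<close> from 1 is extended constantly along the powers of
  \<open>g\<close>, or \<open>\<kappa>\<close> lies in \<open>H n\<close> and the exponent
  \<open>a\<close> modulo p does the separating. \<open>deg_induced\<close> bounds the degree in
  both cases.\<close>

lemma deg_separates:
  fixes P :: "'a set" and h :: 'a
  assumes pth: "pth_power_filtration CARD('p::prime_card)"
    and n: "n \<ge> 1" and fin: "finite ((\<lambda>x. H n #> x) ` carrier G)"
    and P: "subgroup P G" and h: "h \<in> P" "h \<notin> H n"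
  shows "\<exists>f :: 'a \<Rightarrow> 'p mod_ring. deg P n f \<and> f h \<noteq> f \<one>"
  using P h
proof (induction "card ((\<lambda>x. H n #> x) ` P)" arbitrary: P h rule: less_induct)
  case less
  define C where "C X = card ((\<lambda>x. H n #> x) ` X)" for X
  let ?p = "CARD('p)"
  interpret P: subgroup P G by fact
  have p: "prime ?p"
    by (rule prime_card)
  have "\<exists>w\<ge>1. P \<subseteq> H w \<and> \<not> P \<subseteq> H (Suc w)"
  proof (rule ccontr)
    assume *: "\<not> ?thesis"
    have "P \<subseteq> H (Suc w)" for w
    proof (induction w)
      case 0
      then show ?case
        using filtration_1 P.subset by simp
    next
      case (Suc w)
      then show ?case
        using * by simp
    qed
    from this[of "n - 1"] n less.prems show False
      by auto
  qed
  then obtain w where w: "w \<ge> 1" "P \<subseteq> H w" "\<not> P \<subseteq> H (Suc w)"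
    by blast
  have "w < n"
  proof (rule ccontr)
    assume "\<not> w < n"
    then have "H w \<subseteq> H n"
      using n by (intro filtration_antimono) auto
    then show False
      using w less.prems by blast
  qed
  have HK: "H n \<subseteq> H (Suc w)"
    using \<open>w < n\<close> by (intro filtration_antimono) auto
  define \<K> where "\<K> = {K. subgroup K G \<and> K \<subseteq> P \<and> P \<inter> H (Suc w) \<subseteq> K \<and> K \<noteq> P}"
  have "P \<inter> H (Suc w) \<in> \<K>"
    unfolding \<K>_def using subgroups_Inter_pair[OF less.prems(1) subgroup_filtration[of "Suc w"]] w by auto
  moreover have "C K < Suc (C (carrier G))" if "K \<in> \<K>" for K
  proof -
    have "K \<subseteq> carrier G"
      using that P.subset by (auto simp: \<K>_def)
    then show ?thesis
      unfolding C_def using fin by (intro le_imp_less_Suc card_mono image_mono)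
  qed
  \<comment> \<open>A maximal proper subgroup of \<open>P\<close> above
    \<open>P \<inter> H (Suc w)\<close>. The count \<open>C\<close> of cosets of \<open>H n\<close>
    replaces the order of a possibly infinite group.\<close>
  ultimately obtain K where K: "K \<in> \<K>" and K_max: "\<And>L. L \<in> \<K> \<Longrightarrow> C L \<le> C K"
    using ex_has_greatest_nat[of "\<lambda>K. K \<in> \<K>" "P \<inter> H (Suc w)" C] by blast
  then interpret K: subgroup K G
    by (simp add: \<K>_def)
  have KP: "K \<subseteq> P" "P \<inter> H (Suc w) \<subseteq> K" "K \<noteq> P"
    using K by (auto simp: \<K>_def)
  then obtain g where g: "g \<in> P" "g \<notin> K"
    by blast
  have gG: "g \<in> carrier G"
    using g by auto
  \<comment> \<open>The count grows strictly: since \<open>P \<inter> H n\<close> is contained in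
    \<open>K\<close>, an element of \<open>P\<close> outside \<open>K\<close> meets a coset of
    \<open>H n\<close> that \<open>K\<close> misses.\<close>
  have C_less: "C K < C L" if L: "K \<subseteq> L" "L \<subseteq> P" "g \<in> L" for L
  proof -
    have "H n #> g \<noteq> H n #> x" if x: "x \<in> K" for x
    proof
      assume "H n #> g = H n #> x"
      then have "g \<in> H n #> x"
        using rcos_self[OF gG subgroup_filtration[OF n]] by simp
      then obtain m where m: "m \<in> H n" "g = m \<otimes> x"
        by (auto simp: r_coset_def)
      then have "m = g \<otimes> inv x"
        using x filtration_carrier[OF n] gG by (simp add: m_assoc)
      then have "m \<in> P"
        using x KP g by auto
      then have "m \<in> K"
        using m HK KP by blast
      then show False
        using m x g by simp
    qed
    then have "H n #> g \<notin> (\<lambda>x. H n #> x) ` K"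
      by blast
    moreover have "H n #> g \<in> (\<lambda>x. H n #> x) ` L" "(\<lambda>x. H n #> x) ` K \<subseteq> (\<lambda>x. H n #> x) ` L"
      using L by blast+
    ultimately have "(\<lambda>x. H n #> x) ` K \<subset> (\<lambda>x. H n #> x) ` L"
      by blast
    moreover have "finite ((\<lambda>x. H n #> x) ` L)"
      by (rule finite_subset[OF _ fin]) (use L P.subset in auto)
    ultimately show ?thesis
      unfolding C_def by (rule psubset_card_mono[rotated])
  qed
  have norm: "y \<otimes> x \<otimes> inv y \<in> K" if "x \<in> K" "y \<in> P" for x y
  proof -
    have xy: "x \<in> carrier G" "y \<in> carrier G" "x \<in> P"
      using that KP by auto
    have "y \<otimes> x \<otimes> inv y \<otimes> inv x \<in> H (w + w)"
      using that w KP by (intro commutator_filtration) auto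
    moreover have "H (w + w) \<subseteq> H (Suc w)"
      using w by (intro filtration_antimono) auto
    moreover have "y \<otimes> x \<otimes> inv y \<otimes> inv x \<in> P"
      using that xy by auto
    ultimately have "y \<otimes> x \<otimes> inv y \<otimes> inv x \<in> K"
      using KP by auto
    then have "y \<otimes> x \<otimes> inv y \<otimes> inv x \<otimes> x \<in> K"
      using that by auto
    then show ?thesis
      using xy by (simp add: m_assoc)
  qed
  have gp: "g [^] ?p \<in> K"
  proof -
    have "g [^] ?p \<in> H (?p * w)"
      using pth w g unfolding pth_power_filtration_def by blast
    moreover have "Suc w \<le> ?p * w"
    proof -
      have "2 * w \<le> ?p * w"
        using prime_ge_2_nat[OF p] by (intro mult_right_mono) auto
      then show ?thesis
        using w by linarith
    qed
    then have "H (?p * w) \<subseteq> H (Suc w)"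
      by (intro filtration_antimono) auto
    moreover have "g [^] ?p \<in> P"
      by (rule subgroup_nat_pow_closed[OF less.prems(1) g(1)])
    ultimately show ?thesis
      using KP(2) by blast
  qed
  define L where "L = {x \<otimes> g [^] a | x (a :: int). x \<in> K}"
  have gP: "g [^] a \<in> P" for a :: int
    by (rule subgroup_int_pow_closed[OF less.prems(1) g(1)])
  have "L \<subseteq> P"
    using KP gP by (auto simp: L_def)
  have "K \<subseteq> L"
    unfolding L_def by (force intro: exI[of _ "0::int"])
  have "g \<in> L"
    unfolding L_def using gG by (force intro: exI[of _ "1::int"] exI[of _ "\<one>"])
  have "subgroup L G"
  proof (rule subgroupI)
    show "L \<subseteq> carrier G"
      using \<open>L \<subseteq> P\<close> P.subset by blast
    show "L \<noteq> {}"
      using \<open>g \<in> L\<close> by blast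
  next
    fix y assume "y \<in> L"
    then obtain x and a :: int where xa: "x \<in> K" "y = x \<otimes> g [^] a"
      by (auto simp: L_def)
    have "inv y = (g [^] (-a) \<otimes> inv x \<otimes> inv (g [^] (-a))) \<otimes> g [^] (-a)"
      using xa gG by (simp add: m_assoc inv_mult_group int_pow_neg)
    then show "inv y \<in> L"
      unfolding L_def using norm[of "inv x" "g [^] (-a)"] gP xa by blast
  next
    fix y z assume "y \<in> L" "z \<in> L"
    then obtain x x' and a b :: int where xa: "x \<in> K" "y = x \<otimes> g [^] a" "x' \<in> K" "z = x' \<otimes> g [^] b"
      by (auto simp: L_def)
    have "y \<otimes> z = (x \<otimes> (g [^] a \<otimes> x' \<otimes> inv (g [^] a))) \<otimes> g [^] (a + b)"
      using xa gG by (simp add: m_assoc int_pow_mult)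
    then show "y \<otimes> z \<in> L"
      unfolding L_def using norm[of x' "g [^] a"] gP xa by blast
  qed
  \<comment> \<open>\<open>L\<close> is the subgroup generated by \<open>K\<close> and
    \<open>g\<close>, so it exhausts \<open>P\<close> by maximality of \<open>K\<close>.\<close>
  have "L = P"
  proof (rule ccontr)
    assume "L \<noteq> P"
    then have "L \<in> \<K>"
      using \<open>subgroup L G\<close> \<open>L \<subseteq> P\<close> \<open>K \<subseteq> L\<close> KP by (auto simp: \<K>_def)
    then show False
      using K_max[of L] C_less[of L] \<open>L \<subseteq> P\<close> \<open>K \<subseteq> L\<close> \<open>g \<in> L\<close> by simp
  qed
  have decomp: "\<exists>x\<in>K. \<exists>a<?p. y = x \<otimes> g [^] a" if "y \<in> P" for y
  proof -
    have "y \<in> L"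
      using that \<open>L = P\<close> by simp
    then obtain x and a :: int where xa: "x \<in> K" "y = x \<otimes> g [^] a"
      by (auto simp: L_def)
    have "g [^] a = g [^] (int ?p * (a div int ?p) + a mod int ?p)"
      by simp
    also have "\<dots> = (g [^] ?p) [^] (a div int ?p) \<otimes> g [^] nat (a mod int ?p)"
    proof -
      have "g [^] (int ?p * (a div int ?p)) = (g [^] ?p) [^] (a div int ?p)"
        using gG by (simp add: int_pow_pow flip: int_pow_int)
      moreover have "g [^] (a mod int ?p) = g [^] nat (a mod int ?p)"
        using prime_gt_0_nat[OF p] by (simp flip: int_pow_int)
      ultimately show ?thesis
        using int_pow_mult[OF gG, of "int ?p * (a div int ?p)" "a mod int ?p"] by metis
    qed
    finally have "y = (x \<otimes> (g [^] ?p) [^] (a div int ?p)) \<otimes> g [^] nat (a mod int ?p)"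
      using xa gG by (simp add: m_assoc)
    moreover have "x \<otimes> (g [^] ?p) [^] (a div int ?p) \<in> K"
      using xa gp subgroup_int_pow_closed[OF K.subgroup_axioms gp] by auto
    moreover have "nat (a mod int ?p) < ?p"
      using prime_gt_0_nat[OF p] by (simp add: nat_less_iff)
    ultimately show ?thesis
      by blast
  qed
  \<comment> \<open>The order of \<open>g\<close> modulo \<open>K\<close> is exactly p: a smaller
    positive exponent is coprime to p, and Bezout would put \<open>g\<close> into \<open>K\<close>.
    Hence the decomposition \<open>x g^a\<close> with \<open>a < p\<close> is unique.\<close>
  have g_pow: "d = 0" if d: "g [^] d \<in> K" "d < ?p" for d
  proof (rule ccontr)
    assume "d \<noteq> 0"
    then have "coprime d ?p"
      using d p by (metis coprime_commute nat_dvd_not_less neq0_conv prime_imp_coprime)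
    then have "gcd (int d) (int ?p) = 1"
      by simp
    then obtain u v where uv: "u * int d + v * int ?p = 1"
      using bezout_int[of "int d" "int ?p"] by auto
    have "g = g [^] (int d * u + int ?p * v)"
      using uv gG by (simp add: mult.commute)
    also have "\<dots> = (g [^] d) [^] u \<otimes> (g [^] ?p) [^] v"
      using gG by (simp add: int_pow_mult int_pow_pow flip: int_pow_int)
    also have "\<dots> \<in> K"
      using subgroup_int_pow_closed[OF K.subgroup_axioms] d gp by auto
    finally show False
      using g by simp
  qed
  have uniq': "a = b \<and> x = y" if "x \<in> K" "y \<in> K" "a \<le> b" "b < ?p" "x \<otimes> g [^] a = y \<otimes> g [^] b" for x y a b
  proof -
    have "g [^] b = g [^] (b - a) \<otimes> g [^] a"
      using gG that by (simp add: nat_pow_mult)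
    then have "x \<otimes> g [^] a = (y \<otimes> g [^] (b - a)) \<otimes> g [^] a"
      using that gG by (simp add: m_assoc)
    then have x: "x = y \<otimes> g [^] (b - a)"
      using that gG by simp
    then have "g [^] (b - a) = inv y \<otimes> x"
      using that gG by simp
    then have "b - a = 0"
      using that by (intro g_pow) auto
    then show ?thesis
      using x that by simp
  qed
  have uniq: "a = b \<and> x = y" if "x \<in> K" "y \<in> K" "a < ?p" "b < ?p" "x \<otimes> g [^] a = y \<otimes> g [^] b" for x y a b
    using uniq'[of x y a b] uniq'[of y x b a] that by (cases "a \<le> b") auto
  obtain X where X: "\<And>y. y \<in> P \<Longrightarrow> X y \<in> K \<and> (\<exists>a<?p. y = X y \<otimes> g [^] a)"
    using decomp by metis
  then obtain A where A: "\<And>y. y \<in> P \<Longrightarrow> A y < ?p \<and> y = X y \<otimes> g [^] A y"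
    by metis
  have XA: "X (x \<otimes> g [^] a) = x" "A (x \<otimes> g [^] a) = a" if "x \<in> K" "a < ?p" for x a
  proof -
    have "x \<otimes> g [^] a \<in> P"
      using that KP subgroup_nat_pow_closed[OF less.prems(1) g(1), of a] by auto
    then show "X (x \<otimes> g [^] a) = x" "A (x \<otimes> g [^] a) = a"
      using uniq[of "X (x \<otimes> g [^] a)" x "A (x \<otimes> g [^] a)" a] X A that by metis+
  qed
  have extend: "\<exists>f. deg P n f \<and> (\<forall>x\<in>K. \<forall>a<?p. f (x \<otimes> g [^] a) = (\<Sum>e<?p. of_nat (a choose e) * F e x))"
    if F: "\<And>e. e < ?p \<Longrightarrow> deg K (n - e * w) (F e)" for F :: "nat \<Rightarrow> 'a \<Rightarrow> 'p mod_ring"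
  proof -
    define f where "f y = (\<Sum>e<?p. of_nat (A y choose e) * F e (X y))" for y
    have f: "f (x \<otimes> g [^] a) = (\<Sum>e<?p. of_nat (a choose e) * F e x)" if "x \<in> K" "a < ?p" for x a
      using XA[OF that] by (simp add: f_def)
    have "deg P n f"
      by (rule deg_induced[OF pth less.prems(1) K.subgroup_axioms KP(1) w(1,2) KP(2) g(1) gp decomp F f])
    then show ?thesis
      using f by blast
  qed
  obtain \<kappa> a where \<kappa>: "\<kappa> \<in> K" "a < ?p" "h = \<kappa> \<otimes> g [^] a"
    using decomp less.prems by blast
  have p2: "2 \<le> ?p"
    using prime_ge_2_nat[OF p] .
  show ?case
  proof (cases "\<kappa> \<in> H n")
    case False
    have "card ((\<lambda>x. H n #> x) ` K) < card ((\<lambda>x. H n #> x) ` P)"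
      using C_less[of P] KP g by (simp add: C_def)
    from less.hyps[OF this K.subgroup_axioms \<kappa>(1) False]
    obtain f0 :: "'a \<Rightarrow> 'p mod_ring" where f0: "deg K n f0" "f0 \<kappa> \<noteq> f0 \<one>"
      by blast
    \<comment> \<open>With only the coefficient of \<open>(g - 1)^0\<close> present, the extension
      is \<open>f (x g^a) = f0 x\<close>.\<close>
    define F where "F e = (if e = 0 then f0 else (\<lambda>_. 0))" for e :: nat
    have "deg K (n - e * w) (F e)" for e
      by (cases "e = 0") (auto simp: F_def f0 intro!: deg_zero K.subgroup_axioms)
    then obtain f where f: "deg P n f"
      "\<forall>x\<in>K. \<forall>a<?p. f (x \<otimes> g [^] a) = (\<Sum>e<?p. of_nat (a choose e) * F e x)"
      using extend[of F] by metis
    have fa: "f (x \<otimes> g [^] a) = f0 x" if "x \<in> K" "a < ?p" for x a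
    proof -
      have "(\<Sum>e<?p. of_nat (a choose e) * F e x) = (\<Sum>e\<in>{0}. of_nat (a choose e) * F e x)"
        by (rule sum.mono_neutral_right) (use p2 in \<open>auto simp: F_def\<close>)
      then show ?thesis
        using f(2) that by (simp add: F_def)
    qed
    have "f h = f0 \<kappa>" "f \<one> = f0 \<one>"
      using fa[of \<kappa> a] fa[of \<one> 0] \<kappa> p2 by simp_all
    then show ?thesis
      using f(1) f0 by metis
  next
    case True
    have "a \<noteq> 0"
      using True \<kappa> less.prems gG by (intro notI) simp
    \<comment> \<open>With coefficient 1 at \<open>e = 1\<close> the extension is
      \<open>f (x g^a) = a\<close> modulo p. A nonzero constant needs a positive bound
      \<open>n - w\<close>, which is \<open>w < n\<close>.\<close>
    define F where "F e = (if e = 1 then (\<lambda>_ :: 'a. 1) else (\<lambda>_. 0 :: 'p mod_ring))" for e :: nat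
    have "deg K (n - e * w) (F e :: 'a \<Rightarrow> 'p mod_ring)" for e
    proof (cases "e = 1")
      case True
      then show ?thesis
        using \<open>w < n\<close> by (auto simp: F_def intro!: deg_const K.subgroup_axioms)
    qed (auto simp: F_def intro!: deg_zero K.subgroup_axioms)
    then obtain f :: "'a \<Rightarrow> 'p mod_ring" where f: "deg P n f"
      "\<forall>x\<in>K. \<forall>a<?p. f (x \<otimes> g [^] a) = (\<Sum>e<?p. of_nat (a choose e) * F e x)"
      using extend[of F] by metis
    have fa: "f (x \<otimes> g [^] a) = of_nat a" if "x \<in> K" "a < ?p" for x a
    proof -
      have "(\<Sum>e<?p. of_nat (a choose e) * F e x) = (\<Sum>e\<in>{1}. of_nat (a choose e) * F e x)"
        by (rule sum.mono_neutral_right) (use p2 in \<open>auto simp: F_def\<close>)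
      then show ?thesis
        using f(2) that by (simp add: F_def)
    qed
    have "of_nat a \<noteq> (0 :: 'p mod_ring)"
      using of_nat_0_mod_ring_dvd[of a, where 'a='p] \<open>a \<noteq> 0\<close> \<kappa>(2) by (auto simp: nat_dvd_not_less)
    moreover have "f h = of_nat a"
      using fa \<kappa> by simp
    moreover have "f \<one> = 0"
      using fa[of \<one> 0] p2 by simp
    ultimately show ?thesis
      using f(1) by metis
  qed
qed

end

section \<open>Profinite groups\<close>

lemma continuous_map_discrete_UNIV:
  "continuous_map T (discrete_topology UNIV) f \<longleftrightarrow> (\<forall>a. openin T {x \<in> topspace T. f x = a})"
proof
  assume "continuous_map T (discrete_topology UNIV) f"
  then show "\<forall>a. openin T {x \<in> topspace T. f x = a}"
    using openin_continuous_map_preimage[of T "discrete_topology UNIV" f "{a}" for a] by simp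
next
  assume *: "\<forall>a. openin T {x \<in> topspace T. f x = a}"
  have "openin T {x \<in> topspace T. f x \<in> U}" for U
  proof -
    have "{x \<in> topspace T. f x \<in> U} = (\<Union>a\<in>U. {x \<in> topspace T. f x = a})"
      by blast
    then show ?thesis
      using * by auto
  qed
  then show "continuous_map T (discrete_topology UNIV) f"
    by (simp add: continuous_map_def)
qed

lemma continuous_map_discrete_compose2:
  assumes "continuous_map T (discrete_topology UNIV) f" "continuous_map T (discrete_topology UNIV) g"
  shows "continuous_map T (discrete_topology UNIV) (\<lambda>x. h (f x) (g x))"
  unfolding continuous_map_discrete_UNIV
proof
  fix c
  have "{x \<in> topspace T. h (f x) (g x) = c} =
      (\<Union>(a, b) \<in> {(a, b). h a b = c}. {x \<in> topspace T. f x = a} \<inter> {x \<in> topspace T. g x = b})"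
    by auto
  moreover have "openin T \<dots>"
    using assms unfolding continuous_map_discrete_UNIV by (intro openin_Union) (auto intro!: openin_Int)
  ultimately show "openin T {x \<in> topspace T. h (f x) (g x) = c}"
    by simp
qed

lemma continuous_map_discrete_compose1:
  assumes "continuous_map T (discrete_topology UNIV) f"
  shows "continuous_map T (discrete_topology UNIV) (\<lambda>x. h (f x))"
  using continuous_map_discrete_compose2[OF assms assms, of "\<lambda>a _. h a"] .

lemma continuous_map_discrete_sum:
  fixes f :: "'i \<Rightarrow> 'a \<Rightarrow> 'b::comm_monoid_add"
  assumes "\<And>i. i \<in> I \<Longrightarrow> continuous_map T (discrete_topology UNIV) (f i)"
  shows "continuous_map T (discrete_topology UNIV) (\<lambda>x. \<Sum>i\<in>I. f i x)"
  using assms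
proof (induction I rule: infinite_finite_induct)
  case (insert i I)
  then show ?case
    using continuous_map_discrete_compose2[of T "f i" "\<lambda>x. \<Sum>i\<in>I. f i x" "(+)"] by simp
qed simp_all

lemma closedin_discrete_preimage:
  assumes "continuous_map T (discrete_topology UNIV) f"
  shows "closedin T {x \<in> topspace T. f x \<in> A}"
  using closedin_continuous_map_preimage[OF assms, of A] by simp

context topological_group
begin

lemma topspace_carrier [simp]: "topspace T = carrier G"
  by (rule topspace_eq)

lemma openin_carrier [simp]: "openin T (carrier G)" and closedin_carrier [simp]: "closedin T (carrier G)"
  using openin_topspace[of T] closedin_topspace[of T] by simp_all

lemma continuous_map_mult:
  assumes "continuous_map X T f" "continuous_map X T g"
  shows "continuous_map X T (\<lambda>x. f x \<otimes> g x)"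
  using continuous_map_compose[OF continuous_map_pairedI[OF assms] continuous_mult]
  by (simp add: o_def)

lemma continuous_map_inv:
  assumes "continuous_map X T f"
  shows "continuous_map X T (\<lambda>x. inv (f x))"
  using continuous_map_compose[OF assms continuous_inv] by (simp add: o_def)

lemma continuous_map_group_const: "g \<in> carrier G \<Longrightarrow> continuous_map X T (\<lambda>_. g)"
  by simp

lemmas continuous_group_intros =
  continuous_map_mult continuous_map_inv continuous_map_group_const continuous_map_id[unfolded id_def]

lemma openin_preimage: "continuous_map T T f \<Longrightarrow> openin T U \<Longrightarrow> openin T {x \<in> carrier G. f x \<in> U}"
  using openin_continuous_map_preimage by force

lemma closedin_preimage: "continuous_map T T f \<Longrightarrow> closedin T U \<Longrightarrow> closedin T {x \<in> carrier G. f x \<in> U}"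
  using closedin_continuous_map_preimage by force

lemma openin_r_coset:
  assumes "openin T V" "x \<in> carrier G"
  shows "openin T (V #> x)"
proof -
  have V: "V \<subseteq> carrier G"
    using assms(1) openin_subset by force
  have "V #> x = {y \<in> carrier G. y \<otimes> inv x \<in> V}"
  proof (intro equalityI subsetI)
    fix y assume "y \<in> {y \<in> carrier G. y \<otimes> inv x \<in> V}"
    then show "y \<in> V #> x"
      using assms(2) unfolding r_coset_def by (intro UN_I[of "y \<otimes> inv x"]) (auto simp: m_assoc)
  qed (use V assms in \<open>auto simp: r_coset_def m_assoc subset_iff\<close>)
  then show ?thesis
    using assms openin_preimage[of "\<lambda>y. y \<otimes> inv x" V] by (simp add: continuous_group_intros)
qed

lemma open_subgroupI:
  assumes "subgroup N G" "openin T V" "\<one> \<in> V" "V \<subseteq> N"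
  shows "openin T N"
proof -
  have "N = (\<Union>x\<in>N. V #> x)"
  proof (intro equalityI subsetI)
    fix x assume "x \<in> N"
    then have "\<one> \<otimes> x \<in> V #> x"
      using assms(3) unfolding r_coset_def by blast
    then show "x \<in> (\<Union>x\<in>N. V #> x)"
      using \<open>x \<in> N\<close> subgroup.mem_carrier[OF assms(1)] by auto
  next
    fix y assume "y \<in> (\<Union>x\<in>N. V #> x)"
    then show "y \<in> N"
      using assms subgroup.m_closed[OF assms(1)] by (auto simp: r_coset_def)
  qed
  also have "openin T \<dots>"
    using assms subgroup.mem_carrier[OF assms(1)] by (intro openin_Union) (auto intro: openin_r_coset)
  finally show ?thesis .
qed

lemma openin_coset_union:
  assumes "subgroup V G" "openin T V" "U \<subseteq> carrier G" "\<And>x v. x \<in> U \<Longrightarrow> v \<in> V \<Longrightarrow> v \<otimes> x \<in> U"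
  shows "openin T U"
proof -
  have "U = (\<Union>x\<in>U. V #> x)"
  proof (intro equalityI subsetI)
    fix x assume "x \<in> U"
    moreover from this have "\<one> \<otimes> x \<in> V #> x"
      using subgroup.one_closed[OF assms(1)] unfolding r_coset_def by blast
    ultimately show "x \<in> (\<Union>x\<in>U. V #> x)"
      using assms(3) by (metis UN_I l_one subsetD)
  qed (use assms in \<open>auto simp: r_coset_def\<close>)
  also have "openin T \<dots>"
    using assms by (intro openin_Union) (auto intro: openin_r_coset)
  finally show ?thesis .
qed

lemma open_subgroup_closed:
  assumes "subgroup V G" "openin T V"
  shows "closedin T V"
proof -
  have "v \<otimes> x \<in> carrier G - V" if "x \<in> carrier G - V" "v \<in> V" for x v
  proof -
    have v: "v \<in> carrier G"
      using subgroup.mem_carrier[OF assms(1)] that by blast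
    have "x \<in> V" if "v \<otimes> x \<in> V"
    proof -
      have "inv v \<otimes> (v \<otimes> x) \<in> V"
        using subgroup.m_closed[OF assms(1)] subgroup.m_inv_closed[OF assms(1)] that \<open>v \<in> V\<close> by blast
      then show ?thesis
        using v \<open>x \<in> carrier G - V\<close> by simp
    qed
    then show ?thesis
      using that v by auto
  qed
  then have "openin T (carrier G - V)"
    by (intro openin_coset_union[OF assms]) auto
  then show ?thesis
    using subgroup.subset[OF assms(1)] by (simp add: closedin_def)
qed

abbreviation csg :: "'a set \<Rightarrow> 'a set"
  where "csg \<equiv> closed_subgroup_generated G T"

lemma csg_subset: "A \<subseteq> csg A"
  unfolding closed_subgroup_generated_def by (rule hull_subset)

lemma csg_minimal: "subgroup H G \<Longrightarrow> closedin T H \<Longrightarrow> A \<subseteq> H \<Longrightarrow> csg A \<subseteq> H"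
  unfolding closed_subgroup_generated_def by (rule hull_minimal) auto

lemma csg_eq_Inter: "csg A = \<Inter>{H. (subgroup H G \<and> closedin T H) \<and> A \<subseteq> H}"
  by (simp add: closed_subgroup_generated_def hull_def)

lemma carrier_closed_subgroup: "subgroup (carrier G) G" "closedin T (carrier G)"
  using subgroup_self closedin_topspace[of T] by simp_all

lemma csg_subgroup:
  assumes "A \<subseteq> carrier G"
  shows "subgroup (csg A) G"
  unfolding csg_eq_Inter using assms carrier_closed_subgroup by (intro subgroups_Inter) (auto intro!: exI[of _ "carrier G"])

lemma csg_closed:
  assumes "A \<subseteq> carrier G"
  shows "closedin T (csg A)"
  unfolding csg_eq_Inter using assms carrier_closed_subgroup by (intro closedin_Inter) (auto intro!: exI[of _ "carrier G"])

text \<open>For fixed \<open>g\<close>, the elements whose conjugate by \<open>g\<close> stays in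
  the generated subgroup form a closed subgroup containing the generators.\<close>

lemma csg_normal:
  assumes "A \<subseteq> carrier G" "\<And>a g. a \<in> A \<Longrightarrow> g \<in> carrier G \<Longrightarrow> g \<otimes> a \<otimes> inv g \<in> A"
  shows "csg A \<lhd> G"
proof (rule normal_invI)
  show "subgroup (csg A) G"
    by (rule csg_subgroup[OF assms(1)])
  interpret C: subgroup "csg A" G
    by fact
  fix g h assume g: "g \<in> carrier G" and h: "h \<in> csg A"
  have "csg A \<subseteq> {x \<in> carrier G. g \<otimes> x \<otimes> inv g \<in> csg A}"
  proof (rule csg_minimal)
    show "subgroup {x \<in> carrier G. g \<otimes> x \<otimes> inv g \<in> csg A} G"
    proof (rule subgroupI)
      show "{x \<in> carrier G. g \<otimes> x \<otimes> inv g \<in> csg A} \<noteq> {}"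
        using g by (auto intro!: exI[of _ \<one>])
    next
      fix a assume "a \<in> {x \<in> carrier G. g \<otimes> x \<otimes> inv g \<in> csg A}"
      then have "a \<in> carrier G" "inv (g \<otimes> a \<otimes> inv g) \<in> csg A"
        by auto
      then show "inv a \<in> {x \<in> carrier G. g \<otimes> x \<otimes> inv g \<in> csg A}"
        using g by (simp add: inv_mult_group m_assoc)
    next
      fix a b assume "a \<in> {x \<in> carrier G. g \<otimes> x \<otimes> inv g \<in> csg A}" "b \<in> {x \<in> carrier G. g \<otimes> x \<otimes> inv g \<in> csg A}"
      then have "a \<in> carrier G" "b \<in> carrier G" "(g \<otimes> a \<otimes> inv g) \<otimes> (g \<otimes> b \<otimes> inv g) \<in> csg A"
        by auto
      then show "a \<otimes> b \<in> {x \<in> carrier G. g \<otimes> x \<otimes> inv g \<in> csg A}"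
        using g by (simp add: m_assoc)
    qed auto
    show "closedin T {x \<in> carrier G. g \<otimes> x \<otimes> inv g \<in> csg A}"
      using g by (intro closedin_preimage csg_closed assms continuous_group_intros)
         auto
    show "A \<subseteq> {x \<in> carrier G. g \<otimes> x \<otimes> inv g \<in> csg A}"
      using assms g csg_subset by blast
  qed
  then show "g \<otimes> h \<otimes> inv g \<in> csg A"
    using h by blast
qed

end

section \<open>Open normal subgroups and compactness\<close>

context profinite_group
begin

lemma finite_index:
  assumes "subgroup V G" "openin T V"
  shows "finite ((\<lambda>x. V #> x) ` carrier G)"
proof -
  interpret V: subgroup V G by fact
  have self: "x \<in> V #> x" if "x \<in> carrier G" for x
    using rcos_self[OF that assms(1)] .
  have "topspace T \<subseteq> \<Union>((\<lambda>x. V #> x) ` carrier G)"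
    using self by auto
  then obtain F where F: "finite F" "F \<subseteq> (\<lambda>x. V #> x) ` carrier G" "topspace T \<subseteq> \<Union>F"
    using compact assms openin_r_coset unfolding compact_space_alt by (metis (no_types, lifting) imageE)
  have "(\<lambda>x. V #> x) ` carrier G \<subseteq> F"
  proof
    fix X assume "X \<in> (\<lambda>x. V #> x) ` carrier G"
    then obtain x where x: "x \<in> carrier G" "X = V #> x"
      by blast
    then obtain Y where "Y \<in> F" "x \<in> Y"
      using F(3) by auto
    then obtain y where y: "y \<in> carrier G" "V #> y \<in> F" "x \<in> V #> y"
      using F(2) by blast
    have "V #> y = V #> x"
      using repr_independence[OF y(3,1) assms(1)] .
    then show "X \<in> F"
      using x y by simp
  qed
  then show ?thesis
    using F finite_subset by blast
qed

text \<open>In a compact Hausdorff space quasi-components are components, and these are points here.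
  So the clopen sets around \<open>x\<close> intersect in \<open>x\<close> alone, and by compactness
  finitely many of them already fit into \<open>W\<close>.\<close>

lemma clopen_neighbourhood:
  assumes "openin T W" "x \<in> W"
  shows "\<exists>U. openin T U \<and> closedin T U \<and> x \<in> U \<and> U \<subseteq> W"
proof -
  let ?\<U> = "{U. openin T U \<and> closedin T U \<and> x \<in> U}"
  have x: "x \<in> topspace T"
    using assms openin_subset by blast
  have "quasi_components_of T = connected_components_of T"
    by (rule quasi_eq_connected_components_of) (use compact Hausdorff in auto)
  then have "quasi_component_of_set T x = connected_component_of_set T x"
    using x by (simp add: quasi_eq_connected_components_of_pointwise)
  also have "\<dots> = {x}"
  proof -
    obtain z where "connected_component_of_set T x \<subseteq> {z}"
      using totally_disconnected[OF connectedin_connected_component_of[of T x]] by blast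
    moreover have "x \<in> connected_component_of_set T x"
      using x connected_component_of_refl[of T x] by simp
    ultimately show ?thesis
      by blast
  qed
  finally have "y = x" if "y \<in> topspace T" "\<And>U. U \<in> ?\<U> \<Longrightarrow> y \<in> U" for y
    using that x by (auto simp: quasi_component_of set_eq_iff)
  then have "(topspace T - W) \<inter> \<Inter>?\<U> = {}"
    using assms by blast
  moreover have "compactin T (topspace T - W)"
    using assms(1) compact by (intro closedin_compact_space) (simp_all only: openin_closedin_eq)
  ultimately obtain F where F: "finite F" "F \<subseteq> ?\<U>" "(topspace T - W) \<inter> \<Inter>F = {}"
    unfolding compactin_fip by (metis (no_types, lifting) mem_Collect_eq)
  let ?U = "topspace T \<inter> \<Inter>F"
  have "openin T ?U"
    using F by (intro openin_Int_Inter) auto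
  moreover have "closedin T ?U"
  proof -
    have "?U = \<Inter>(insert (topspace T) F)"
      by simp
    then show ?thesis
      using F by (metis (no_types, lifting) closedin_Inter closedin_topspace insertE insert_not_empty mem_Collect_eq subsetD)
  qed
  moreover have "x \<in> ?U" "?U \<subseteq> W"
    using F x by auto
  ultimately show ?thesis
    by blast
qed

text \<open>Take a clopen \<open>U\<close> around 1 inside \<open>W\<close> and those
  \<open>v\<close> all of whose conjugates, together with the conjugates of the inverse, carry
  \<open>U\<close> into itself by right multiplication. Quantifying over the conjugates makes this
  subgroup normal at once; it lies in \<open>U\<close> because \<open>U\<close> contains 1.\<close>

lemma open_normal_subgroup_basis:
  assumes W: "openin T W" "\<one> \<in> W"
  shows "\<exists>V. V \<lhd> G \<and> openin T V \<and> V \<subseteq> W"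
proof -
  obtain U where U: "openin T U" "closedin T U" "\<one> \<in> U" "U \<subseteq> W"
    using clopen_neighbourhood[OF W] by blast
  have UG: "U \<subseteq> carrier G"
    using U openin_subset by force
  let ?X = "prod_topology (prod_topology T T) T"
  define f1 where "f1 = (\<lambda>x :: ('a \<times> 'a) \<times> 'a. snd (fst x) \<otimes> (fst (fst x) \<otimes> snd x \<otimes> inv (fst (fst x))))"
  define f2 where "f2 = (\<lambda>x :: ('a \<times> 'a) \<times> 'a. snd (fst x) \<otimes> (fst (fst x) \<otimes> inv (snd x) \<otimes> inv (fst (fst x))))"
  have "continuous_map ?X T (\<lambda>x. fst (fst x))" "continuous_map ?X T (\<lambda>x. snd (fst x))"
    "continuous_map ?X T (\<lambda>x. snd x)"
    using continuous_map_compose[OF continuous_map_fst continuous_map_fst]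
      continuous_map_compose[OF continuous_map_fst continuous_map_snd] continuous_map_snd
    by (simp_all add: o_def)
  then have f: "continuous_map ?X T f1" "continuous_map ?X T f2"
    unfolding f1_def f2_def by (intro continuous_map_mult continuous_map_inv; simp)+
  define Q where "Q = {x \<in> topspace ?X. f1 x \<in> U} \<inter> {x \<in> topspace ?X. f2 x \<in> U}"
  have Q1: "openin ?X Q"
    unfolding Q_def using f U by (intro openin_Int openin_continuous_map_preimage)
  have Q2: "compactin (prod_topology T T) (carrier G \<times> U)"
    unfolding compactin_Times using compact U closedin_compact_space[of T] carrier_closed_subgroup(2) by blast
  have Q3: "(carrier G \<times> U) \<times> {\<one>} \<subseteq> Q"
    using UG by (auto simp: Q_def f1_def f2_def)
  \<comment> \<open>Compactness of \<open>carrier G \<times> U\<close> yields one neighbourhood of 1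
    that serves all \<open>g\<close> and \<open>u\<close> simultaneously.\<close>
  obtain C V' where V': "openin T V'" "\<one> \<in> V'" and C: "carrier G \<times> U \<subseteq> C" "C \<times> V' \<subseteq> Q"
    using tube_lemma_left[OF Q1 Q2 _ Q3] by auto
  have V'Q: "(carrier G \<times> U) \<times> V' \<subseteq> Q"
    using C by blast
  define V where "V = {v \<in> carrier G. \<forall>g\<in>carrier G. \<forall>u\<in>U.
    u \<otimes> (g \<otimes> v \<otimes> inv g) \<in> U \<and> u \<otimes> (g \<otimes> inv v \<otimes> inv g) \<in> U}"
  have "V' \<subseteq> V"
  proof
    fix v assume "v \<in> V'"
    then have "((g, u), v) \<in> Q" if "g \<in> carrier G" "u \<in> U" for g u
      using that subsetD[OF V'Q, of "((g, u), v)"] by simp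
    moreover have "v \<in> carrier G"
      using \<open>v \<in> V'\<close> openin_subset[OF V'(1)] by auto
    moreover have "f1 y \<in> U \<and> f2 y \<in> U" if "y \<in> Q" for y
      using that by (simp add: Q_def)
    ultimately show "v \<in> V"
      unfolding V_def f1_def f2_def by fastforce
  qed
  have "V \<subseteq> U"
  proof
    fix v assume "v \<in> V"
    then have "v \<in> carrier G" "\<one> \<otimes> (\<one> \<otimes> v \<otimes> inv \<one>) \<in> U"
      using U(3) unfolding V_def by blast+
    then show "v \<in> U"
      by simp
  qed
  have "subgroup V G"
  proof (rule subgroupI)
    show "V \<noteq> {}"
      using V' \<open>V' \<subseteq> V\<close> by blast
  next
    fix a b assume ab: "a \<in> V" "b \<in> V"
    have "u \<otimes> (g \<otimes> (a \<otimes> b) \<otimes> inv g) \<in> U \<and> u \<otimes> (g \<otimes> inv (a \<otimes> b) \<otimes> inv g) \<in> U"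
      if "g \<in> carrier G" "u \<in> U" for g u
    proof -
      have "(u \<otimes> (g \<otimes> a \<otimes> inv g)) \<otimes> (g \<otimes> b \<otimes> inv g) \<in> U"
        "(u \<otimes> (g \<otimes> inv b \<otimes> inv g)) \<otimes> (g \<otimes> inv a \<otimes> inv g) \<in> U"
        using ab that unfolding V_def by blast+
      moreover have "u \<in> carrier G" "a \<in> carrier G" "b \<in> carrier G"
        using that UG ab by (auto simp: V_def)
      ultimately show ?thesis
        using that by (simp add: m_assoc inv_mult_group)
    qed
    then show "a \<otimes> b \<in> V"
      using ab by (auto simp: V_def)
  qed (auto simp: V_def)
  moreover have "h \<otimes> v \<otimes> inv h \<in> V" if hv: "h \<in> carrier G" "v \<in> V" for h v
  proof -
    have "u \<otimes> (g \<otimes> (h \<otimes> v \<otimes> inv h) \<otimes> inv g) \<in> U \<and> u \<otimes> (g \<otimes> inv (h \<otimes> v \<otimes> inv h) \<otimes> inv g) \<in> U"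
      if "g \<in> carrier G" "u \<in> U" for g u
    proof -
      have "u \<otimes> ((g \<otimes> h) \<otimes> v \<otimes> inv (g \<otimes> h)) \<in> U \<and> u \<otimes> ((g \<otimes> h) \<otimes> inv v \<otimes> inv (g \<otimes> h)) \<in> U"
        using hv that unfolding V_def by blast
      moreover have "u \<in> carrier G" "v \<in> carrier G"
        using that UG hv by (auto simp: V_def)
      ultimately show ?thesis
        using that hv by (simp add: m_assoc inv_mult_group)
    qed
    then show ?thesis
      using hv by (auto simp: V_def)
  qed
  ultimately have "V \<lhd> G"
    by (rule normal_invI)
  moreover have "openin T V"
    by (rule open_subgroupI[OF \<open>subgroup V G\<close> V'(1,2) \<open>V' \<subseteq> V\<close>])
  ultimately show ?thesis
    using \<open>V \<subseteq> U\<close> U by blast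
qed

text \<open>The \<open>v\<close> for which \<open>inv v \<otimes> s\<close> avoids \<open>A\<close>
  form an open neighbourhood of 1, and any open normal subgroup inside it works.\<close>

lemma separate_closed_subgroup:
  assumes "subgroup A G" "closedin T A" "s \<in> carrier G" "s \<notin> A"
  shows "\<exists>V. V \<lhd> G \<and> openin T V \<and> (\<forall>a\<in>A. V #> s \<noteq> V #> a)"
proof -
  let ?W = "{v \<in> carrier G. inv v \<otimes> s \<in> carrier G - A}"
  have "openin T ?W"
    using assms by (intro openin_preimage continuous_group_intros)
      (auto simp: openin_diff simp flip: topspace_carrier)
  then obtain V where V: "V \<lhd> G" "openin T V" "V \<subseteq> ?W"
    using open_normal_subgroup_basis[of ?W] assms by auto
  interpret V: normal V G
    by fact
  have "V #> s \<noteq> V #> a" if "a \<in> A" for a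
  proof
    assume eq: "V #> s = V #> a"
    have a: "a \<in> carrier G"
      using that assms subgroup.mem_carrier by metis
    have "s \<in> V #> a"
      using rcos_self[OF assms(3) V.subgroup_axioms] eq by simp
    then obtain v where v: "v \<in> V" "s = v \<otimes> a"
      by (auto simp: r_coset_def)
    then have "inv v \<otimes> s = a"
      using a by simp
    then show False
      using v V that by auto
  qed
  then show ?thesis
    using V by blast
qed

text \<open>\<open>zassenhaus\<close> multiplies closed subgroups as bare sets; the product stays
  closed as a continuous image of a compact set.\<close>

lemma closed_set_mult:
  assumes "closedin T A" "closedin T B"
  shows "closedin T (A <#> B)"
proof -
  have "compactin (prod_topology T T) (A \<times> B)"
    using assms compact by (simp add: compactin_Times closedin_compact_space)
  then have "compactin T ((\<lambda>(x, y). x \<otimes> y) ` (A \<times> B))"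
    using continuous_mult by (rule image_compactin)
  moreover have "(\<lambda>(x, y). x \<otimes> y) ` (A \<times> B) = A <#> B"
    by (auto simp: set_mult_def)
  ultimately show ?thesis
    using Hausdorff compactin_imp_closedin by metis
qed

end

section \<open>The Zassenhaus filtration\<close>

text \<open>For values in a field, this says that the linear extension of \<open>f\<close> vanishes
  on the n-th power of the augmentation ideal. Differences by 1 are zero, so the trivial terms of
  the weighting impose nothing and \<open>dd_Suc\<close> is the effective recursion.\<close>

definition difference_degree_less :: "('a, 'm) monoid_scheme \<Rightarrow> nat \<Rightarrow> ('a \<Rightarrow> 'b::ab_group_add) \<Rightarrow> bool"
  where "difference_degree_less G =
    filtered_degree_less G (\<lambda>i. if i \<le> 1 then carrier G else {\<one>\<^bsub>G\<^esub>}) (carrier G)"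

context group
begin

abbreviation dd :: "nat \<Rightarrow> ('a \<Rightarrow> 'c::ab_group_add) \<Rightarrow> bool"
  where "dd \<equiv> difference_degree_less G"

interpretation trivial: weighted_group G "\<lambda>i. if i \<le> 1 then carrier G else {\<one>}"
  by unfold_locales simp

lemmas dd_cong = trivial.deg_cong[OF subgroup_self, folded difference_degree_less_def]
lemmas dd_zero = trivial.deg_zero[OF subgroup_self, folded difference_degree_less_def]
lemmas dd_add = trivial.deg_add[where K = "carrier G", folded difference_degree_less_def]
lemmas dd_diff = trivial.deg_diff[where K = "carrier G", folded difference_degree_less_def]
lemmas dd_additive_map = trivial.deg_additive_map[where K = "carrier G", folded difference_degree_less_def]
lemmas dd_mono = trivial.deg_mono[OF subgroup_self, folded difference_degree_less_def]
lemmas dd_translate = trivial.deg_translate[OF _ _ subgroup_self, folded difference_degree_less_def]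
lemmas dd_const = trivial.deg_const[OF _ subgroup_self, folded difference_degree_less_def]

lemma dd_0 [simp]: "dd 0 f \<longleftrightarrow> (\<forall>x\<in>carrier G. f x = 0)"
  by (simp add: difference_degree_less_def)

lemma dd_Suc: "dd (Suc n) f \<longleftrightarrow> (\<forall>h\<in>carrier G. dd n (left_diff G h f))"
proof
  assume "dd (Suc n) f"
  then show "\<forall>h\<in>carrier G. dd n (left_diff G h f)"
    unfolding difference_degree_less_def by (auto dest: spec[of _ 0])
next
  assume *: "\<forall>h\<in>carrier G. dd n (left_diff G h f)"
  have "dd (n - i) (left_diff G h f)" if "h \<in> carrier G \<inter> (if Suc i \<le> 1 then carrier G else {\<one>})" for i h
  proof (cases i)
    case 0
    then show ?thesis
      using * that by simp
  next
    case (Suc j)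
    then show ?thesis
      using that by (intro dd_zero) (simp add: left_diff_def)
  qed
  then show "dd (Suc n) f"
    unfolding difference_degree_less_def by simp
qed

lemma dd_left_diff: "dd n f \<Longrightarrow> h \<in> carrier G \<Longrightarrow> dd (n - 1) (left_diff G h f)"
  by (cases n) (auto simp: dd_Suc left_diff_def)

lemma dd_sum:
  assumes "\<And>i. i \<in> I \<Longrightarrow> dd n (f i)"
  shows "dd n (\<lambda>x. \<Sum>i\<in>I. f i x)"
  using assms
proof (induction I rule: infinite_finite_induct)
  case (insert i I)
  then show ?case
    using dd_add[of n "f i" "\<lambda>x. \<Sum>i\<in>I. f i x"] by simp
qed (auto intro: dd_zero)

lemma normal_carrier: "carrier G \<lhd> G"
  by (rule normal_invI) (auto intro: subgroup_self)

lemma normal_one: "{\<one>} \<lhd> G"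
  by (rule normal_invI) (auto intro: triv_subgroup)

lemma normal_conj:
  assumes "N \<lhd> G" "g \<in> carrier G" "x \<in> N"
  shows "g \<otimes> x \<otimes> inv g \<in> N"
  using assms by (simp add: normal.inv_op_closed2)

lemma normal_carrierD: "N \<lhd> G \<Longrightarrow> x \<in> N \<Longrightarrow> x \<in> carrier G"
  using normal_imp_subgroup subgroup.mem_carrier by metis

lemma normal_set_mult:
  assumes N: "N \<lhd> G" and M: "M \<lhd> G"
  shows "N <#> M \<lhd> G"
proof -
  interpret N: normal N G by fact
  interpret M: normal M G by fact
  show ?thesis
  proof (rule normal_invI)
    show "subgroup (N <#> M) G"
    proof (rule subgroupI)
      show "N <#> M \<subseteq> carrier G"
        by (simp add: setmult_subset_G N.subset M.subset)
      show "N <#> M \<noteq> {}"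
        using N.one_closed M.one_closed unfolding set_mult_def by blast
    next
      fix a assume "a \<in> N <#> M"
      then obtain x y where xy: "x \<in> N" "y \<in> M" "a = x \<otimes> y"
        by (auto simp: set_mult_def)
      then have "inv a = (inv y \<otimes> inv x \<otimes> inv (inv y)) \<otimes> inv y"
        by (simp add: inv_mult_group m_assoc)
      moreover have "inv y \<otimes> inv x \<otimes> inv (inv y) \<in> N"
        using xy by (intro normal_conj[OF N]) auto
      ultimately show "inv a \<in> N <#> M"
        using xy unfolding set_mult_def by blast
    next
      fix a b assume "a \<in> N <#> M" "b \<in> N <#> M"
      then obtain x y x' y' where xy: "x \<in> N" "y \<in> M" "a = x \<otimes> y" "x' \<in> N" "y' \<in> M" "b = x' \<otimes> y'"
        by (auto simp: set_mult_def)
      then have "a \<otimes> b = (x \<otimes> (y \<otimes> x' \<otimes> inv y)) \<otimes> (y \<otimes> y')"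
        by (simp add: m_assoc)
      moreover have "y \<otimes> x' \<otimes> inv y \<in> N"
        using xy by (intro normal_conj[OF N]) auto
      ultimately show "a \<otimes> b \<in> N <#> M"
        using xy unfolding set_mult_def by blast
    qed
    fix g a assume g: "g \<in> carrier G" and "a \<in> N <#> M"
    then obtain x y where xy: "x \<in> N" "y \<in> M" "a = x \<otimes> y"
      by (auto simp: set_mult_def)
    then have "g \<otimes> a \<otimes> inv g = (g \<otimes> x \<otimes> inv g) \<otimes> (g \<otimes> y \<otimes> inv g)"
      using g by (simp add: m_assoc)
    then show "g \<otimes> a \<otimes> inv g \<in> N <#> M"
      using normal_conj[OF N g xy(1)] normal_conj[OF M g xy(2)] unfolding set_mult_def by blast
  qed
qed

lemma set_mult_subset_subgroup:
  assumes "subgroup W G" "A \<subseteq> W" "B \<subseteq> W"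
  shows "A <#> B \<subseteq> W"
  using assms subgroup.m_closed[OF assms(1)] by (auto simp: set_mult_def)

lemma conj_nat_pow:
  assumes "g \<in> carrier G" "h \<in> carrier G"
  shows "(g \<otimes> h \<otimes> inv g) [^] (n :: nat) = g \<otimes> h [^] n \<otimes> inv g"
  by (induction n) (use assms in \<open>simp_all add: m_assoc\<close>)

end

text \<open>Keeps only the differences of weight 1, which are available for every element since
  \<open>H 1\<close> is the whole group.\<close>

lemma (in group_filtration) deg_imp_dd: "deg (carrier G) k f \<Longrightarrow> dd k f"
proof (induction k arbitrary: f)
  case (Suc k)
  have "deg (carrier G) k (left_diff G h f)" if "h \<in> carrier G" for h
    using Suc.prems that filtration_1 by (auto dest: spec[of _ 0])
  then show ?case
    using Suc.IH by (simp add: dd_Suc)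
qed simp

context profinite_group
begin

abbreviation Z :: "nat \<Rightarrow> nat \<Rightarrow> 'a set"
  where "Z p \<equiv> zassenhaus p G T"

definition closed_normal :: "'a set \<Rightarrow> bool"
  where "closed_normal N \<longleftrightarrow> N \<lhd> G \<and> closedin T N"

lemma closed_normal_power:
  assumes "A \<lhd> G"
  shows "closed_normal (closed_power G T A p)"
proof -
  have sub: "{h [^] p | h. h \<in> A} \<subseteq> carrier G"
    using normal_carrierD[OF assms] by auto
  have "g \<otimes> a \<otimes> inv g \<in> {h [^] p | h. h \<in> A}" if a: "a \<in> {h [^] p | h. h \<in> A}" and g: "g \<in> carrier G" for a g
  proof -
    obtain h where h: "h \<in> A" "a = h [^] p"
      using a by blast
    then have "g \<otimes> a \<otimes> inv g = (g \<otimes> h \<otimes> inv g) [^] p"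
      using conj_nat_pow g normal_carrierD[OF assms] by simp
    then show ?thesis
      using normal_conj[OF assms g h(1)] by blast
  qed
  then show ?thesis
    unfolding closed_normal_def closed_power_def using sub by (intro conjI csg_normal csg_closed) auto
qed

lemma conj_commutator:
  assumes "g \<in> carrier G" "h \<in> carrier G" "k \<in> carrier G"
  shows "g \<otimes> (h \<otimes> k \<otimes> inv h \<otimes> inv k) \<otimes> inv g = (g \<otimes> h \<otimes> inv g) \<otimes> (g \<otimes> k \<otimes> inv g) \<otimes>
    inv (g \<otimes> h \<otimes> inv g) \<otimes> inv (g \<otimes> k \<otimes> inv g)"
  using assms by (simp add: m_assoc inv_mult_group)

lemma closed_normal_commutator:
  assumes "A \<lhd> G" "B \<lhd> G"
  shows "closed_normal (closed_commutator G T A B)"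
proof -
  let ?C = "{h \<otimes> k \<otimes> inv h \<otimes> inv k | h k. h \<in> A \<and> k \<in> B}"
  have sub: "?C \<subseteq> carrier G"
    using normal_carrierD[OF assms(1)] normal_carrierD[OF assms(2)] by auto
  have "g \<otimes> a \<otimes> inv g \<in> ?C" if a: "a \<in> ?C" and g: "g \<in> carrier G" for a g
  proof -
    obtain h k where h: "h \<in> A" "k \<in> B" "a = h \<otimes> k \<otimes> inv h \<otimes> inv k"
      using a by blast
    have "g \<otimes> a \<otimes> inv g = (g \<otimes> h \<otimes> inv g) \<otimes> (g \<otimes> k \<otimes> inv g) \<otimes>
        inv (g \<otimes> h \<otimes> inv g) \<otimes> inv (g \<otimes> k \<otimes> inv g)"
      unfolding h(3) using g h normal_carrierD[OF assms(1)] normal_carrierD[OF assms(2)]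
      by (intro conj_commutator) auto
    then show ?thesis
      using normal_conj[OF assms(1) g h(1)] normal_conj[OF assms(2) g h(2)] by blast
  qed
  then show ?thesis
    unfolding closed_normal_def closed_commutator_def using sub by (intro conjI csg_normal csg_closed) auto
qed

lemma closed_normal_set_mult: "closed_normal A \<Longrightarrow> closed_normal B \<Longrightarrow> closed_normal (A <#> B)"
  unfolding closed_normal_def using normal_set_mult closed_set_mult by blast

lemma closed_normal_one: "closed_normal {\<one>}"
  unfolding closed_normal_def using normal_one Hausdorff
  by (simp add: closedin_Hausdorff_singleton)

lemma closed_normal_foldr:
  assumes "\<And>i. i \<in> set is \<Longrightarrow> closed_normal (F i)"
  shows "closed_normal (foldr (\<lambda>i A. F i <#> A) is {\<one>})"
  using assms by (induction "is") (auto intro: closed_normal_one closed_normal_set_mult)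

lemma one_in_closed_normal: "closed_normal A \<Longrightarrow> \<one> \<in> A"
  unfolding closed_normal_def using normal_imp_subgroup subgroup.one_closed by metis

lemma closed_normal_subset: "closed_normal A \<Longrightarrow> A \<subseteq> carrier G"
  unfolding closed_normal_def using normal_imp_subgroup subgroup.subset by metis

lemma subset_set_mult:
  assumes "closed_normal A" "closed_normal B"
  shows "A \<subseteq> A <#> B" "B \<subseteq> A <#> B"
proof -
  show "A \<subseteq> A <#> B"
  proof
    fix x assume "x \<in> A"
    then have "x \<otimes> \<one> \<in> A <#> B" "x \<in> carrier G"
      using one_in_closed_normal[OF assms(2)] closed_normal_subset[OF assms(1)]
      unfolding set_mult_def by blast+
    then show "x \<in> A <#> B"
      by simp
  qed
  show "B \<subseteq> A <#> B"
  proof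
    fix x assume "x \<in> B"
    then have "\<one> \<otimes> x \<in> A <#> B" "x \<in> carrier G"
      using one_in_closed_normal[OF assms(1)] closed_normal_subset[OF assms(2)]
      unfolding set_mult_def by blast+
    then show "x \<in> A <#> B"
      by simp
  qed
qed

lemma subset_foldr:
  assumes "\<And>i. i \<in> set is \<Longrightarrow> closed_normal (F i)" "j \<in> set is"
  shows "F j \<subseteq> foldr (\<lambda>i A. F i <#> A) is {\<one>}"
  using assms
proof (induction "is")
  case (Cons i "is")
  have "closed_normal (foldr (\<lambda>i A. F i <#> A) is {\<one>})"
    using Cons.prems by (intro closed_normal_foldr) auto
  then have "F i \<subseteq> F i <#> foldr (\<lambda>i A. F i <#> A) is {\<one>}"
    "foldr (\<lambda>i A. F i <#> A) is {\<one>} \<subseteq> F i <#> foldr (\<lambda>i A. F i <#> A) is {\<one>}"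
    using Cons.prems subset_set_mult by auto
  then show ?case
    using Cons by auto
qed simp

lemma foldr_subset_subgroup:
  assumes "subgroup W G" "\<And>i. i \<in> set is \<Longrightarrow> F i \<subseteq> W"
  shows "foldr (\<lambda>i A. F i <#> A) is {\<one>} \<subseteq> W"
  using assms(2)
proof (induction "is")
  case Nil
  then show ?case
    using subgroup.one_closed[OF assms(1)] by simp
next
  case (Cons i "is")
  then show ?case
    using set_mult_subset_subgroup[OF assms(1)] by simp
qed

abbreviation ceil_div :: "nat \<Rightarrow> nat \<Rightarrow> nat"
  where "ceil_div n p \<equiv> nat \<lceil>real n / real p\<rceil>"

lemma ceil_div_bounds:
  assumes "2 \<le> p" "2 \<le> n"
  shows "1 \<le> ceil_div n p" "ceil_div n p < n"
proof -
  have "0 < real n / real p"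
    using assms by simp
  then have "0 < \<lceil>real n / real p\<rceil>"
    by (simp only: zero_less_ceiling)
  then show "1 \<le> ceil_div n p"
    by linarith
  have "real n / real p \<le> real n / 2"
    using assms by (intro divide_left_mono) auto
  also have "\<dots> \<le> real n - 1"
    using assms by simp
  finally have "\<lceil>real n / real p\<rceil> \<le> int n - 1"
    unfolding ceiling_le_iff by simp
  then show "ceil_div n p < n"
    using assms by linarith
qed

lemma ceil_div_mult: "2 \<le> p \<Longrightarrow> ceil_div (p * i) p = i"
  by simp

lemma ceil_div_Suc:
  assumes "2 \<le> p"
  shows "ceil_div (Suc n) p = ceil_div n p \<or> ceil_div (Suc n) p = Suc (ceil_div n p)"
proof -
  have "real n / real p \<le> real (Suc n) / real p" "real (Suc n) / real p \<le> real n / real p + 1"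
    using assms by (simp_all add: field_simps)
  then have "\<lceil>real n / real p\<rceil> \<le> \<lceil>real (Suc n) / real p\<rceil>"
    "\<lceil>real (Suc n) / real p\<rceil> \<le> \<lceil>real n / real p\<rceil> + 1"
    by linarith+
  moreover have "0 \<le> \<lceil>real n / real p\<rceil>"
    using order_less_le_trans[of "-1" 0 "real n / real p"] by simp
  ultimately show ?thesis
    by linarith
qed

lemma zassenhaus_rec:
  assumes "2 \<le> p" "2 \<le> n"
  shows "Z p n = closed_power G T (Z p (ceil_div n p)) p <#>
    foldr (\<lambda>i A. closed_commutator G T (Z p i) (Z p (n - i)) <#> A) [1..<n] {\<one>}"
  using assms by (subst zassenhaus.simps) auto

lemma zassenhaus_le_1: "n \<le> 1 \<Longrightarrow> Z p n = carrier G"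
  by (simp add: zassenhaus.simps)

lemma closed_normal_zassenhaus: "closed_normal (Z p n)"
proof (induction n rule: less_induct)
  case (less n)
  show ?case
  proof (cases "n \<le> 1 \<or> p < 2")
    case True
    then show ?thesis
      using normal_carrier by (simp add: zassenhaus.simps closed_normal_def)
  next
    case False
    have "closed_normal (closed_power G T (Z p (ceil_div n p)) p)"
      using less.IH[OF ceil_div_bounds(2)] False by (intro closed_normal_power) (auto simp: closed_normal_def)
    moreover have "closed_normal (foldr (\<lambda>i A. closed_commutator G T (Z p i) (Z p (n - i)) <#> A) [1..<n] {\<one>})"
      using less.IH by (intro closed_normal_foldr closed_normal_commutator) (auto simp: closed_normal_def)
    ultimately show ?thesis
      using False by (simp add: zassenhaus_rec closed_normal_set_mult)
  qed
qed

lemma normal_zassenhaus: "Z p n \<lhd> G" and closed_zassenhaus: "closedin T (Z p n)"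
  using closed_normal_zassenhaus by (auto simp: closed_normal_def)

lemma zassenhaus_subset: "Z p n \<subseteq> carrier G"
  using closed_normal_subset closed_normal_zassenhaus by blast

lemma pow_zassenhaus:
  assumes "2 \<le> p" "2 \<le> n" "x \<in> Z p (ceil_div n p)"
  shows "x [^] p \<in> Z p n"
proof -
  have "x [^] p \<in> {h [^] p | h. h \<in> Z p (ceil_div n p)}"
    using assms by blast
  then have "x [^] p \<in> closed_power G T (Z p (ceil_div n p)) p"
    unfolding closed_power_def using csg_subset by (rule rev_subsetD)
  also have "\<dots> \<subseteq> Z p n"
    unfolding zassenhaus_rec[OF assms(1,2)]
    by (intro subset_set_mult closed_normal_power closed_normal_foldr closed_normal_commutator normal_zassenhaus)
  finally show ?thesis .
qed

lemma commutator_zassenhaus: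
  assumes "2 \<le> p" "i \<ge> 1" "j \<ge> 1" "x \<in> Z p i" "y \<in> Z p j"
  shows "x \<otimes> y \<otimes> inv x \<otimes> inv y \<in> Z p (i + j)"
proof -
  let ?n = "i + j"
  let ?F = "\<lambda>i. closed_commutator G T (Z p i) (Z p (?n - i))"
  have n: "2 \<le> ?n"
    using assms by simp
  have F: "closed_normal (?F k)" for k
    using normal_zassenhaus by (intro closed_normal_commutator)
  have "x \<otimes> y \<otimes> inv x \<otimes> inv y \<in> {h \<otimes> k \<otimes> inv h \<otimes> inv k | h k. h \<in> Z p i \<and> k \<in> Z p (?n - i)}"
    using assms by auto
  then have "x \<otimes> y \<otimes> inv x \<otimes> inv y \<in> ?F i"
    unfolding closed_commutator_def using csg_subset by (rule rev_subsetD)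
  also have "?F i \<subseteq> foldr (\<lambda>i A. ?F i <#> A) [1..<?n] {\<one>}"
    using assms F by (intro subset_foldr) auto
  also have "\<dots> \<subseteq> Z p ?n"
    unfolding zassenhaus_rec[OF assms(1) n]
    by (intro subset_set_mult closed_normal_power normal_zassenhaus closed_normal_foldr F)
  finally show ?thesis .
qed

text \<open>The recursion multiplies closed subgroups generated by powers and commutators, so it
  suffices to test these generators. Upper bounds on \<open>Z p n\<close> are derived in this way
  below.\<close>

lemma zassenhaus_least:
  assumes p: "2 \<le> p" and n: "2 \<le> n" and W: "subgroup W G" "closedin T W"
    and pow: "\<And>x. x \<in> Z p (ceil_div n p) \<Longrightarrow> x [^] p \<in> W"
    and comm: "\<And>i x y. 1 \<le> i \<Longrightarrow> i < n \<Longrightarrow> x \<in> Z p i \<Longrightarrow> y \<in> Z p (n - i) \<Longrightarrow>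
      x \<otimes> y \<otimes> inv x \<otimes> inv y \<in> W"
  shows "Z p n \<subseteq> W"
  unfolding zassenhaus_rec[OF p n]
proof (intro set_mult_subset_subgroup foldr_subset_subgroup W(1))
  show "closed_power G T (Z p (ceil_div n p)) p \<subseteq> W"
    unfolding closed_power_def using pow by (intro csg_minimal W) auto
  show "closed_commutator G T (Z p i) (Z p (n - i)) \<subseteq> W" if "i \<in> set [1..<n]" for i
    unfolding closed_commutator_def using comm that by (intro csg_minimal W) auto
qed

text \<open>The recursion does not make the filtration descending by itself. By induction the
  ingredients of level \<open>Suc n\<close> lie in those of level \<open>n\<close>, because
  \<open>ceil_div\<close> grows by at most one at each step.\<close>

lemma zassenhaus_Suc:
  assumes p: "2 \<le> p"
  shows "Z p (Suc n) \<subseteq> Z p n"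
proof (induction n rule: less_induct)
  case (less n)
  show ?case
  proof (cases "n \<le> 1")
    case True
    then show ?thesis
      using zassenhaus_subset by (simp add: zassenhaus_le_1)
  next
    case False
    then have n: "2 \<le> n" "2 \<le> Suc n"
      by simp_all
    show ?thesis
    proof (rule zassenhaus_least[OF p n(2)])
      show "subgroup (Z p n) G" "closedin T (Z p n)"
        using normal_zassenhaus normal_imp_subgroup closed_zassenhaus by blast+
      fix x assume x: "x \<in> Z p (ceil_div (Suc n) p)"
      have "x \<in> Z p (ceil_div n p)"
        using ceil_div_Suc[OF p, of n] less.IH[OF ceil_div_bounds(2)[OF p n(1)]] x by auto
      then show "x [^] p \<in> Z p n"
        by (rule pow_zassenhaus[OF p n(1)])
    next
      fix i x y assume i: "1 \<le> i" "i < Suc n" and xy: "x \<in> Z p i" "y \<in> Z p (Suc n - i)"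
      show "x \<otimes> y \<otimes> inv x \<otimes> inv y \<in> Z p n"
      proof (cases "i = n")
        case False
        then have "y \<in> Z p (n - i)"
          using less.IH[of "n - i"] xy i by (auto simp: Suc_diff_le)
        then show ?thesis
          using commutator_zassenhaus[OF p, of i "n - i" x y] i False xy by simp
      next
        \<comment> \<open>For \<open>i = n\<close> the other factor has level 1, so there is no
          commutator at level \<open>n\<close> to compare with; normality of \<open>Z p n\<close>
          takes over.\<close>
        case True
        have y: "y \<in> carrier G" "x \<in> carrier G"
          using xy zassenhaus_subset by auto
        interpret N: normal "Z p n" G
          by (rule normal_zassenhaus)
        have "x \<otimes> (y \<otimes> inv x \<otimes> inv y) \<in> Z p n"
          using xy True y normal_conj[OF normal_zassenhaus y(1)] by auto
        then show ?thesis
          using y by (simp add: m_assoc)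
      qed
    qed
  qed
qed

lemma zassenhaus_group_filtration:
  assumes "2 \<le> p"
  shows "group_filtration G (Z p)"
proof (intro group_filtration.intro weighted_group.intro weighted_group_axioms.intro group_axioms
    group_filtration_axioms.intro)
  fix i
  show "subgroup (Z p i) G"
    using normal_zassenhaus normal_imp_subgroup by blast
  show "Z p (Suc i) \<subseteq> Z p i"
    using zassenhaus_Suc[OF assms] .
qed (use assms in \<open>auto simp: zassenhaus_le_1 intro!: commutator_zassenhaus\<close>)

lemma pth_power_zassenhaus:
  assumes "2 \<le> p" "i \<ge> 1" "x \<in> Z p i"
  shows "x [^] p \<in> Z p (p * i)"
proof (rule pow_zassenhaus)
  have "2 * 1 \<le> p * i"
    using assms by (intro mult_mono) auto
  then show "2 \<le> p * i"
    by simp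
qed (use assms in \<open>simp_all add: ceil_div_mult\<close>)

end

section \<open>How elements of the Zassenhaus filtration lower the degree\<close>

lemma sum_Suc_choose:
  fixes g :: "nat \<Rightarrow> 'b::comm_ring_1"
  shows "(\<Sum>e\<le>Suc a. of_nat (Suc a choose e) * g e) = (\<Sum>e\<le>a. of_nat (a choose e) * (g e + g (Suc e)))"
proof -
  have "(\<Sum>e\<le>Suc a. of_nat (Suc a choose e) * g e) =
      g 0 + (\<Sum>e\<le>a. of_nat (a choose Suc e) * g (Suc e)) + (\<Sum>e\<le>a. of_nat (a choose e) * g (Suc e))"
    by (subst sum.atMost_Suc_shift) (simp add: algebra_simps sum.distrib)
  also have "g 0 + (\<Sum>e\<le>a. of_nat (a choose Suc e) * g (Suc e)) = (\<Sum>e\<le>Suc a. of_nat (a choose e) * g e)"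
    by (subst sum.atMost_Suc_shift) simp
  also have "\<dots> = (\<Sum>e\<le>a. of_nat (a choose e) * g e)"
    by (simp add: binomial_eq_0)
  finally show ?thesis
    by (simp add: algebra_simps sum.distrib)
qed

context topological_group
begin

abbreviation cont :: "('a \<Rightarrow> 'c) \<Rightarrow> bool"
  where "cont \<equiv> continuous_map T (discrete_topology UNIV)"

lemma cont_compose: "continuous_map T T g \<Longrightarrow> cont f \<Longrightarrow> cont (\<lambda>x. f (g x))"
  using continuous_map_compose[of T T g _ f] by (simp add: o_def)

lemma cont_left_translate: "cont f \<Longrightarrow> g \<in> carrier G \<Longrightarrow> cont (\<lambda>x. f (g \<otimes> x))"
  by (rule cont_compose[of "\<lambda>x. g \<otimes> x" f]) (simp_all add: continuous_group_intros)

lemma cont_right_translate: "cont f \<Longrightarrow> g \<in> carrier G \<Longrightarrow> cont (\<lambda>x. f (x \<otimes> g))"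
  by (rule cont_compose[of "\<lambda>x. x \<otimes> g" f]) (simp_all add: continuous_group_intros)

lemma cont_left_diff: "cont f \<Longrightarrow> g \<in> carrier G \<Longrightarrow> cont (left_diff G g f)"
  unfolding left_diff_def by (rule continuous_map_discrete_compose2[OF cont_left_translate])

lemma closedin_Collect_ball:
  assumes "\<And>i. i \<in> I \<Longrightarrow> closedin T {g \<in> carrier G. P i g}"
  shows "closedin T {g \<in> carrier G. \<forall>i\<in>I. P i g}"
proof (cases "I = {}")
  case False
  then have "{g \<in> carrier G. \<forall>i\<in>I. P i g} = (\<Inter>i\<in>I. {g \<in> carrier G. P i g})"
    by auto
  then show ?thesis
    using assms False by auto
qed simp

text \<open>Unfolded, \<open>dd m (F g)\<close> is a conjunction of linear equations, each between
  finitely many values of \<open>F g\<close> and hence closed in \<open>g\<close>.\<close>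

lemma closedin_dd:
  assumes "\<And>s. s \<in> carrier G \<Longrightarrow> cont (\<lambda>g. F g s)"
  shows "closedin T {g \<in> carrier G. dd m (F g)}"
  using assms
proof (induction m arbitrary: F)
  case 0
  have "closedin T {g \<in> carrier G. F g s = 0}" if "s \<in> carrier G" for s
    using closedin_discrete_preimage[OF 0[OF that], of "{0}"] by simp
  then show ?case
    by (simp add: closedin_Collect_ball)
next
  case (Suc m)
  have "closedin T {g \<in> carrier G. dd m (left_diff G h (F g))}" if "h \<in> carrier G" for h
    using that Suc.prems
    by (intro Suc.IH) (auto simp: left_diff_def intro: continuous_map_discrete_compose2[where h = "(-)"])
  then show ?case
    by (simp add: dd_Suc closedin_Collect_ball)
qed

end

text \<open>\<open>(x - 1)^p = x^p - 1\<close> in characteristic p. The fact \<open>pow\<close> is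
  Newton's forward difference formula, and at exponent p only its two extreme terms survive.\<close>

lemma (in group) left_diff_pow_prime_card:
  fixes f :: "'a \<Rightarrow> 'p::prime_card mod_ring"
  assumes x: "x \<in> carrier G" and s: "s \<in> carrier G"
  shows "left_diff G (x [^] CARD('p)) f s = (left_diff G x ^^ CARD('p)) f s"
proof -
  let ?p = "CARD('p)"
  let ?D = "\<lambda>e. (left_diff G x ^^ e) f"
  have pow: "f (x [^] a \<otimes> s) = (\<Sum>e\<le>a. of_nat (a choose e) * ?D e s)" if "s \<in> carrier G" for a :: nat and s
    using that
  proof (induction a arbitrary: s)
    case (Suc a)
    have "f (x [^] Suc a \<otimes> s) = f (x [^] a \<otimes> (x \<otimes> s))"
      using x Suc.prems by (simp add: m_assoc)
    also have "\<dots> = (\<Sum>e\<le>a. of_nat (a choose e) * ?D e (x \<otimes> s))"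
      using x Suc by simp
    also have "\<dots> = (\<Sum>e\<le>a. of_nat (a choose e) * (?D e s + ?D (Suc e) s))"
      by (simp add: left_diff_def)
    finally show ?case
      by (simp only: sum_Suc_choose)
  qed simp
  have "(\<Sum>e\<le>?p. of_nat (?p choose e) * ?D e s) = (\<Sum>e\<in>{0, ?p}. of_nat (?p choose e) * ?D e s)"
    using of_nat_choose_prime_card_eq_0[where 'p='p] by (intro sum.mono_neutral_right) auto
  also have "\<dots> = f s + ?D ?p s"
    using prime_gt_0_nat[OF prime_card[where 'a='p]] by simp
  finally show ?thesis
    using pow[OF s] by (simp add: left_diff_def)
qed

context profinite_group
begin

text \<open>Dual description of a dimension subgroup: \<open>g - 1\<close> lowers degrees by
  \<open>k\<close>. All bounds \<open>n\<close> occur at once so that differences can be iterated;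
  the quantifier over pairs has the shape \<open>closedin_Collect_ball\<close> expects. The type
  argument fixes the field of values.\<close>

definition diff_lowering :: "'p::prime_card itself \<Rightarrow> nat \<Rightarrow> 'a set"
  where "diff_lowering _ k = {g \<in> carrier G. \<forall>(n, f) \<in> {(n, f :: 'a \<Rightarrow> 'p mod_ring). cont f \<and> dd n f}.
    dd (n - k) (left_diff G g f)}"

lemma diff_loweringD:
  fixes f :: "'a \<Rightarrow> 'p::prime_card mod_ring"
  shows "g \<in> diff_lowering TYPE('p) k \<Longrightarrow> cont f \<Longrightarrow> dd n f \<Longrightarrow> dd (n - k) (left_diff G g f)"
  by (auto simp: diff_lowering_def)

lemma closedin_diff_lowering: "closedin T (diff_lowering TYPE('p::prime_card) k)"
  unfolding diff_lowering_def
proof (rule closedin_Collect_ball, clarify)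
  fix n and f :: "'a \<Rightarrow> 'p mod_ring" assume "cont f"
  then show "closedin T {g \<in> carrier G. dd (n - k) (left_diff G g f)}"
    by (intro closedin_dd)
      (auto simp: left_diff_def intro: cont_right_translate continuous_map_discrete_compose2[where h = "(-)"])
qed

lemma subgroup_diff_lowering: "subgroup (diff_lowering TYPE('p::prime_card) k) G"
proof (rule subgroupI)
  show "diff_lowering TYPE('p) k \<subseteq> carrier G"
    by (auto simp: diff_lowering_def)
  have "\<one> \<in> diff_lowering TYPE('p) k"
    by (auto simp: diff_lowering_def left_diff_def intro: dd_zero)
  then show "diff_lowering TYPE('p) k \<noteq> {}"
    by blast
next
  fix a assume a: "a \<in> diff_lowering TYPE('p) k"
  then have aG: "a \<in> carrier G"
    by (simp add: diff_lowering_def)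
  have "dd (n - k) (left_diff G (inv a) f)" if "cont f" "dd n f" for n and f :: "'a \<Rightarrow> 'p mod_ring"
  proof -
    have "dd (n - k) (\<lambda>x. - left_diff G a f (inv a \<otimes> x))"
      using dd_additive_map[of uminus, OF _ dd_translate[OF diff_loweringD[OF a that], of "inv a"]] aG by simp
    then show ?thesis
      by (subst dd_cong[where f' = "\<lambda>x. - left_diff G a f (inv a \<otimes> x)"]) (use aG in \<open>auto simp: left_diff_def\<close>)
  qed
  then show "inv a \<in> diff_lowering TYPE('p) k"
    using aG by (auto simp: diff_lowering_def)
next
  fix a b assume ab: "a \<in> diff_lowering TYPE('p) k" "b \<in> diff_lowering TYPE('p) k"
  then have abG: "a \<in> carrier G" "b \<in> carrier G"
    by (simp_all add: diff_lowering_def)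
  have "dd (n - k) (left_diff G (a \<otimes> b) f)" if "cont f" "dd n f" for n and f :: "'a \<Rightarrow> 'p mod_ring"
  proof -
    have "dd (n - k) (\<lambda>x. left_diff G a f (b \<otimes> x) + left_diff G b f x)"
      using diff_loweringD[OF ab(1) that] diff_loweringD[OF ab(2) that] abG
      by (intro dd_add dd_translate) auto
    then show ?thesis
      by (subst dd_cong[where f' = "\<lambda>x. left_diff G a f (b \<otimes> x) + left_diff G b f x"])
        (use abG in \<open>auto simp: left_diff_def m_assoc\<close>)
  qed
  then show "a \<otimes> b \<in> diff_lowering TYPE('p) k"
    using abG by (auto simp: diff_lowering_def)
qed

text \<open>The easy half of Jennings' theorem. By \<open>zassenhaus_least\<close> only generators
  matter: the difference by \<open>x^p\<close> is a p-fold difference by \<open>x\<close>, and the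
  difference by a commutator comes from the two orders of taking differences. Continuity is carried
  along since \<open>diff_lowering\<close> speaks of continuous functions only.\<close>

lemma zassenhaus_subset_diff_lowering: "Z CARD('p) k \<subseteq> diff_lowering TYPE('p::prime_card) k"
proof (induction k rule: less_induct)
  case (less k)
  let ?p = "CARD('p)"
  have p: "2 \<le> ?p"
    using prime_ge_2_nat[OF prime_card[where 'a='p]] .
  show ?case
  proof (cases "k \<le> 1")
    case True
    have "dd (n - k) (left_diff G g f)" if "g \<in> carrier G" "dd n f" for g n and f :: "'a \<Rightarrow> 'p mod_ring"
      using dd_left_diff[OF that(2,1)] by (rule dd_mono) (use True in simp)
    then show ?thesis
      using True by (auto simp: zassenhaus_le_1 diff_lowering_def)
  next
    case False
    then have k: "2 \<le> k"
      by simp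
    show ?thesis
    proof (rule zassenhaus_least[OF p k subgroup_diff_lowering closedin_diff_lowering])
      fix x assume "x \<in> Z ?p (ceil_div k ?p)"
      then have x: "x \<in> diff_lowering TYPE('p) (ceil_div k ?p)" "x \<in> carrier G"
        using less.IH[OF ceil_div_bounds(2)[OF p k]] zassenhaus_subset by auto
      have "real k / real ?p \<le> real (ceil_div k ?p)"
        by linarith
      then have "real k \<le> real (ceil_div k ?p) * real ?p"
        using p by (subst (asm) pos_divide_le_eq) simp_all
      then have kp: "k \<le> ?p * ceil_div k ?p"
        by (metis mult.commute of_nat_le_iff of_nat_mult)
      have "dd (n - k) (left_diff G (x [^] ?p) f)" if f: "cont f" "dd n f" for n and f :: "'a \<Rightarrow> 'p mod_ring"
      proof -
        have "cont ((left_diff G x ^^ e) f) \<and> dd (n - e * ceil_div k ?p) ((left_diff G x ^^ e) f)" for e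
        proof (induction e)
          case (Suc e)
          then have "cont (left_diff G x ((left_diff G x ^^ e) f))"
            "dd (n - e * ceil_div k ?p - ceil_div k ?p) (left_diff G x ((left_diff G x ^^ e) f))"
            using cont_left_diff[OF _ x(2)] diff_loweringD[OF x(1)] by blast+
          then show ?case
            by (simp add: add.commute)
        qed (use f in simp)
        then have "dd (n - ?p * ceil_div k ?p) ((left_diff G x ^^ ?p) f)"
          by blast
        then have "dd (n - k) ((left_diff G x ^^ ?p) f)"
          by (rule dd_mono) (use kp in simp)
        then show ?thesis
          by (subst dd_cong[where f' = "(left_diff G x ^^ ?p) f"]) (use x left_diff_pow_prime_card in auto)
      qed
      then show "x [^] ?p \<in> diff_lowering TYPE('p) k"
        using x by (auto simp: diff_lowering_def)
    next
      fix i x y assume i: "1 \<le> i" "i < k" and "x \<in> Z ?p i" "y \<in> Z ?p (k - i)"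
      then have x: "x \<in> diff_lowering TYPE('p) i" and y: "y \<in> diff_lowering TYPE('p) (k - i)"
        and G: "x \<in> carrier G" "y \<in> carrier G"
        using less.IH[of i] less.IH[of "k - i"] zassenhaus_subset[of ?p i] zassenhaus_subset[of ?p "k - i"]
        by auto
      define c where "c = x \<otimes> y \<otimes> inv x \<otimes> inv y"
      have "dd (n - k) (left_diff G c f)" if f: "cont f" "dd n f" for n and f :: "'a \<Rightarrow> 'p mod_ring"
      proof -
        \<comment> \<open>In the group algebra,
          \<open>[x,y] - 1 = ((x-1)(y-1) - (y-1)(x-1)) (y x)^-1\<close>; the last factor becomes a
          translation of the argument.\<close>
        let ?u = "left_diff G y (left_diff G x f)" and ?v = "left_diff G x (left_diff G y f)"
        have "dd (n - i - (k - i)) ?u" "dd (n - (k - i) - i) ?v"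
          by (intro diff_loweringD x y cont_left_diff f G)+
        then have "dd (n - k) (\<lambda>s. ?u s - ?v s)"
          using i by (intro dd_diff) (simp_all add: diff_commute)
        then have 1: "dd (n - k) (\<lambda>s. ?u (inv (y \<otimes> x) \<otimes> s) - ?v (inv (y \<otimes> x) \<otimes> s))"
          using G by (intro dd_translate[of _ "\<lambda>s. ?u s - ?v s"]) auto
        have "left_diff G c f s = ?u (inv (y \<otimes> x) \<otimes> s) - ?v (inv (y \<otimes> x) \<otimes> s)" if s: "s \<in> carrier G" for s
        proof -
          define t where "t = inv (y \<otimes> x) \<otimes> s"
          have t: "t \<in> carrier G" "s = y \<otimes> x \<otimes> t"
            using s G by (auto simp: t_def m_assoc inv_mult_group)
          have "c \<otimes> s = x \<otimes> (y \<otimes> t)"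
            using t(1) G unfolding t(2) by (simp add: c_def m_assoc)
          then have "left_diff G c f s = ?u t - ?v t"
            using t(1) G unfolding t(2) by (simp add: left_diff_def m_assoc)
          then show ?thesis
            by (simp only: t_def)
        qed
        then show ?thesis
          by (subst dd_cong) (use 1 in auto)
      qed
      then show "x \<otimes> y \<otimes> inv x \<otimes> inv y \<in> diff_lowering TYPE('p) k"
        using G by (auto simp: diff_lowering_def c_def)
    qed
  qed
qed

lemma dd_zassenhaus:
  fixes f :: "'a \<Rightarrow> 'p::prime_card mod_ring"
  assumes "g \<in> Z CARD('p) k" "cont f" "dd n f"
  shows "dd (n - k) (left_diff G g f)"
  using diff_loweringD zassenhaus_subset_diff_lowering assms by blast

lemma zassenhaus_left_invariant:
  fixes f :: "'a \<Rightarrow> 'p::prime_card mod_ring"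
  assumes "g \<in> Z CARD('p) k" "cont f" "dd k f" "s \<in> carrier G"
  shows "f (g \<otimes> s) = f s"
  using dd_zassenhaus[OF assms(1-3)] assms(4) by (simp add: left_diff_def)

text \<open>\<open>H' i\<close> is the product of \<open>V\<close> with \<open>H i\<close>, the
  preimage of the filtration induced on \<open>G/V\<close>. Using preimages keeps the argument
  inside \<open>G\<close>, while the inclusion of \<open>V\<close> makes all terms open once
  \<open>V\<close> is.\<close>

lemma filtration_mod_normal:
  assumes "group_filtration G H" and V: "V \<lhd> G"
  defines "H' \<equiv> \<lambda>i. {a \<in> carrier G. \<exists>x\<in>H i. V #> a = V #> x}"
  shows "group_filtration G H'"
    and "\<And>p. (\<And>i x. i \<ge> 1 \<Longrightarrow> x \<in> H i \<Longrightarrow> x [^] p \<in> H (p * i)) \<Longrightarrow>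
      group_filtration.pth_power_filtration G H' p"
    and "\<And>i. i \<ge> 1 \<Longrightarrow> V \<subseteq> H' i"
proof -
  interpret F: group_filtration G H by fact
  interpret V: normal V G by fact
  define \<phi> where "\<phi> = (\<lambda>a. V #> a)"
  interpret Q: group "G Mod V"
    by (rule V.factorgroup_is_group)
  interpret \<phi>: group_hom G "G Mod V" \<phi>
    unfolding group_hom_def group_hom_axioms_def \<phi>_def
    using V.r_coset_hom_Mod Q.is_group is_group by simp
  have H': "H' i = {a \<in> carrier G. \<exists>x\<in>H i. \<phi> a = \<phi> x}" for i
    by (simp add: H'_def \<phi>_def)
  show fil: "group_filtration G H'"
  proof (intro group_filtration.intro weighted_group.intro weighted_group_axioms.intro group_axioms
      group_filtration_axioms.intro)
    show "H' 1 = carrier G"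
      using F.filtration_1 by (auto simp: H')
  next
    fix i :: nat assume i: "1 \<le> i"
    interpret Hi: subgroup "H i" G
      by (rule F.subgroup_filtration[OF i])
    show "subgroup (H' i) G"
    proof (rule subgroupI)
      show "H' i \<noteq> {}"
        unfolding H' using Hi.one_closed one_closed by blast
    next
      fix a assume "a \<in> H' i"
      then obtain x where "a \<in> carrier G" "x \<in> H i" "\<phi> a = \<phi> x"
        by (auto simp: H')
      then show "inv a \<in> H' i"
        by (auto simp: H' intro!: bexI[of _ "inv x"])
    next
      fix a b assume "a \<in> H' i" "b \<in> H' i"
      then obtain x y where "a \<in> carrier G" "x \<in> H i" "\<phi> a = \<phi> x" "b \<in> carrier G" "y \<in> H i" "\<phi> b = \<phi> y"
        by (auto simp: H')
      then show "a \<otimes> b \<in> H' i"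
        by (auto simp: H' intro!: bexI[of _ "x \<otimes> y"])
    qed (auto simp: H')
    show "H' (Suc i) \<subseteq> H' i"
      using F.filtration_Suc[OF i] by (auto simp: H')
    fix j a b assume j: "1 \<le> j" and "a \<in> H' i" "b \<in> H' j"
    then obtain x y where xy: "a \<in> carrier G" "x \<in> H i" "\<phi> a = \<phi> x" "b \<in> carrier G" "y \<in> H j" "\<phi> b = \<phi> y"
      by (auto simp: H')
    moreover have "x \<in> carrier G" "y \<in> carrier G"
      using xy F.filtration_carrier i j by auto
    ultimately show "a \<otimes> b \<otimes> inv a \<otimes> inv b \<in> H' (i + j)"
      using F.commutator_filtration[OF i j xy(2,5)]
      by (auto simp: H' intro!: bexI[of _ "x \<otimes> y \<otimes> inv x \<otimes> inv y"])
  qed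
  show "group_filtration.pth_power_filtration G H' p" if pth: "\<And>i x. i \<ge> 1 \<Longrightarrow> x \<in> H i \<Longrightarrow> x [^] p \<in> H (p * i)" for p
  proof -
    have "a [^] p \<in> H' (p * i)" if i: "1 \<le> i" and a: "a \<in> H' i" for i a
    proof -
      obtain x where x: "a \<in> carrier G" "x \<in> H i" "\<phi> a = \<phi> x"
        using a by (auto simp: H')
      then have "\<phi> (a [^] p) = \<phi> (x [^] p)"
        using F.filtration_carrier[OF i] by (simp add: \<phi>.hom_nat_pow)
      then show ?thesis
        using x pth[OF i x(2)] by (auto simp: H')
    qed
    then show ?thesis
      by (simp add: group_filtration.pth_power_filtration_def[OF fil])
  qed
  show "V \<subseteq> H' i" if "1 \<le> i" for i
  proof
    fix v assume "v \<in> V"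
    then have "V #> v = V #> \<one>"
      using coset_join2[OF _ V.subgroup_axioms] V.subset by (simp add: subset_iff)
    then show "v \<in> H' i"
      using \<open>v \<in> V\<close> subgroup.one_closed[OF F.subgroup_filtration[OF that]] by (auto simp: H'_def)
  qed
qed

text \<open>As \<open>Z n\<close> is closed, some open normal \<open>V\<close> keeps
  \<open>s\<close> outside the product of \<open>V\<close> with \<open>Z n\<close>. That product has
  finite index, so \<open>deg_separates\<close> applies; and it contains \<open>V\<close>, so a
  function of degree less than \<open>n\<close> is invariant under \<open>V\<close>.\<close>

lemma zassenhaus_separation:
  assumes s: "s \<in> carrier G" "s \<notin> Z CARD('p::prime_card) n" and n: "n \<ge> 1"
  shows "\<exists>V (f :: 'a \<Rightarrow> 'p mod_ring). V \<lhd> G \<and> openin T V \<and> (\<forall>v\<in>V. \<forall>x\<in>carrier G. f (v \<otimes> x) = f x) \<and>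
    dd n f \<and> f s \<noteq> f \<one>"
proof -
  let ?p = "CARD('p)"
  have p: "2 \<le> ?p"
    using prime_ge_2_nat[OF prime_card[where 'a='p]] .
  have "subgroup (Z ?p n) G"
    using normal_zassenhaus normal_imp_subgroup by blast
  then obtain V where V: "V \<lhd> G" "openin T V" "\<forall>a\<in>Z ?p n. V #> s \<noteq> V #> a"
    using separate_closed_subgroup[OF _ closed_zassenhaus s] by blast
  define H where "H = (\<lambda>i. {a \<in> carrier G. \<exists>x\<in>Z ?p i. V #> a = V #> x})"
  note fil = filtration_mod_normal[OF zassenhaus_group_filtration[OF p] V(1), folded H_def]
  interpret F: group_filtration G H
    by (rule fil(1))
  interpret V: normal V G
    by fact
  have pth: "F.pth_power_filtration ?p"
    using pth_power_zassenhaus[OF p] by (intro fil(2))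
  have VH: "V \<subseteq> H n"
    using fil(3)[OF n] by (simp add: H_def)
  \<comment> \<open>Since \<open>V\<close> lies in \<open>H n\<close>, each coset of
    \<open>H n\<close> is determined by a coset of \<open>V\<close>, and there are finitely many of
    the latter.\<close>
  have "(\<lambda>x. H n #> x) ` carrier G = (\<lambda>X. H n <#> X) ` (\<lambda>x. V #> x) ` carrier G"
  proof -
    interpret Hn: subgroup "H n" G
      by (rule F.subgroup_filtration[OF n])
    have "H n <#> V = H n"
    proof
      show "H n <#> V \<subseteq> H n"
        using VH by (intro set_mult_subset_subgroup Hn.subgroup_axioms) auto
      show "H n \<subseteq> H n <#> V"
      proof
        fix x assume "x \<in> H n"
        then have "x \<otimes> \<one> \<in> H n <#> V"
          unfolding set_mult_def using V.one_closed by blast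
        then show "x \<in> H n <#> V"
          using \<open>x \<in> H n\<close> by simp
      qed
    qed
    then have "H n <#> (V #> x) = H n #> x" if "x \<in> carrier G" for x
      using setmult_rcos_assoc[OF Hn.subset V.subset that] by simp
    then show ?thesis
      by (auto simp: image_image)
  qed
  then have fin: "finite ((\<lambda>x. H n #> x) ` carrier G)"
    using finite_index[OF V.subgroup_axioms V(2)] by simp
  have "s \<notin> H n"
    using V(3) by (auto simp: H_def)
  then obtain f :: "'a \<Rightarrow> 'p mod_ring" where f: "F.deg (carrier G) n f" "f s \<noteq> f \<one>"
    using F.deg_separates[OF pth n fin subgroup_self s(1)] by blast
  have "f (v \<otimes> x) = f x" if "v \<in> V" "x \<in> carrier G" for v x
    using that VH n by (intro F.deg_left_diff_zero[OF f(1), of v n]) (auto intro: subgroup_self)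
  then show ?thesis
    using V f F.deg_imp_dd[OF f(1)] by blast
qed

end

section \<open>Unipotent representations\<close>

lemma unipotent_group_carrier_iff:
  "A \<in> carrier (unipotent_group k) \<longleftrightarrow> A \<in> carrier_mat k k \<and>
    (\<forall>i<k. \<forall>j<i. A $$ (i, j) = 0) \<and> (\<forall>i<k. A $$ (i, i) = 1)"
  by (auto simp: unipotent_group_def)

lemma unipotent_group_simps [simp]:
  "mult (unipotent_group k) = (*)" "one (unipotent_group k) = 1\<^sub>m k"
  by (simp_all add: unipotent_group_def)

lemma unipotent_mult_entry:
  assumes "A \<in> carrier (unipotent_group k)" "B \<in> carrier (unipotent_group k)" "i < k" "j < k"
  shows "(A * B) $$ (i, j) = (\<Sum>r<k. A $$ (i, r) * B $$ (r, j))"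
  using assms by (auto simp: unipotent_group_carrier_iff scalar_prod_def atLeast0LessThan intro!: sum.cong)

lemma unipotent_mult_entry_le:
  assumes "A \<in> carrier (unipotent_group k)" "B \<in> carrier (unipotent_group k)" "i \<le> j" "j < k"
  shows "(A * B) $$ (i, j) = (\<Sum>r\<in>{i..j}. A $$ (i, r) * B $$ (r, j))"
proof -
  have "A $$ (i, r) * B $$ (r, j) = 0" if "r < k" "r \<notin> {i..j}" for r
    using that assms by (auto simp: unipotent_group_carrier_iff)
  then have "(\<Sum>r<k. A $$ (i, r) * B $$ (r, j)) = (\<Sum>r\<in>{i..j}. A $$ (i, r) * B $$ (r, j))"
    using assms by (intro sum.mono_neutral_right) auto
  then show ?thesis
    using assms by (simp add: unipotent_mult_entry)
qed

lemma unipotent_mult_closed: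
  assumes "A \<in> carrier (unipotent_group k)" "B \<in> carrier (unipotent_group k)"
  shows "A * B \<in> carrier (unipotent_group k)"
proof -
  have "(A * B) $$ (i, j) = 0" if "i < k" "j < i" for i j
  proof -
    have "A $$ (i, r) * B $$ (r, j) = 0" if "r < k" for r
      using that assms \<open>i < k\<close> \<open>j < i\<close> by (cases "r < i") (auto simp: unipotent_group_carrier_iff)
    then show ?thesis
      using that by (simp add: unipotent_mult_entry[OF assms] sum.neutral del: mult_eq_0_iff)
  qed
  moreover have "(A * B) $$ (i, i) = 1" if "i < k" for i
    using that assms unipotent_mult_entry_le[OF assms, of i i] by (simp add: unipotent_group_carrier_iff)
  moreover have "A * B \<in> carrier_mat k k"
    using assms by (auto simp: unipotent_group_carrier_iff)
  ultimately show ?thesis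
    by (simp add: unipotent_group_carrier_iff)
qed

lemma finite_carrier_mat: "finite (carrier_mat n m :: 'a::finite mat set)"
proof (rule finite_subset)
  show "carrier_mat n m \<subseteq> (\<lambda>f. mat n m f) ` ({..<n} \<times> {..<m} \<rightarrow>\<^sub>E (UNIV :: 'a set))"
  proof
    fix A :: "'a mat" assume "A \<in> carrier_mat n m"
    then have "A = mat n m (restrict (\<lambda>ij. A $$ ij) ({..<n} \<times> {..<m}))"
      by (intro eq_matI) auto
    then show "A \<in> (\<lambda>f. mat n m f) ` ({..<n} \<times> {..<m} \<rightarrow>\<^sub>E (UNIV :: 'a set))"
      by (rule image_eqI[where x = "restrict (\<lambda>ij. A $$ ij) ({..<n} \<times> {..<m})"]) simp
  qed
  show "finite ((\<lambda>f. mat n m f) ` ({..<n} \<times> {..<m} \<rightarrow>\<^sub>E (UNIV :: 'a set)))"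
    by (intro finite_imageI finite_PiE) auto
qed

lemma finite_unipotent_group: "finite (carrier (unipotent_group k :: 'p::prime_card mod_ring mat monoid))"
  by (rule finite_subset[OF _ finite_carrier_mat[of k k]]) (auto simp: unipotent_group_def)

text \<open>Determinant 1 gives a left inverse among all matrices, so multiplication by
  \<open>A\<close> is injective on the finite set of unipotent matrices, hence surjective. Thus an
  inverse is found inside this set without computing its entries.\<close>

lemma group_unipotent_group: "group (unipotent_group k :: 'p::prime_card mod_ring mat monoid)"
proof -
  let ?U = "unipotent_group k :: 'p mod_ring mat monoid"
  have carrier: "A \<in> carrier_mat k k" if "A \<in> carrier ?U" for A
    using that by (simp add: unipotent_group_carrier_iff)
  have inverse: "\<exists>B\<in>carrier ?U. A * B = 1\<^sub>m k" if A: "A \<in> carrier ?U" for A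
  proof -
    have "diag_mat A = map (\<lambda>_. 1) [0..<k]"
      using A by (auto simp: diag_mat_def unipotent_group_carrier_iff)
    then have "det A = 1"
      using det_upper_triangular[of A k] A
      by (auto simp: unipotent_group_def map_replicate_const)
    then have "A \<in> Units (ring_mat TYPE('p mod_ring) k ())"
      using carrier[OF A] by (intro det_non_zero_imp_unit) auto
    then obtain C where C: "C \<in> carrier_mat k k" "C * A = 1\<^sub>m k"
      unfolding Units_def ring_mat_def by auto
    have "inj_on (\<lambda>B. A * B) (carrier ?U)"
    proof (rule inj_onI)
      fix B B' assume B: "B \<in> carrier ?U" "B' \<in> carrier ?U" and eq: "A * B = A * B'"
      have "B = C * (A * B)" "B' = C * (A * B')"
        using C carrier[OF A] carrier[OF B(1)] carrier[OF B(2)]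
        by (simp_all flip: assoc_mult_mat[of _ k k _ k _ k])
      then show "B = B'"
        using eq by simp
    qed
    moreover have "(\<lambda>B. A * B) ` carrier ?U \<subseteq> carrier ?U"
      using unipotent_mult_closed[OF A] by auto
    ultimately have "(\<lambda>B. A * B) ` carrier ?U = carrier ?U"
      using finite_unipotent_group endo_inj_surj by blast
    moreover have "1\<^sub>m k \<in> carrier ?U"
      by (simp add: unipotent_group_carrier_iff)
    ultimately show ?thesis
      by (metis imageE)
  qed
  show ?thesis
  proof (rule groupI)
    show "\<one>\<^bsub>?U\<^esub> \<in> carrier ?U"
      by (simp add: unipotent_group_carrier_iff)
  next
    fix x y assume "x \<in> carrier ?U" "y \<in> carrier ?U"
    then show "x \<otimes>\<^bsub>?U\<^esub> y \<in> carrier ?U"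
      by (simp add: unipotent_mult_closed)
  next
    fix x y z assume "x \<in> carrier ?U" "y \<in> carrier ?U" "z \<in> carrier ?U"
    then show "x \<otimes>\<^bsub>?U\<^esub> y \<otimes>\<^bsub>?U\<^esub> z = x \<otimes>\<^bsub>?U\<^esub> (y \<otimes>\<^bsub>?U\<^esub> z)"
      using assoc_mult_mat[of x k k y k z k] carrier by simp
  next
    fix x assume "x \<in> carrier ?U"
    then show "\<one>\<^bsub>?U\<^esub> \<otimes>\<^bsub>?U\<^esub> x = x"
      using left_mult_one_mat[OF carrier] by simp
  next
    fix A assume A: "A \<in> carrier ?U"
    then obtain B where B: "B \<in> carrier ?U" "A * B = 1\<^sub>m k"
      using inverse by blast
    have "B * A = 1\<^sub>m k"
      by (rule mat_mult_left_right_inverse[OF carrier[OF A] carrier[OF B(1)] B(2)])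
    then show "\<exists>B\<in>carrier ?U. B \<otimes>\<^bsub>?U\<^esub> A = \<one>\<^bsub>?U\<^esub>"
      using B(1) by auto
  qed
qed

abbreviation unipotent_reps ::
  "('a, 'm) monoid_scheme \<Rightarrow> 'a topology \<Rightarrow> nat \<Rightarrow> ('a \<Rightarrow> 'p::prime_card mod_ring mat) set"
  where "unipotent_reps G T k \<equiv>
    continuous_hom G T (unipotent_group k) (discrete_topology (carrier (unipotent_group k)))"

context topological_group
begin

lemma unipotent_repD:
  assumes "\<rho> \<in> unipotent_reps G T k"
  shows "x \<in> carrier G \<Longrightarrow> \<rho> x \<in> carrier (unipotent_group k)"
    and "x \<in> carrier G \<Longrightarrow> y \<in> carrier G \<Longrightarrow> \<rho> (x \<otimes> y) = \<rho> x * \<rho> y"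
    and "\<rho> \<one> = 1\<^sub>m k"
proof -
  interpret \<rho>: group_hom G "unipotent_group k" \<rho>
    using assms is_group group_unipotent_group
    by (auto simp: continuous_hom_def group_hom_def group_hom_axioms_def)
  show "x \<in> carrier G \<Longrightarrow> \<rho> x \<in> carrier (unipotent_group k)"
    "x \<in> carrier G \<Longrightarrow> y \<in> carrier G \<Longrightarrow> \<rho> (x \<otimes> y) = \<rho> x * \<rho> y" "\<rho> \<one> = 1\<^sub>m k"
    using \<rho>.hom_mult \<rho>.hom_one by auto
qed

lemma cont_unipotent_rep:
  assumes "\<rho> \<in> unipotent_reps G T k"
  shows "cont \<rho>"
proof -
  have "continuous_map T (discrete_topology (carrier (unipotent_group k))) \<rho>"
    using assms by (simp add: continuous_hom_def)
  then have "continuous_map T (discrete_topology UNIV) (id \<circ> \<rho>)"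
    by (rule continuous_map_compose) simp
  then show ?thesis
    by simp
qed

lemma cont_unipotent_entry: "\<rho> \<in> unipotent_reps G T k \<Longrightarrow> cont (\<lambda>x. \<rho> x $$ ij)"
  using continuous_map_discrete_compose1[OF cont_unipotent_rep] .

lemma unipotent_repI:
  assumes carrier: "\<And>x. x \<in> carrier G \<Longrightarrow> \<rho> x \<in> carrier (unipotent_group k)"
    and mult: "\<And>x y i j. x \<in> carrier G \<Longrightarrow> y \<in> carrier G \<Longrightarrow> i \<le> j \<Longrightarrow> j < k \<Longrightarrow>
      \<rho> (x \<otimes> y) $$ (i, j) = (\<Sum>r\<in>{i..j}. \<rho> x $$ (i, r) * \<rho> y $$ (r, j))"
    and cont: "\<And>i j. i \<le> j \<Longrightarrow> j < k \<Longrightarrow> cont (\<lambda>x. \<rho> x $$ (i, j))"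
  shows "\<rho> \<in> unipotent_reps G T k"
proof -
  have eqI: "A = B" if "A \<in> carrier (unipotent_group k)" "B \<in> carrier (unipotent_group k)"
    "\<And>i j. i \<le> j \<Longrightarrow> j < k \<Longrightarrow> A $$ (i, j) = B $$ (i, j)" for A B :: "'c mod_ring mat"
  proof (rule eq_matI)
    fix i j assume "i < dim_row B" "j < dim_col B"
    then show "A $$ (i, j) = B $$ (i, j)"
      using that by (cases "i \<le> j") (auto simp: unipotent_group_carrier_iff)
  qed (use that in \<open>auto simp: unipotent_group_carrier_iff\<close>)
  have "\<rho> \<in> hom G (unipotent_group k)"
  proof (rule homI)
    fix x y assume xy: "x \<in> carrier G" "y \<in> carrier G"
    then show "\<rho> (x \<otimes> y) = \<rho> x \<otimes>\<^bsub>unipotent_group k\<^esub> \<rho> y"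
      using mult[OF xy] unipotent_mult_entry_le[OF carrier[OF xy(1)] carrier[OF xy(2)]]
      by (intro eqI) (auto intro: carrier unipotent_mult_closed)
  qed (rule carrier)
  moreover have open_fibre: "openin T {x \<in> carrier G. \<rho> x = A}" if A: "A \<in> carrier (unipotent_group k)" for A
  proof -
    define I where "I = {(i, j). i \<le> j \<and> j < k}"
    have "finite I"
      by (rule finite_subset[of _ "{..<k} \<times> {..<k}"]) (auto simp: I_def)
    have "{x \<in> carrier G. \<rho> x = A} = carrier G \<inter> (\<Inter>ij\<in>I. {x \<in> carrier G. \<rho> x $$ ij = A $$ ij})"
      using eqI[OF carrier A] by (auto simp: I_def)
    also have "openin T \<dots>"
      using cont by (intro openin_Int_Inter finite_imageI \<open>finite I\<close>)
        (auto simp: I_def continuous_map_discrete_UNIV)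
    finally show ?thesis .
  qed
  then have "openin T {x \<in> carrier G. \<rho> x \<in> W}" if "W \<subseteq> carrier (unipotent_group k)" for W
  proof -
    have "{x \<in> carrier G. \<rho> x \<in> W} = (\<Union>A\<in>W. {x \<in> carrier G. \<rho> x = A})"
      by blast
    also have "openin T \<dots>"
      using open_fibre that by (intro openin_Union) auto
    finally show ?thesis .
  qed
  ultimately show ?thesis
    using carrier by (auto simp: continuous_hom_def continuous_map_def)
qed

text \<open>A left difference of the entry \<open>(i, j)\<close> is a combination of entries
  \<open>(r, j)\<close> with \<open>r > i\<close>, which are closer to the diagonal.\<close>

lemma dd_unipotent_entry:
  assumes "\<rho> \<in> unipotent_reps G T k" "i \<le> j" "j < k"
  shows "dd (Suc (j - i)) (\<lambda>x. \<rho> x $$ (i, j))"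
  using assms(2,3)
proof (induction "j - i" arbitrary: i rule: less_induct)
  case less
  note \<rho> = unipotent_repD[OF assms(1)]
  have "dd (j - i) (left_diff G y (\<lambda>x. \<rho> x $$ (i, j)))" if y: "y \<in> carrier G" for y
  proof -
    have "dd (j - i) (\<lambda>x. \<rho> y $$ (i, r) * \<rho> x $$ (r, j))" if "r \<in> {i<..j}" for r
    proof (rule dd_additive_map[of "\<lambda>a. \<rho> y $$ (i, r) * a"])
      have "dd (Suc (j - r)) (\<lambda>x. \<rho> x $$ (r, j))"
        using that less by (intro less.hyps) auto
      then show "dd (j - i) (\<lambda>x. \<rho> x $$ (r, j))"
        by (rule dd_mono) (use that in auto)
    qed (simp add: right_diff_distrib)
    then have "dd (j - i) (\<lambda>x. \<Sum>r\<in>{i<..j}. \<rho> y $$ (i, r) * \<rho> x $$ (r, j))"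
      by (rule dd_sum)
    moreover have "left_diff G y (\<lambda>x. \<rho> x $$ (i, j)) x = (\<Sum>r\<in>{i<..j}. \<rho> y $$ (i, r) * \<rho> x $$ (r, j))"
      if "x \<in> carrier G" for x
    proof -
      have "\<rho> (y \<otimes> x) $$ (i, j) = (\<Sum>r\<in>{i..j}. \<rho> y $$ (i, r) * \<rho> x $$ (r, j))"
        unfolding \<rho>(2)[OF y that] by (rule unipotent_mult_entry_le[OF \<rho>(1)[OF y] \<rho>(1)[OF that] less.prems])
      also have "{i..j} = insert i {i<..j}"
        using less.prems by auto
      also have "\<rho> y $$ (i, i) = 1"
        using \<rho>(1)[OF y] less.prems by (simp add: unipotent_group_carrier_iff)
      ultimately show ?thesis
        by (simp add: left_diff_def)
    qed
    ultimately show ?thesis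
      by (subst dd_cong) auto
  qed
  then show ?case
    by (simp add: dd_Suc)
qed

end

text \<open>All entries of a matrix of size \<open>k\<close> have degree less than \<open>k\<close>,
  so they are invariant under \<open>Z k\<close>; evaluate at 1.\<close>

lemma (in profinite_group) zassenhaus_subset_kernel:
  fixes \<rho> :: "'a \<Rightarrow> 'p::prime_card mod_ring mat"
  assumes "\<rho> \<in> unipotent_reps G T k" "g \<in> Z CARD('p) k"
  shows "\<rho> g = 1\<^sub>m k"
proof -
  note \<rho> = unipotent_repD[OF assms(1)]
  have g: "g \<in> carrier G"
    using assms(2) zassenhaus_subset by blast
  have "\<rho> g $$ (i, j) = \<rho> \<one> $$ (i, j)" if "i \<le> j" "j < k" for i j
  proof -
    have "dd k (\<lambda>x. \<rho> x $$ (i, j))"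
      by (rule dd_mono[OF dd_unipotent_entry[OF assms(1) that]]) (use that in simp)
    from zassenhaus_left_invariant[OF assms(2) cont_unipotent_entry[OF assms(1)] this one_closed]
    show ?thesis
      using g by simp
  qed
  moreover have "\<rho> g $$ (i, j) = 0" if "j < i" "i < k" for i j
    using \<rho>(1)[OF g] that by (simp add: unipotent_group_carrier_iff)
  ultimately show ?thesis
    using \<rho>(1)[OF g] \<rho>(3)
    by (intro eq_matI) (auto simp: unipotent_group_carrier_iff, metis leI index_one_mat(1) less_le_trans nat_neq_iff)
qed

section \<open>Free profinite groups\<close>

lemma profinite_group_finite_discrete:
  assumes "group H" "finite (carrier H)"
  shows "profinite_group H (discrete_topology (carrier H))"
proof -
  interpret group H by fact
  show ?thesis
    using assms(2)
    by unfold_locales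
      (auto simp: compact_space_discrete_topology connectedin_discrete_topology
        simp flip: prod_topology_discrete_topology)
qed

text \<open>The universal property speaks only of groups carried by subsets of
  \<open>('s + nat) set\<close>. A finite \<open>H\<close> of any type is copied there through
  singletons \<open>{Inr i}\<close> of its numbered elements.\<close>

lemma free_profinite_extend:
  fixes S :: "('s, 'k) monoid_scheme" and H :: "('h, 'l) monoid_scheme"
  assumes free: "free_profinite_on B S TS"
    and H: "group H" "finite (carrier H)"
    and \<alpha>: "\<And>x. x \<in> B \<Longrightarrow> \<alpha> x \<in> carrier H" "finite {x \<in> B. \<alpha> x \<noteq> \<one>\<^bsub>H\<^esub>}"
  shows "\<exists>f \<in> continuous_hom S TS H (discrete_topology (carrier H)). \<forall>x\<in>B. f x = \<alpha> x"
proof -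
  interpret H: group H by fact
  obtain idx :: "'h \<Rightarrow> nat" where idx: "inj_on idx (carrier H)"
    using finite_imp_inj_to_nat_seg[OF H(2)] by blast
  define \<iota> :: "'h \<Rightarrow> ('s + nat) set" where "\<iota> = (\<lambda>h. {Inr (idx h)})"
  have \<iota>: "inj_on \<iota> (carrier H)"
    using idx by (auto simp: \<iota>_def inj_on_def)
  let ?H' = "image_group \<iota> H"
  have carrier': "carrier ?H' = \<iota> ` carrier H"
    by (simp add: image_group_def)
  have "group ?H'"
    by (rule H.inj_imp_image_group_is_group[OF \<iota>])
  then have "profinite_group ?H' (discrete_topology (carrier ?H'))"
    using H(2) carrier' by (intro profinite_group_finite_discrete) auto
  moreover have "(\<iota> \<circ> \<alpha>) ` B \<subseteq> carrier ?H'"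
    using \<alpha>(1) carrier' by auto
  moreover have "converges_to_one B (\<iota> \<circ> \<alpha>) ?H' (discrete_topology (carrier ?H'))"
    unfolding converges_to_one_def
  proof (intro allI impI)
    fix V assume "subgroup V ?H' \<and> openin (discrete_topology (carrier ?H')) V"
    then have "\<iota> \<one>\<^bsub>H\<^esub> \<in> V"
      using subgroup.one_closed[of V ?H'] by (simp add: image_group_def)
    then have "{x \<in> B. (\<iota> \<circ> \<alpha>) x \<notin> V} \<subseteq> {x \<in> B. \<alpha> x \<noteq> \<one>\<^bsub>H\<^esub>}"
      by auto
    then show "finite {x \<in> B. (\<iota> \<circ> \<alpha>) x \<notin> V}"
      using \<alpha>(2) finite_subset by blast
  qed
  ultimately obtain f where f: "f \<in> continuous_hom S TS ?H' (discrete_topology (carrier ?H'))"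
    "\<forall>x\<in>B. f x = (\<iota> \<circ> \<alpha>) x"
    using free unfolding free_profinite_on_def by (metis (no_types, lifting))
  define \<kappa> where "\<kappa> = inv_into (carrier H) \<iota>"
  have "\<kappa> \<in> iso ?H' H"
    unfolding \<kappa>_def by (rule H.iso_set_sym[OF inj_imp_image_group_iso[OF \<iota>]])
  then have \<kappa>: "\<kappa> \<in> hom ?H' H"
    by (simp add: iso_def)
  have "\<kappa> \<circ> f \<in> hom S H"
    using f(1) \<kappa> by (auto simp: continuous_hom_def intro: hom_compose)
  moreover have "continuous_map TS (discrete_topology (carrier H)) (\<kappa> \<circ> f)"
  proof (rule continuous_map_compose)
    show "continuous_map TS (discrete_topology (carrier ?H')) f"
      using f(1) by (simp add: continuous_hom_def)
    show "continuous_map (discrete_topology (carrier ?H')) (discrete_topology (carrier H)) \<kappa>"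
      using \<kappa> by (auto simp: hom_def)
  qed
  moreover have "(\<kappa> \<circ> f) x = \<alpha> x" if "x \<in> B" for x
    using f(2) that \<alpha>(1)[OF that] \<iota> by (simp add: \<kappa>_def)
  ultimately show ?thesis
    by (intro bexI[of _ "\<kappa> \<circ> f"]) (auto simp: continuous_hom_def)
qed

context topological_group
begin

lemma generated_hom_eq:
  assumes "csg B = carrier G" "group H" "f \<in> hom G H" "f' \<in> hom G H" "cont f" "cont f'"
    and B: "B \<subseteq> carrier G" "\<And>x. x \<in> B \<Longrightarrow> f x = f' x" and x: "x \<in> carrier G"
  shows "f x = f' x"
proof -
  interpret f: group_hom G H f
    using assms is_group by (simp add: group_hom_def group_hom_axioms_def)
  interpret f': group_hom G H f'
    using assms is_group by (simp add: group_hom_def group_hom_axioms_def)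
  let ?E = "{x \<in> carrier G. f x = f' x}"
  have "subgroup ?E G"
    by (rule subgroupI) (auto intro: exI[of _ \<one>])
  moreover have "openin T ?E"
  proof -
    have "cont (\<lambda>x. f x = f' x)"
      by (rule continuous_map_discrete_compose2) fact+
    then have "openin T {x \<in> topspace T. (f x = f' x) = True}"
      unfolding continuous_map_discrete_UNIV by blast
    then show ?thesis
      by simp
  qed
  ultimately have "csg B \<subseteq> ?E"
    using B by (intro csg_minimal open_subgroup_closed) auto
  then show ?thesis
    using assms(1) x by auto
qed

lemma generated_invariant:
  assumes "csg B = carrier G" "B \<subseteq> carrier G" "cont h"
    and B: "\<And>y s. y \<in> B \<Longrightarrow> s \<in> carrier G \<Longrightarrow> h (y \<otimes> s) = h s" and s: "s \<in> carrier G"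
  shows "h s = h \<one>"
proof -
  let ?E = "{y \<in> carrier G. \<forall>s\<in>carrier G. h (y \<otimes> s) = h s}"
  have "subgroup ?E G"
  proof (rule subgroupI)
    show "?E \<noteq> {}"
      by (auto intro!: exI[of _ \<one>])
  next
    fix a assume a: "a \<in> ?E"
    have "h (inv a \<otimes> s) = h s" if "s \<in> carrier G" for s
    proof -
      have "h (a \<otimes> (inv a \<otimes> s)) = h (inv a \<otimes> s)"
        using a that by blast
      then show ?thesis
        using a that by simp
    qed
    then show "inv a \<in> ?E"
      using a by simp
  next
    fix a b assume "a \<in> ?E" "b \<in> ?E"
    then show "a \<otimes> b \<in> ?E"
      by (simp add: m_assoc)
  qed auto
  moreover have "closedin T ?E"
  proof (rule closedin_Collect_ball)
    fix s assume "s \<in> carrier G"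
    then show "closedin T {y \<in> carrier G. h (y \<otimes> s) = h s}"
      using closedin_discrete_preimage[OF cont_right_translate[OF assms(3)], of s "{h s}"] by simp
  qed
  moreover have "B \<subseteq> ?E"
    using B assms(2) by auto
  ultimately have "csg B \<subseteq> ?E"
    by (rule csg_minimal)
  then have "s \<in> ?E"
    using assms(1) s by auto
  then have "h (s \<otimes> \<one>) = h \<one>"
    by blast
  then show ?thesis
    using s by simp
qed

end

text \<open>Adds a row on top and a column on the left. With \<open>u = 0\<close> this pads a
  representation to the next size; with other \<open>u\<close> it prescribes the images of basis
  elements of a free group.\<close>

definition bordered_mat :: "nat \<Rightarrow> (nat \<Rightarrow> 'b::comm_ring_1) \<Rightarrow> 'b mat \<Rightarrow> 'b mat"
  where "bordered_mat k u A = mat (Suc k) (Suc k) (\<lambda>(i, j).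
    if i = 0 then (if j = 0 then 1 else u (j - 1)) else if j = 0 then 0 else A $$ (i - 1, j - 1))"

lemma bordered_mat_index [simp]:
  "bordered_mat k u A $$ (0, 0) = 1"
  "j < k \<Longrightarrow> bordered_mat k u A $$ (0, Suc j) = u j"
  "i < k \<Longrightarrow> bordered_mat k u A $$ (Suc i, 0) = 0"
  "i < k \<Longrightarrow> j < k \<Longrightarrow> bordered_mat k u A $$ (Suc i, Suc j) = A $$ (i, j)"
  by (simp_all add: bordered_mat_def)

lemma bordered_mat_unipotent:
  assumes "A \<in> carrier (unipotent_group k)"
  shows "bordered_mat k u A \<in> carrier (unipotent_group (Suc k))"
proof -
  have "bordered_mat k u A $$ (i, j) = 0" if "i < Suc k" "j < i" for i j
    using that assms by (cases i; cases j) (auto simp: unipotent_group_carrier_iff)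
  moreover have "bordered_mat k u A $$ (i, i) = 1" if "i < Suc k" for i
    using that assms by (cases i) (auto simp: unipotent_group_carrier_iff)
  ultimately show ?thesis
    unfolding unipotent_group_carrier_iff[of _ "Suc k"] by (simp add: bordered_mat_def)
qed

lemma (in topological_group) bordered_rep:
  assumes "\<rho> \<in> unipotent_reps G T k"
  shows "(\<lambda>x. bordered_mat k (\<lambda>_. 0) (\<rho> x)) \<in> unipotent_reps G T (Suc k)"
proof (rule unipotent_repI)
  note \<rho> = unipotent_repD[OF assms]
  show "bordered_mat k (\<lambda>_. 0) (\<rho> x) \<in> carrier (unipotent_group (Suc k))" if "x \<in> carrier G" for x
    using \<rho>(1)[OF that] by (rule bordered_mat_unipotent)
  show "bordered_mat k (\<lambda>_. 0) (\<rho> (x \<otimes> y)) $$ (i, j) =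
      (\<Sum>r\<in>{i..j}. bordered_mat k (\<lambda>_. 0) (\<rho> x) $$ (i, r) * bordered_mat k (\<lambda>_. 0) (\<rho> y) $$ (r, j))"
    if xy: "x \<in> carrier G" "y \<in> carrier G" "i \<le> j" "j < Suc k" for x y i j
  proof (cases i)
    case 0
    show ?thesis
    proof (cases j)
      case (Suc j')
      have "(\<Sum>r\<in>{0..j}. bordered_mat k (\<lambda>_. 0) (\<rho> x) $$ (0, r) * bordered_mat k (\<lambda>_. 0) (\<rho> y) $$ (r, j)) = 0"
      proof (rule sum.neutral, rule ballI)
        fix r assume "r \<in> {0..j}"
        then show "bordered_mat k (\<lambda>_. 0) (\<rho> x) $$ (0, r) * bordered_mat k (\<lambda>_. 0) (\<rho> y) $$ (r, j) = 0"
          using xy Suc by (cases r) auto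
      qed
      then show ?thesis
        using xy 0 Suc by simp
    qed (use 0 in simp)
  next
    case (Suc i')
    then obtain j' where j: "j = Suc j'"
      using xy by (cases j) auto
    have "bordered_mat k (\<lambda>_. 0) (\<rho> (x \<otimes> y)) $$ (i, j) = (\<rho> x * \<rho> y) $$ (i', j')"
      using xy Suc j \<rho>(2) by simp
    also have "\<dots> = (\<Sum>r\<in>{i'..j'}. \<rho> x $$ (i', r) * \<rho> y $$ (r, j'))"
      using xy Suc j \<rho>(1) by (intro unipotent_mult_entry_le) auto
    also have "\<dots> = (\<Sum>r\<in>{i'..j'}. bordered_mat k (\<lambda>_. 0) (\<rho> x) $$ (i, Suc r) *
        bordered_mat k (\<lambda>_. 0) (\<rho> y) $$ (Suc r, j))"
      using xy Suc j by (intro sum.cong) auto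
    also have "\<dots> = (\<Sum>r\<in>{i..j}. bordered_mat k (\<lambda>_. 0) (\<rho> x) $$ (i, r) * bordered_mat k (\<lambda>_. 0) (\<rho> y) $$ (r, j))"
      unfolding Suc j by (rule sum.shift_bounds_cl_Suc_ivl[symmetric])
    finally show ?thesis .
  qed
  show "cont (\<lambda>x. bordered_mat k (\<lambda>_. 0) (\<rho> x) $$ (i, j))" if "i \<le> j" "j < Suc k" for i j
    using that cont_unipotent_entry[OF assms] by (cases i; cases j) auto
qed

section \<open>Integration along a free basis\<close>

locale free_profinite = profinite_group G T for G :: "('a, 'm) monoid_scheme" (structure) and T +
  fixes B :: "'a set"
  assumes free: "free_profinite_on B G T"
begin

lemma basis_subset: "B \<subseteq> carrier G" and basis_generates: "csg B = carrier G"
  and basis_converges: "converges_to_one B (\<lambda>x. x) G T"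
  using free by (auto simp: free_profinite_on_def)

text \<open>An antiderivative: row 0 of \<open>\<rho>'\<close> has difference along \<open>x\<close>
  equal to row 0 of \<open>\<rho>\<close>, and difference 0 along the other basis elements. By
  freeness the images of basis elements may be chosen: \<open>\<rho>\<close> in the lower right
  block and, for \<open>x\<close> alone, a 1 right after the top left corner.\<close>

lemma unipotent_rep_lift:
  fixes \<rho> :: "'a \<Rightarrow> 'p::prime_card mod_ring mat"
  assumes \<rho>: "\<rho> \<in> unipotent_reps G T k" and x: "x \<in> B"
  shows "\<exists>\<rho>' \<in> unipotent_reps G T (Suc k). \<forall>y\<in>B. \<forall>s\<in>carrier G. \<forall>j<k.
    left_diff G y (\<lambda>s. \<rho>' s $$ (0, Suc j)) s = (if y = x then \<rho> s $$ (0, j) else 0)"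
proof -
  let ?U = "unipotent_group (Suc k) :: 'p mod_ring mat monoid"
  note \<rho>D = unipotent_repD[OF \<rho>]
  define \<alpha> where "\<alpha> y = bordered_mat k (\<lambda>j. if y = x \<and> j = 0 then 1 else 0) (\<rho> y)" for y
  have \<alpha>: "\<alpha> y \<in> carrier ?U" if "y \<in> B" for y
    unfolding \<alpha>_def using that basis_subset \<rho>D(1) by (intro bordered_mat_unipotent) auto
  \<comment> \<open>The kernel of \<open>\<rho>\<close> is open, so it contains almost all of the
    basis. Hence \<open>\<alpha>\<close> is trivial off a finite set, as the universal property
    requires.\<close>
  have "finite {y \<in> B. \<rho> y \<noteq> 1\<^sub>m k}"
  proof -
    let ?V = "kernel G (unipotent_group k) \<rho>"
    interpret \<rho>: group_hom G "unipotent_group k" \<rho>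
      using \<rho> is_group group_unipotent_group
      by (auto simp: continuous_hom_def group_hom_def group_hom_axioms_def)
    have "openin T ?V"
      using cont_unipotent_rep[OF \<rho>] by (simp add: continuous_map_discrete_UNIV kernel_def)
    then have "finite {y \<in> B. y \<notin> ?V}"
      using basis_converges \<rho>.subgroup_kernel by (auto simp: converges_to_one_def)
    moreover have "{y \<in> B. y \<notin> ?V} = {y \<in> B. \<rho> y \<noteq> 1\<^sub>m k}"
      using basis_subset by (auto simp: kernel_def)
    ultimately show ?thesis
      by simp
  qed
  moreover have "{y \<in> B. \<alpha> y \<noteq> \<one>\<^bsub>?U\<^esub>} \<subseteq> insert x {y \<in> B. \<rho> y \<noteq> 1\<^sub>m k}"
  proof (clarsimp simp: \<alpha>_def)
    fix y assume y: "y \<noteq> x" "\<rho> y = 1\<^sub>m k"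
      and neq: "bordered_mat k (\<lambda>j. 0) (1\<^sub>m k :: 'p mod_ring mat) \<noteq> 1\<^sub>m (Suc k)"
    have "bordered_mat k (\<lambda>j. 0) (1\<^sub>m k :: 'p mod_ring mat) = 1\<^sub>m (Suc k)"
    proof (rule eq_matI)
      fix i j assume "i < dim_row (1\<^sub>m (Suc k) :: 'p mod_ring mat)" "j < dim_col (1\<^sub>m (Suc k) :: 'p mod_ring mat)"
      then show "bordered_mat k (\<lambda>j. 0) (1\<^sub>m k :: 'p mod_ring mat) $$ (i, j) = 1\<^sub>m (Suc k) $$ (i, j)"
        by (cases i; cases j) auto
    qed (simp_all add: bordered_mat_def)
    then show False
      using neq by simp
  qed
  ultimately have "finite {y \<in> B. \<alpha> y \<noteq> \<one>\<^bsub>?U\<^esub>}"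
    using finite_subset by blast
  then obtain \<rho>' where \<rho>': "\<rho>' \<in> unipotent_reps G T (Suc k)" "\<And>y. y \<in> B \<Longrightarrow> \<rho>' y = \<alpha> y"
    using free_profinite_extend[of B G T ?U \<alpha>, OF free group_unipotent_group finite_unipotent_group \<alpha>]
    by blast
  note \<rho>'D = unipotent_repD[OF \<rho>'(1)]
  \<comment> \<open>The lower right block of \<open>\<rho>'\<close> is a representation of its own;
    it agrees with \<open>\<rho>\<close> on the basis, hence everywhere.\<close>
  define \<sigma> where "\<sigma> s = mat k k (\<lambda>(i, j). \<rho>' s $$ (Suc i, Suc j))" for s
  have \<sigma>: "\<sigma> \<in> unipotent_reps G T k"
  proof (rule unipotent_repI)
    show "\<sigma> s \<in> carrier (unipotent_group k)" if "s \<in> carrier G" for s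
      using \<rho>'D(1)[OF that] by (auto simp: unipotent_group_carrier_iff \<sigma>_def)
    show "\<sigma> (s \<otimes> t) $$ (i, j) = (\<Sum>r\<in>{i..j}. \<sigma> s $$ (i, r) * \<sigma> t $$ (r, j))"
      if "s \<in> carrier G" "t \<in> carrier G" "i \<le> j" "j < k" for s t i j
    proof -
      have "\<sigma> (s \<otimes> t) $$ (i, j) = (\<rho>' s * \<rho>' t) $$ (Suc i, Suc j)"
        using that \<rho>'D(2) by (simp add: \<sigma>_def)
      also have "\<dots> = (\<Sum>r\<in>{Suc i..Suc j}. \<rho>' s $$ (Suc i, r) * \<rho>' t $$ (r, Suc j))"
        using that \<rho>'D(1) by (intro unipotent_mult_entry_le) auto
      also have "\<dots> = (\<Sum>r\<in>{i..j}. \<rho>' s $$ (Suc i, Suc r) * \<rho>' t $$ (Suc r, Suc j))"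
        by (rule sum.shift_bounds_cl_Suc_ivl)
      also have "\<dots> = (\<Sum>r\<in>{i..j}. \<sigma> s $$ (i, r) * \<sigma> t $$ (r, j))"
        using that by (intro sum.cong) (auto simp: \<sigma>_def)
      finally show ?thesis .
    qed
    show "cont (\<lambda>s. \<sigma> s $$ (i, j))" if "i \<le> j" "j < k" for i j
      using that cont_unipotent_entry[OF \<rho>'(1)] by (simp add: \<sigma>_def)
  qed
  have "\<sigma> y = \<rho> y" if "y \<in> B" for y
  proof (rule eq_matI)
    have "\<rho> y \<in> carrier_mat k k"
      using \<rho>D(1) that basis_subset by (auto simp: unipotent_group_carrier_iff)
    then show "dim_row (\<sigma> y) = dim_row (\<rho> y)" "dim_col (\<sigma> y) = dim_col (\<rho> y)"
      by (simp_all add: \<sigma>_def)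
    fix i j assume "i < dim_row (\<rho> y)" "j < dim_col (\<rho> y)"
    then show "\<sigma> y $$ (i, j) = \<rho> y $$ (i, j)"
      using \<open>\<rho> y \<in> carrier_mat k k\<close> by (simp add: \<sigma>_def \<rho>'(2)[OF that] \<alpha>_def)
  qed
  then have eq: "\<sigma> s = \<rho> s" if "s \<in> carrier G" for s
    using generated_hom_eq[OF basis_generates group_unipotent_group[of k, where 'p = 'p] _ _ cont_unipotent_rep[OF \<sigma>]
        cont_unipotent_rep[OF \<rho>] basis_subset _ that] \<sigma> \<rho>
    by (simp add: continuous_hom_def)
  have "left_diff G y (\<lambda>s. \<rho>' s $$ (0, Suc j)) s = (if y = x then \<rho> s $$ (0, j) else 0)"
    if y: "y \<in> B" and s: "s \<in> carrier G" and j: "j < k" for y s j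
  proof -
    have yG: "y \<in> carrier G"
      using y basis_subset by blast
    have "\<rho>' (y \<otimes> s) $$ (0, Suc j) = (\<Sum>r<Suc k. \<alpha> y $$ (0, r) * \<rho>' s $$ (r, Suc j))"
      using \<rho>'D(1)[OF yG] \<rho>'D(1)[OF s] j unfolding \<rho>'D(2)[OF yG s] \<rho>'(2)[OF y, symmetric]
      by (intro unipotent_mult_entry) auto
    also have "\<dots> = \<rho>' s $$ (0, Suc j) + (\<Sum>r<k. \<alpha> y $$ (0, Suc r) * \<rho>' s $$ (Suc r, Suc j))"
      by (subst sum.lessThan_Suc_shift) (simp add: \<alpha>_def)
    also have "(\<Sum>r<k. \<alpha> y $$ (0, Suc r) * \<rho>' s $$ (Suc r, Suc j)) =
        (\<Sum>r<k. if r = 0 then (if y = x then \<rho> s $$ (0, j) else 0) else 0)"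
    proof (intro sum.cong refl)
      fix r assume "r \<in> {..<k}"
      moreover from this have "\<rho>' s $$ (Suc r, Suc j) = \<rho> s $$ (r, j)"
        using j by (simp add: \<sigma>_def flip: eq[OF s])
      ultimately show "\<alpha> y $$ (0, Suc r) * \<rho>' s $$ (Suc r, Suc j) =
          (if r = 0 then (if y = x then \<rho> s $$ (0, j) else 0) else 0)"
        by (simp add: \<alpha>_def)
    qed
    also have "\<dots> = (if y = x then \<rho> s $$ (0, j) else 0)"
      using j by simp
    finally show ?thesis
      by (simp add: left_diff_def)
  qed
  then show ?thesis
    using \<rho>'(1) by blast
qed

end

text \<open>Two column sets matter: \<open>{..<k}\<close> for integrating functions of degree less
  than \<open>k\<close>, and \<open>{n}\<close> with \<open>k = Suc n\<close> for the upper right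
  corner. Linear combinations are included since the duality argument works with a vector space of
  functions.\<close>

inductive_set rep_span :: "('a, 'm) monoid_scheme \<Rightarrow> 'a topology \<Rightarrow> nat \<Rightarrow> nat set \<Rightarrow>
    ('a \<Rightarrow> 'p::prime_card mod_ring) set"
  for G :: "('a, 'm) monoid_scheme" and T k J
  where
    zero: "(\<lambda>_. 0) \<in> rep_span G T k J"
  | entry: "\<rho> \<in> unipotent_reps G T k \<Longrightarrow> j \<in> J \<Longrightarrow> (\<lambda>x. \<rho> x $$ (0, j)) \<in> rep_span G T k J"
  | add: "f \<in> rep_span G T k J \<Longrightarrow> g \<in> rep_span G T k J \<Longrightarrow> (\<lambda>x. f x + g x) \<in> rep_span G T k J"
  | scale: "f \<in> rep_span G T k J \<Longrightarrow> (\<lambda>x. c * f x) \<in> rep_span G T k J"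

lemma rep_span_sum:
  assumes "\<And>i. i \<in> I \<Longrightarrow> f i \<in> rep_span G T k J"
  shows "(\<lambda>x. \<Sum>i\<in>I. f i x) \<in> rep_span G T k J"
  using assms
proof (induction I rule: infinite_finite_induct)
  case (insert i I)
  then show ?case
    using rep_span.add[of "f i" G T k J "\<lambda>x. \<Sum>i\<in>I. f i x"] by simp
qed (auto intro: rep_span.zero)

lemma (in topological_group) cont_rep_span: "f \<in> rep_span G T k J \<Longrightarrow> cont f"
  by (induction rule: rep_span.induct)
    (auto intro: cont_unipotent_entry continuous_map_discrete_compose1 continuous_map_discrete_compose2)

context free_profinite
begin

lemma rep_span_lift:
  fixes f :: "'a \<Rightarrow> 'p::prime_card mod_ring"
  assumes "f \<in> rep_span G T k {..<k}" and x: "x \<in> B"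
  shows "\<exists>f' \<in> rep_span G T (Suc k) {..<Suc k}. \<forall>y\<in>B. \<forall>s\<in>carrier G.
    left_diff G y f' s = (if y = x then f s else 0)"
  using assms(1)
proof induction
  case zero
  then show ?case
    by (intro bexI[of _ "\<lambda>_. 0"]) (auto simp: left_diff_def intro: rep_span.zero)
next
  case (entry \<rho> j)
  then obtain \<rho>' where \<rho>': "\<rho>' \<in> unipotent_reps G T (Suc k)"
    "\<forall>y\<in>B. \<forall>s\<in>carrier G. \<forall>j<k. left_diff G y (\<lambda>s. \<rho>' s $$ (0, Suc j)) s = (if y = x then \<rho> s $$ (0, j) else 0)"
    using unipotent_rep_lift[OF _ x] by blast
  show ?case
    by (rule bexI[of _ "\<lambda>s. \<rho>' s $$ (0, Suc j)"])
      (use \<rho>' entry in \<open>auto intro!: rep_span.entry\<close>)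
next
  case (add f g)
  then obtain f' g' where f': "f' \<in> rep_span G T (Suc k) {..<Suc k}" "g' \<in> rep_span G T (Suc k) {..<Suc k}"
    "\<forall>y\<in>B. \<forall>s\<in>carrier G. left_diff G y f' s = (if y = x then f s else 0)"
    "\<forall>y\<in>B. \<forall>s\<in>carrier G. left_diff G y g' s = (if y = x then g s else 0)"
    by blast
  have "left_diff G y (\<lambda>s. f' s + g' s) s = left_diff G y f' s + left_diff G y g' s" for y s
    by (simp add: left_diff_def)
  then show ?case
    using f' by (intro bexI[of _ "\<lambda>s. f' s + g' s"]) (auto intro: rep_span.add)
next
  case (scale f c)
  then obtain f' where f': "f' \<in> rep_span G T (Suc k) {..<Suc k}"
    "\<forall>y\<in>B. \<forall>s\<in>carrier G. left_diff G y f' s = (if y = x then f s else 0)"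
    by blast
  have "left_diff G y (\<lambda>s. c * f' s) s = c * left_diff G y f' s" for y s
    by (simp add: left_diff_def right_diff_distrib)
  then show ?case
    using f' by (intro bexI[of _ "\<lambda>s. c * f' s"]) (auto intro: rep_span.scale)
qed

text \<open>Differences along basis elements inside \<open>V\<close> vanish, and only finitely many
  basis elements lie outside. The differences along these have smaller degree and are integrated one
  by one; the sum has the same differences as \<open>f\<close> along the whole basis, so it differs
  from \<open>f\<close> by a constant.\<close>

lemma dd_imp_rep_span:
  fixes f :: "'a \<Rightarrow> 'p::prime_card mod_ring"
  assumes V: "V \<lhd> G" "openin T V"
    and "cont f" "\<And>v x. v \<in> V \<Longrightarrow> x \<in> carrier G \<Longrightarrow> f (v \<otimes> x) = f x" "dd n f"
  shows "\<exists>f' \<in> rep_span G T n {..<n}. \<forall>x\<in>carrier G. f x = f' x"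
  using assms(3-)
proof (induction n arbitrary: f)
  case 0
  then show ?case
    by (intro bexI[of _ "\<lambda>_. 0"]) (auto intro: rep_span.zero)
next
  case (Suc n)
  define X where "X = {x \<in> B. x \<notin> V}"
  interpret V: normal V G by fact
  have "finite X"
    using basis_converges V V.subgroup_axioms by (auto simp: converges_to_one_def X_def)
  have "\<exists>F \<in> rep_span G T (Suc n) {..<Suc n}. \<forall>y\<in>B. \<forall>s\<in>carrier G.
      left_diff G y F s = (if y = x then left_diff G x f s else 0)" if "x \<in> X" for x
  proof -
    have x: "x \<in> B" "x \<in> carrier G"
      using that basis_subset by (auto simp: X_def)
    \<comment> \<open>Normality of \<open>V\<close> keeps the invariance when passing to a
      difference, so the induction hypothesis applies with the same \<open>V\<close>.\<close>
    have "left_diff G x f (v \<otimes> s) = left_diff G x f s" if "v \<in> V" "s \<in> carrier G" for v s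
    proof -
      have "x \<otimes> (v \<otimes> s) = (x \<otimes> v \<otimes> inv x) \<otimes> (x \<otimes> s)"
        using x that by (simp add: m_assoc)
      moreover have "f ((x \<otimes> v \<otimes> inv x) \<otimes> (x \<otimes> s)) = f (x \<otimes> s)"
        using x that normal_conj[OF V(1)] by (intro Suc.prems) auto
      ultimately show ?thesis
        using Suc.prems(2)[OF that] by (simp add: left_diff_def)
    qed
    moreover have "dd n (left_diff G x f)"
      using Suc.prems(3) x by (simp add: dd_Suc)
    ultimately obtain F where F: "F \<in> rep_span G T n {..<n}" "\<forall>s\<in>carrier G. left_diff G x f s = F s"
      using Suc.IH[of "left_diff G x f"] cont_left_diff[OF Suc.prems(1) x(2)] by blast
    from rep_span_lift[OF F(1) x(1)] obtain F' where "F' \<in> rep_span G T (Suc n) {..<Suc n}"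
      "\<forall>y\<in>B. \<forall>s\<in>carrier G. left_diff G y F' s = (if y = x then F s else 0)"
      by blast
    then show ?thesis
      using F(2) by (intro bexI[of _ F']) auto
  qed
  then obtain F where F: "\<And>x. x \<in> X \<Longrightarrow> F x \<in> rep_span G T (Suc n) {..<Suc n}"
    "\<And>x y s. x \<in> X \<Longrightarrow> y \<in> B \<Longrightarrow> s \<in> carrier G \<Longrightarrow>
      left_diff G y (F x) s = (if y = x then left_diff G x f s else 0)"
    by metis
  define f' where "f' = (\<lambda>s. \<Sum>x\<in>X. F x s)"
  have f': "f' \<in> rep_span G T (Suc n) {..<Suc n}"
    unfolding f'_def using F(1) by (rule rep_span_sum)
  have "f (y \<otimes> s) - f' (y \<otimes> s) = f s - f' s" if y: "y \<in> B" and s: "s \<in> carrier G" for y s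
  proof -
    have "left_diff G y f' s = (\<Sum>x\<in>X. left_diff G y (F x) s)"
      by (simp add: f'_def left_diff_def sum_subtractf)
    also have "\<dots> = (\<Sum>x\<in>X. if x = y then left_diff G y f s else 0)"
      using F(2)[OF _ y s] by (intro sum.cong) auto
    also have "\<dots> = (if y \<in> X then left_diff G y f s else 0)"
      using \<open>finite X\<close> by simp
    also have "\<dots> = left_diff G y f s"
      using y s Suc.prems(2)[of y s] by (auto simp: X_def left_diff_def)
    finally show ?thesis
      by (simp add: left_diff_def algebra_simps)
  qed
  moreover have "cont (\<lambda>s. f s - f' s)"
    using Suc.prems(1) cont_rep_span[OF f'] by (rule continuous_map_discrete_compose2)
  ultimately have const: "f s - f' s = f \<one> - f' \<one>" if "s \<in> carrier G" for s
    using generated_invariant[OF basis_generates basis_subset, of "\<lambda>s. f s - f' s"] that by blast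
  \<comment> \<open>The constant of integration is a multiple of the entry \<open>(0, 0)\<close> of
    the trivial representation.\<close>
  have "((\<lambda>_. 1\<^sub>m (Suc n)) :: 'a \<Rightarrow> 'p mod_ring mat) \<in> unipotent_reps G T (Suc n)"
  proof -
    interpret U: group "unipotent_group (Suc n) :: 'p mod_ring mat monoid"
      by (rule group_unipotent_group)
    show ?thesis
      using U.one_closed by (auto simp: continuous_hom_def hom_def)
  qed
  from rep_span.scale[OF rep_span.entry[OF this, of 0 "{..<Suc n}"], of "f \<one> - f' \<one>"]
  have "(\<lambda>_. f \<one> - f' \<one>) \<in> rep_span G T (Suc n) {..<Suc n}"
    by simp
  note span = rep_span.add[OF f' this]
  have "f x = f' x + (f \<one> - f' \<one>)" if "x \<in> carrier G" for x
    unfolding const[OF that, symmetric] by simp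
  then show ?case
    by (intro bexI[OF _ span] ballI)
qed

text \<open>Otherwise a function of degree less than \<open>n\<close> separates \<open>s\<close>
  from 1. Being invariant under an open subgroup it is continuous, hence a combination of matrix
  entries, none of which separates the two.\<close>

lemma unipotent_kernel_subset_zassenhaus:
  assumes n: "n \<ge> 1" and s: "s \<in> carrier G"
    and ker: "\<And>\<rho> :: 'a \<Rightarrow> 'p::prime_card mod_ring mat. \<rho> \<in> unipotent_reps G T n \<Longrightarrow> \<rho> s = 1\<^sub>m n"
  shows "s \<in> Z CARD('p) n"
proof (rule ccontr)
  assume "s \<notin> Z CARD('p) n"
  then obtain V and f :: "'a \<Rightarrow> 'p mod_ring" where V: "V \<lhd> G" "openin T V"
    and f: "\<And>v x. v \<in> V \<Longrightarrow> x \<in> carrier G \<Longrightarrow> f (v \<otimes> x) = f x" "dd n f" "f s \<noteq> f \<one>"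
    using zassenhaus_separation[OF s _ n] by blast
  interpret V: normal V G by fact
  have "openin T {x \<in> carrier G. f x = a}" for a
    using f(1) by (intro openin_coset_union[OF V.subgroup_axioms V(2)]) auto
  then have "cont f"
    by (simp add: continuous_map_discrete_UNIV)
  then obtain f' where f': "f' \<in> rep_span G T n {..<n}" "\<forall>x\<in>carrier G. f x = f' x"
    using dd_imp_rep_span[OF V _ f(1,2)] by blast
  have "f' s = f' \<one>"
    using f'(1)
  proof induction
    case (entry \<rho> j)
    then show ?case
      using ker[of \<rho>] unipotent_repD(3)[of \<rho>] by simp
  qed auto
  then show False
    using f(3) f'(2) s by simp
qed

end

section \<open>Quotients and cohomology\<close>

context topological_group
begin

lemma quotient_map_coset: "quotient_map T (quotient_topology G T N) (\<lambda>x. N #> x)"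
  unfolding quotient_topology_def by (rule quotient_map_image_topology)

lemma topspace_quotient_topology: "topspace (quotient_topology G T N) = carrier (G Mod N)"
  using quotient_imp_surjective_map[OF quotient_map_coset[of N]] by (simp add: carrier_FactGroup)

lemma coset_eq_iff:
  assumes "subgroup N G" "x \<in> carrier G" "y \<in> carrier G"
  shows "N #> x = N #> y \<longleftrightarrow> (\<exists>n\<in>N. x = n \<otimes> y)"
proof
  assume "N #> x = N #> y"
  then have "x \<in> N #> y"
    using rcos_self[OF assms(2,1)] by simp
  then show "\<exists>n\<in>N. x = n \<otimes> y"
    by (auto simp: r_coset_def)
next
  assume "\<exists>n\<in>N. x = n \<otimes> y"
  then have "x \<in> N #> y"
    by (auto simp: r_coset_def)
  then show "N #> x = N #> y"
    using repr_independence assms by metis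
qed

lemma openin_coset_image:
  assumes "subgroup N G" "openin T U"
  shows "openin (quotient_topology G T N) ((\<lambda>x. N #> x) ` U)"
proof -
  have U: "U \<subseteq> carrier G"
    using openin_subset[OF assms(2)] by simp
  have N: "N \<subseteq> carrier G"
    by (rule subgroup.subset[OF assms(1)])
  have "{x \<in> topspace T. N #> x \<in> (\<lambda>x. N #> x) ` U} = (\<Union>n\<in>N. {x \<in> carrier G. inv n \<otimes> x \<in> U})"
  proof (intro equalityI subsetI)
    fix x assume "x \<in> {x \<in> topspace T. N #> x \<in> (\<lambda>x. N #> x) ` U}"
    then obtain u where u: "x \<in> carrier G" "u \<in> U" "N #> x = N #> u"
      by auto
    moreover have "u \<in> carrier G"
      using u U by blast
    ultimately obtain n where n: "n \<in> N" "x = n \<otimes> u"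
      using coset_eq_iff[OF assms(1)] by blast
    then have "inv n \<otimes> x = u"
      using N \<open>u \<in> carrier G\<close> by auto
    then show "x \<in> (\<Union>n\<in>N. {x \<in> carrier G. inv n \<otimes> x \<in> U})"
      using n u by blast
  next
    fix x assume "x \<in> (\<Union>n\<in>N. {x \<in> carrier G. inv n \<otimes> x \<in> U})"
    then obtain n where n: "n \<in> N" "x \<in> carrier G" "inv n \<otimes> x \<in> U"
      by blast
    moreover have "x = n \<otimes> (inv n \<otimes> x)"
      using n N by auto
    ultimately have "N #> x = N #> (inv n \<otimes> x)"
      using coset_eq_iff[OF assms(1), of x "inv n \<otimes> x"] U by blast
    then show "x \<in> {x \<in> topspace T. N #> x \<in> (\<lambda>x. N #> x) ` U}"
      using n by auto
  qed
  moreover have "openin T (\<Union>n\<in>N. {x \<in> carrier G. inv n \<otimes> x \<in> U})"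
  proof (intro openin_Union, clarify)
    fix n assume "n \<in> N"
    then have "n \<in> carrier G"
      using N by blast
    then show "openin T {x \<in> carrier G. inv n \<otimes> x \<in> U}"
      by (intro openin_preimage[OF _ assms(2)]) (simp add: continuous_group_intros)
  qed
  ultimately show ?thesis
    unfolding quotient_topology_def openin_image_topology using U by auto
qed

text \<open>A product of quotient maps need not be a quotient map. Multiplication is therefore
  treated with the openness of the coset map; for inversion the quotient property suffices.\<close>

lemma topological_group_quotient:
  assumes "N \<lhd> G"
  shows "topological_group (G Mod N) (quotient_topology G T N)"
proof -
  interpret N: normal N G by fact
  let ?Q = "quotient_topology G T N"
  let ?q = "\<lambda>x. N #> x"
  note sub = N.subgroup_axioms
  interpret Q: group "G Mod N"
    by (rule N.factorgroup_is_group)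
  show ?thesis
  proof (intro topological_group.intro topological_group_axioms.intro N.factorgroup_is_group)
    show "topspace ?Q = carrier (G Mod N)"
      by (rule topspace_quotient_topology)
    show "continuous_map (prod_topology ?Q ?Q) ?Q (\<lambda>(x, y). x \<otimes>\<^bsub>G Mod N\<^esub> y)"
    proof -
      have "openin (prod_topology ?Q ?Q)
        {z \<in> topspace (prod_topology ?Q ?Q). (case z of (x, y) \<Rightarrow> x \<otimes>\<^bsub>G Mod N\<^esub> y) \<in> W}"
        (is "openin _ ?P") if W: "openin ?Q W" for W
      proof -
      have open_W: "openin T {x \<in> topspace T. ?q x \<in> W}"
        by (rule openin_continuous_map_preimage[OF quotient_imp_continuous_map[OF quotient_map_coset] W])
      let ?O = "{z \<in> topspace (prod_topology T T). (case z of (x, y) \<Rightarrow> x \<otimes> y) \<in> {x \<in> topspace T. ?q x \<in> W}}"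
      have O: "openin (prod_topology T T) ?O"
        by (rule openin_continuous_map_preimage[OF continuous_mult open_W])
      show ?thesis
        unfolding openin_prod_topology_alt
      proof (intro allI impI)
        fix X Y assume XY: "(X, Y) \<in> ?P"
        then obtain x y where xy: "x \<in> carrier G" "X = ?q x" "y \<in> carrier G" "Y = ?q y"
          by (auto simp: topspace_quotient_topology carrier_FactGroup)
        have "(x, y) \<in> ?O"
          using XY xy N.rcos_sum[of x y] by simp
        then obtain U V where UV: "openin T U" "openin T V" "x \<in> U" "y \<in> V" "U \<times> V \<subseteq> ?O"
          using O unfolding openin_prod_topology_alt by meson
        have "?q ` U \<times> ?q ` V \<subseteq> ?P"
        proof
          fix z assume "z \<in> ?q ` U \<times> ?q ` V"
          then obtain u v where "u \<in> U" "v \<in> V" "z = (?q u, ?q v)"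
            by blast
          moreover from this have "(u, v) \<in> ?O"
            using UV by blast
          then have "u \<in> carrier G" "v \<in> carrier G" "?q (u \<otimes> v) \<in> W"
            by auto
          ultimately show "z \<in> ?P"
            using N.rcos_sum[of u v] by (simp add: topspace_quotient_topology carrier_FactGroup)
        qed
        then show "\<exists>U V. openin ?Q U \<and> openin ?Q V \<and> X \<in> U \<and> Y \<in> V \<and> U \<times> V \<subseteq> ?P"
          using openin_coset_image[OF sub UV(1)] openin_coset_image[OF sub UV(2)] UV(3,4) xy(2,4)
          by (intro exI[of _ "?q ` U"] exI[of _ "?q ` V"]) (simp only: imageI simp_thms)
      qed
      qed
      moreover have "(\<lambda>(x, y). x \<otimes>\<^bsub>G Mod N\<^esub> y) \<in> topspace (prod_topology ?Q ?Q) \<rightarrow> topspace ?Q"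
        using Q.m_closed by (auto simp: topspace_quotient_topology)
      ultimately show ?thesis
        unfolding continuous_map_def by blast
    qed
    show "continuous_map ?Q ?Q (\<lambda>x. inv\<^bsub>G Mod N\<^esub> x)"
    proof (rule continuous_compose_quotient_map[OF quotient_map_coset])
      have "continuous_map T ?Q (?q \<circ> (\<lambda>x. inv x))"
        by (rule continuous_map_compose[OF continuous_inv quotient_imp_continuous_map[OF quotient_map_coset]])
      moreover have "(?q \<circ> (\<lambda>x. inv x)) x = ((\<lambda>x. inv\<^bsub>G Mod N\<^esub> x) \<circ> ?q) x" if "x \<in> topspace T" for x
        using that N.inv_FactGroup[of "?q x"] N.rcos_inv[of x] by (simp add: carrier_FactGroup)
      ultimately show "continuous_map T ?Q ((\<lambda>x. inv\<^bsub>G Mod N\<^esub> x) \<circ> ?q)"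
        by (rule continuous_map_eq)
    qed
  qed
qed

section \<open>Continuous cochains and the group structure of the second cohomology\<close>

lemma cochains1_iff: "c \<in> cochains1 G T \<longleftrightarrow> cont c \<and> (\<forall>x. x \<notin> carrier G \<longrightarrow> c x = 0)"
  by (simp add: cochains1_def)

abbreviation cont2 :: "('a \<times> 'a \<Rightarrow> 'c) \<Rightarrow> bool"
  where "cont2 \<equiv> continuous_map (prod_topology T T) (discrete_topology UNIV)"

lemma cont2_fst: "cont c \<Longrightarrow> cont2 (\<lambda>x. c (fst x))"
  using continuous_map_compose[OF continuous_map_fst, of T _ c T] by (simp add: o_def)

lemma cont2_snd: "cont c \<Longrightarrow> cont2 (\<lambda>x. c (snd x))"
  using continuous_map_compose[OF continuous_map_snd, of T _ c T] by (simp add: o_def)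

lemma cont2_mult: "cont c \<Longrightarrow> cont2 (\<lambda>x. c (fst x \<otimes> snd x))"
  using continuous_map_compose[OF continuous_mult, of _ c] by (simp add: o_def case_prod_unfold)

lemma cochains2_coboundary:
  assumes "c \<in> cochains1 G T"
  shows "coboundary G c \<in> cochains2 G T"
proof -
  have "cont2 (\<lambda>x. c (fst x) + c (snd x) - c (fst x \<otimes> snd x))"
    using assms unfolding cochains1_iff
    by (intro continuous_map_discrete_compose2[where h = "(-)"] continuous_map_discrete_compose2[where h = "(+)"]
        cont2_fst cont2_snd cont2_mult) auto
  then have "cont2 (coboundary G c)"
    by (rule continuous_map_eq) (auto simp: coboundary_def)
  then show ?thesis
    by (auto simp: cochains2_def coboundary_def)
qed

lemma coboundary_cocycle:
  assumes "c \<in> cochains1 G T"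
  shows "coboundary G c \<in> cocycles2 G T"
  using cochains2_coboundary[OF assms] by (auto simp: cocycles2_def coboundary_def m_assoc)

lemma cocycles2_add: "f \<in> cocycles2 G T \<Longrightarrow> g \<in> cocycles2 G T \<Longrightarrow> (\<lambda>x. f x + g x) \<in> cocycles2 G T"
proof -
  assume fg: "f \<in> cocycles2 G T" "g \<in> cocycles2 G T"
  then have "cont2 (\<lambda>x. f x + g x)"
    by (auto simp: cocycles2_def cochains2_def intro: continuous_map_discrete_compose2)
  moreover have "f (\<sigma>, \<tau>) + g (\<sigma>, \<tau>) - (f (\<rho> \<otimes> \<sigma>, \<tau>) + g (\<rho> \<otimes> \<sigma>, \<tau>)) +
      (f (\<rho>, \<sigma> \<otimes> \<tau>) + g (\<rho>, \<sigma> \<otimes> \<tau>)) - (f (\<rho>, \<sigma>) + g (\<rho>, \<sigma>)) = 0"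
    if "\<rho> \<in> carrier G" "\<sigma> \<in> carrier G" "\<tau> \<in> carrier G" for \<rho> \<sigma> \<tau>
  proof -
    have "(f (\<sigma>, \<tau>) - f (\<rho> \<otimes> \<sigma>, \<tau>) + f (\<rho>, \<sigma> \<otimes> \<tau>) - f (\<rho>, \<sigma>)) +
        (g (\<sigma>, \<tau>) - g (\<rho> \<otimes> \<sigma>, \<tau>) + g (\<rho>, \<sigma> \<otimes> \<tau>) - g (\<rho>, \<sigma>)) = 0"
      using fg that by (simp add: cocycles2_def)
    then show ?thesis
      by (simp add: algebra_simps)
  qed
  ultimately show ?thesis
    using fg by (simp add: cocycles2_def cochains2_def)
qed

lemma cocycles2_uminus:
  assumes f: "f \<in> cocycles2 G T"
  shows "(\<lambda>x. - f x) \<in> cocycles2 G T"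
proof -
  have "cont2 (\<lambda>x. - f x)"
    using f by (auto simp: cocycles2_def cochains2_def intro: continuous_map_discrete_compose1)
  moreover have "f (\<rho> \<otimes> \<sigma>, \<tau>) - f (\<sigma>, \<tau>) - f (\<rho>, \<sigma> \<otimes> \<tau>) = - f (\<rho>, \<sigma>)"
    if "\<rho> \<in> carrier G" "\<sigma> \<in> carrier G" "\<tau> \<in> carrier G" for \<rho> \<sigma> \<tau>
  proof -
    have "f (\<sigma>, \<tau>) - f (\<rho> \<otimes> \<sigma>, \<tau>) + f (\<rho>, \<sigma> \<otimes> \<tau>) = f (\<rho>, \<sigma>)"
      using f that by (simp add: cocycles2_def)
    then show ?thesis
      by (simp flip: \<open>_ = f (\<rho>, \<sigma>)\<close>)
  qed
  ultimately show ?thesis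
    using f by (simp add: cocycles2_def cochains2_def)
qed

lemma cocycles2_zero: "(\<lambda>_. 0) \<in> cocycles2 G T"
  by (simp add: cocycles2_def cochains2_def)

lemma cocycle_group2_simps [simp]:
  "carrier (cocycle_group2 G T) = cocycles2 G T"
  "mult (cocycle_group2 G T) = (\<lambda>f g x. f x + g x)"
  "one (cocycle_group2 G T) = (\<lambda>_. 0)"
  by (simp_all add: cocycle_group2_def)

lemma comm_group_cocycles: "comm_group (cocycle_group2 G T)"
proof (rule comm_groupI)
  fix f assume "f \<in> carrier (cocycle_group2 G T)"
  then show "\<exists>g\<in>carrier (cocycle_group2 G T). g \<otimes>\<^bsub>cocycle_group2 G T\<^esub> f = \<one>\<^bsub>cocycle_group2 G T\<^esub>"
    by (intro bexI[of _ "\<lambda>x. - f x"]) (auto intro: cocycles2_uminus)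
qed (auto intro: cocycles2_add cocycles2_zero simp: add_ac)

lemma inv_cocycle_group2:
  fixes f :: "'a \<times> 'a \<Rightarrow> 'p::prime_card mod_ring"
  assumes "f \<in> cocycles2 G T"
  shows "inv\<^bsub>cocycle_group2 G T\<^esub> f = (\<lambda>x. - f x)"
proof -
  interpret C: comm_group "cocycle_group2 G T :: ('a \<times> 'a \<Rightarrow> 'p mod_ring) monoid"
    by (rule comm_group_cocycles)
  show ?thesis
    by (rule C.inv_equality) (use assms cocycles2_uminus in auto)
qed

lemma cochains1_add: "c \<in> cochains1 G T \<Longrightarrow> d \<in> cochains1 G T \<Longrightarrow> (\<lambda>x. c x + d x) \<in> cochains1 G T"
  by (auto simp: cochains1_iff intro: continuous_map_discrete_compose2)

lemma cochains1_uminus: "c \<in> cochains1 G T \<Longrightarrow> (\<lambda>x. - c x) \<in> cochains1 G T"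
  by (auto simp: cochains1_iff intro: continuous_map_discrete_compose1)

lemma cochains1_zero: "(\<lambda>_. 0) \<in> cochains1 G T"
  by (simp add: cochains1_iff)

lemma coboundary_add: "coboundary G (\<lambda>x. c x + d x) = (\<lambda>x. coboundary G c x + coboundary G d x)"
  by (auto simp: coboundary_def fun_eq_iff)

lemma coboundary_uminus: "coboundary G (\<lambda>x. - c x) = (\<lambda>x. - coboundary G c x)"
  by (auto simp: coboundary_def fun_eq_iff)

lemma coboundary_zero: "coboundary G (\<lambda>_. 0) = (\<lambda>_. 0)"
  by (auto simp: coboundary_def fun_eq_iff)

lemma coboundaries2_zero: "(\<lambda>_. 0) \<in> coboundaries2 G T"
  unfolding coboundaries2_def using imageI[OF cochains1_zero, of "coboundary G"]
  by (simp add: coboundary_zero)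

lemma subgroup_coboundaries:
  "subgroup (coboundaries2 G T :: ('a \<times> 'a \<Rightarrow> 'p::prime_card mod_ring) set) (cocycle_group2 G T)"
proof -
  let ?B = "coboundaries2 G T :: ('a \<times> 'a \<Rightarrow> 'p mod_ring) set"
  interpret C: comm_group "cocycle_group2 G T :: ('a \<times> 'a \<Rightarrow> 'p mod_ring) monoid"
    by (rule comm_group_cocycles)
  show ?thesis
  proof (rule C.subgroupI)
    show "?B \<subseteq> carrier (cocycle_group2 G T)"
      by (auto simp: coboundaries2_def coboundary_cocycle)
    show "?B \<noteq> {}"
      using coboundaries2_zero by blast
  next
    fix f assume "f \<in> ?B"
    then obtain c where "c \<in> cochains1 G T" "f = coboundary G c"
      by (auto simp: coboundaries2_def)
    then show "inv\<^bsub>cocycle_group2 G T\<^esub> f \<in> ?B"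
      using cochains1_uminus[of c] coboundary_uminus[of c, symmetric]
      by (simp add: inv_cocycle_group2 coboundary_cocycle coboundaries2_def)
  next
    fix f g assume "f \<in> ?B" "g \<in> ?B"
    then obtain c d where "c \<in> cochains1 G T" "f = coboundary G c" "d \<in> cochains1 G T" "g = coboundary G d"
      by (auto simp: coboundaries2_def)
    then show "f \<otimes>\<^bsub>cocycle_group2 G T\<^esub> g \<in> ?B"
      using cochains1_add[of c d] coboundary_add[of c d, symmetric] by (simp add: coboundaries2_def)
  qed
qed

lemma normal_coboundaries: "coboundaries2 G T \<lhd> cocycle_group2 G T"
  using comm_group.normal_iff_subgroup[OF comm_group_cocycles] subgroup_coboundaries by blast

lemma H2_class_iff: "g \<in> H2_class G T f \<longleftrightarrow> (\<exists>c\<in>cochains1 G T. g = (\<lambda>x. coboundary G c x + f x))"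
  by (auto simp: H2_class_def r_coset_def coboundaries2_def)

lemma H2_class_self: "f \<in> H2_class G T f"
  unfolding H2_class_iff
  by (rule bexI[of _ "\<lambda>_. 0"]) (simp_all add: cochains1_zero coboundary_zero)

lemma H2_class_coboundary:
  fixes c :: "'a \<Rightarrow> 'p::prime_card mod_ring"
  assumes "c \<in> cochains1 G T"
  shows "H2_class G T (coboundary G c) = coboundaries2 G T"
proof -
  interpret B: subgroup "coboundaries2 G T :: ('a \<times> 'a \<Rightarrow> 'p mod_ring) set" "cocycle_group2 G T"
    by (rule subgroup_coboundaries)
  show ?thesis
    unfolding H2_class_def
    by (rule B.rcos_const) (use comm_group_cocycles assms in \<open>auto simp: comm_group_def coboundaries2_def\<close>)
qed

lemma H2_class_zero: "H2_class G T (\<lambda>_. 0) = coboundaries2 G T"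
  using H2_class_coboundary[OF cochains1_zero] by (simp add: coboundary_zero)

lemma H2_class_add:
  fixes f :: "'a \<times> 'a \<Rightarrow> 'p::prime_card mod_ring"
  assumes "f \<in> cocycles2 G T" "g \<in> cocycles2 G T"
  shows "H2_class G T (\<lambda>x. f x + g x) = H2_class G T f \<otimes>\<^bsub>H2 G T\<^esub> H2_class G T g"
proof -
  interpret B: normal "coboundaries2 G T :: ('a \<times> 'a \<Rightarrow> 'p mod_ring) set" "cocycle_group2 G T"
    by (rule normal_coboundaries)
  show ?thesis
    using B.rcos_sum[of f g] assms by (simp add: H2_class_def H2_def)
qed

lemma one_H2: "one (H2 G T) = coboundaries2 G T"
  by (simp add: H2_def)

lemma H2_mult_mem:
  assumes "f \<in> X" "g \<in> Y"
  shows "(\<lambda>x. f x + g x) \<in> X \<otimes>\<^bsub>H2 G T\<^esub> Y"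
  using assms by (auto simp: H2_def set_mult_def)

lemma H2_inv_mem:
  fixes f :: "'a \<times> 'a \<Rightarrow> 'p::prime_card mod_ring"
  assumes f: "f \<in> cocycles2 G T"
  shows "(\<lambda>x. - f x) \<in> inv\<^bsub>H2 G T\<^esub> H2_class G T f"
proof -
  interpret B: normal "coboundaries2 G T :: ('a \<times> 'a \<Rightarrow> 'p mod_ring) set" "cocycle_group2 G T"
    by (rule normal_coboundaries)
  have "H2_class G T f \<in> carrier (cocycle_group2 G T Mod coboundaries2 G T)"
    using f by (simp add: H2_class_def carrier_FactGroup)
  then have "inv\<^bsub>H2 G T\<^esub> H2_class G T f = set_inv\<^bsub>cocycle_group2 G T\<^esub> H2_class G T f"
    unfolding H2_def by (rule B.inv_FactGroup)
  moreover have "inv\<^bsub>cocycle_group2 G T\<^esub> f \<in> set_inv\<^bsub>cocycle_group2 G T\<^esub> H2_class G T f"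
    unfolding SET_INV_def by (rule UN_I[OF H2_class_self]) simp
  ultimately show ?thesis
    using f by (simp add: inv_cocycle_group2)
qed

text \<open>The cocycle identity may be tested after pulling back along a surjection, where it holds
  for a coboundary. This spares a direct computation with Massey cochains.\<close>

lemma cocycle_if_pullback_coboundary:
  fixes \<pi> :: "'s \<Rightarrow> 'a" and S :: "('s, 'k) monoid_scheme"
  assumes S: "group S" and \<pi>: "\<pi> \<in> hom S G" "\<pi> ` carrier S = carrier G"
    and f: "f \<in> cochains2 G T"
    and pull: "\<And>s t. s \<in> carrier S \<Longrightarrow> t \<in> carrier S \<Longrightarrow> f (\<pi> s, \<pi> t) = h s + h t - h (s \<otimes>\<^bsub>S\<^esub> t)"
  shows "f \<in> cocycles2 G T"
proof -
  interpret S: group S by fact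
  have "f (\<sigma>, \<tau>) - f (\<rho> \<otimes> \<sigma>, \<tau>) + f (\<rho>, \<sigma> \<otimes> \<tau>) - f (\<rho>, \<sigma>) = 0"
    if G: "\<rho> \<in> carrier G" "\<sigma> \<in> carrier G" "\<tau> \<in> carrier G" for \<rho> \<sigma> \<tau>
  proof -
    obtain r s t where rst: "r \<in> carrier S" "\<rho> = \<pi> r" "s \<in> carrier S" "\<sigma> = \<pi> s" "t \<in> carrier S" "\<tau> = \<pi> t"
    proof -
      have "\<rho> \<in> \<pi> ` carrier S" "\<sigma> \<in> \<pi> ` carrier S" "\<tau> \<in> \<pi> ` carrier S"
        using G by (simp_all add: \<pi>(2))
      then show thesis
        by (elim imageE) (rule that)
    qed
    have "\<rho> \<otimes> \<sigma> = \<pi> (r \<otimes>\<^bsub>S\<^esub> s)" "\<sigma> \<otimes> \<tau> = \<pi> (s \<otimes>\<^bsub>S\<^esub> t)"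
      using rst \<pi>(1) by (auto simp: hom_def)
    then show ?thesis
      using rst pull by (simp add: S.m_assoc)
  qed
  then show ?thesis
    using f by (simp add: cocycles2_def)
qed

lemma massey_tilde_cochain:
  assumes "\<And>r. r \<in> {i..<j} \<Longrightarrow> c i r \<in> cochains1 G T" "\<And>r. r \<in> {i..<j} \<Longrightarrow> c (r + 1) j \<in> cochains1 G T"
  shows "massey_tilde c i j \<in> cochains2 G T"
proof -
  have "cont2 (\<lambda>x. \<Sum>r\<in>{i..<j}. cup (c i r) (c (r + 1) j) x)"
  proof (rule continuous_map_discrete_sum)
    fix r assume "r \<in> {i..<j}"
    then have "cont2 (\<lambda>x. c i r (fst x) * c (r + 1) j (snd x))"
      using assms by (intro continuous_map_discrete_compose2[where h = "(*)"] cont2_fst cont2_snd)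
        (auto simp: cochains1_iff)
    then show "cont2 (cup (c i r) (c (r + 1) j))"
      by (simp add: cup_def case_prod_unfold)
  qed
  then have "cont2 (massey_tilde c i j)"
    unfolding massey_tilde_def by (rule continuous_map_discrete_compose1)
  moreover have "massey_tilde c i j x = 0" if "x \<notin> carrier G \<times> carrier G" for x
  proof -
    have "cup (c i r) (c (r + 1) j) x = 0" if "r \<in> {i..<j}" for r
      using assms[OF that] \<open>x \<notin> carrier G \<times> carrier G\<close> by (cases x) (auto simp: cup_def cochains1_iff)
    then show ?thesis
      by (simp add: massey_tilde_def)
  qed
  ultimately show ?thesis
    by (simp add: cochains2_def)
qed

end

section \<open>Duality in the free presentation\<close>

text \<open>The value 0 off the quotient space matches the normalisation in
  \<open>cochains1\<close>.\<close>

lemma quotient_map_factor_discrete: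
  fixes f :: "'s \<Rightarrow> 'c::zero"
  assumes r: "quotient_map T U r" and f: "continuous_map T (discrete_topology UNIV) f"
    and eq: "\<And>s t. s \<in> topspace T \<Longrightarrow> t \<in> topspace T \<Longrightarrow> r s = r t \<Longrightarrow> f s = f t"
  shows "\<exists>h. continuous_map U (discrete_topology UNIV) h \<and> (\<forall>s\<in>topspace T. h (r s) = f s) \<and>
    (\<forall>x. x \<notin> topspace U \<longrightarrow> h x = 0)"
proof -
  define h where "h x = (if x \<in> topspace U then f (inv_into (topspace T) r x) else 0)" for x
  have surj: "r ` topspace T = topspace U"
    by (rule quotient_imp_surjective_map[OF r])
  have h: "h (r s) = f s" if "s \<in> topspace T" for s
  proof -
    have "r s \<in> r ` topspace T"
      using that by blast
    then have "f (inv_into (topspace T) r (r s)) = f s"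
      using that by (intro eq) (auto simp: inv_into_into f_inv_into_f)
    then show ?thesis
      using \<open>r s \<in> r ` topspace T\<close> surj by (simp add: h_def)
  qed
  have "continuous_map T (discrete_topology UNIV) (h \<circ> r)"
    by (rule continuous_map_eq[OF f]) (simp add: h)
  then have "continuous_map U (discrete_topology UNIV) h"
    by (rule continuous_compose_quotient_map[OF r])
  then show ?thesis
    using h by (intro exI[of _ h]) (simp add: h_def)
qed

text \<open>Every scalar of a prime field is a natural number, so scaling is repeated addition. This
  handles scalars where only a subgroup of cohomology classes is at hand.\<close>

lemma mod_ring_scale_closed:
  fixes f :: "'a \<Rightarrow> 'p::prime_card mod_ring"
  assumes "P (\<lambda>_. 0)" "\<And>g. P g \<Longrightarrow> P (\<lambda>x. f x + g x)"
  shows "P (\<lambda>x. c * f x)"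
proof -
  have "P (\<lambda>x. of_nat m * f x)" for m
  proof (induction m)
    case (Suc m)
    from assms(2)[OF this] show ?case
      by (simp add: algebra_simps)
  qed (use assms(1) in simp)
  then show ?thesis
    using surj_of_nat_mod_ring[of c] by metis
qed

text \<open>Finite-dimensional duality for homomorphisms on \<open>A\<close>. If some
  \<open>\<psi>\<close> is nonzero on \<open>N\<close>, match its value at \<open>s\<close> by an
  element of \<open>N\<close>, divide that element out of \<open>s\<close>, and continue inside the
  kernel of \<open>\<psi>\<close> on \<open>N\<close>.\<close>

lemma (in group) simultaneous_values:
  fixes F :: "('a \<Rightarrow> 'p::prime_card mod_ring) set"
  assumes A: "subgroup A G"
    and F: "\<And>f g. f \<in> F \<Longrightarrow> g \<in> F \<Longrightarrow> (\<lambda>x. f x + g x) \<in> F" "\<And>f c. f \<in> F \<Longrightarrow> (\<lambda>x. c * f x) \<in> F"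
    and hom: "\<And>f a b. f \<in> F \<Longrightarrow> a \<in> A \<Longrightarrow> b \<in> A \<Longrightarrow> f (a \<otimes> b) = f a + f b"
    and X: "finite X" "X \<subseteq> F"
    and N: "subgroup N G" "N \<subseteq> A" and s: "s \<in> A"
    and vanish: "\<And>f. f \<in> F \<Longrightarrow> (\<forall>x\<in>N. f x = 0) \<Longrightarrow> f s = 0"
  shows "\<exists>x\<in>N. \<forall>f\<in>X. f x = f s"
  using X N s vanish
proof (induction X arbitrary: N s rule: finite_induct)
  case empty
  then show ?case
    using subgroup.one_closed by blast
next
  case (insert \<psi> X)
  interpret A: subgroup A G by fact
  interpret N: subgroup N G by (rule insert.prems(2))
  have chi: "\<psi> \<in> F"
    using insert.prems by simp
  have F_one: "f \<one> = 0" if "f \<in> F" for f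
  proof -
    have "f (\<one> \<otimes> \<one>) - f \<one> = f \<one>"
      unfolding hom[OF that A.one_closed A.one_closed] by (rule add_diff_cancel_right')
    then show ?thesis
      by simp
  qed
  have hom_pow: "\<psi> (a [^] m) = of_nat m * \<psi> a" if "a \<in> A" for a and m :: nat
  proof (induction m)
    case 0
    show ?case
      using F_one[OF chi] by simp
  next
    case (Suc m)
    then show ?case
      using that subgroup_nat_pow_closed[OF A that] hom[OF chi _ that] by (simp add: algebra_simps)
  qed
  show ?case
  proof (cases "\<forall>x\<in>N. \<psi> x = 0")
    case True
    then have "\<psi> s = 0"
      using insert.prems(5) chi by blast
    moreover obtain x where "x \<in> N" "\<forall>f\<in>X. f x = f s"
      using insert.IH[of N s] insert.prems by auto
    ultimately show ?thesis
      using True by auto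
  next
    case False
    then obtain r where r: "r \<in> N" "\<psi> r \<noteq> 0"
      by blast
    \<comment> \<open>Over a prime field a power of \<open>r\<close> attains any prescribed value of
      \<open>\<psi>\<close>.\<close>
    obtain m where m: "\<psi> s / \<psi> r = of_nat m"
      using surj_of_nat_mod_ring[of "\<psi> s / \<psi> r"] by blast
    define t where "t = r [^] m"
    have t: "t \<in> N" "\<psi> t = \<psi> s"
      using subgroup_nat_pow_closed[OF insert.prems(2) r(1), of m] hom_pow[of r m] r insert.prems(3)
      by (auto simp: t_def simp flip: m)
    have tA: "t \<in> A" "inv t \<in> A"
      using t insert.prems(3) by auto
    define N' where "N' = {x \<in> N. \<psi> x = 0}"
    define s' where "s' = s \<otimes> inv t"
    have s': "s' \<in> A" "s = s' \<otimes> t"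
      using insert.prems(4) tA A.mem_carrier by (auto simp: s'_def m_assoc)
    note chi_one = F_one[OF chi]
    have chi_inv: "\<psi> (inv a) = - \<psi> a" if "a \<in> A" for a
      using hom[OF chi that A.m_inv_closed[OF that]] chi_one that A.mem_carrier
      by (simp add: add_eq_0_iff)
    have "subgroup N' G"
    proof (rule subgroupI)
      show "N' \<noteq> {}"
        unfolding N'_def using chi_one N.one_closed by blast
    next
      fix a assume "a \<in> N'"
      then show "inv a \<in> N'"
        using chi_inv[of a] insert.prems(3) by (auto simp: N'_def)
    next
      fix a b assume "a \<in> N'" "b \<in> N'"
      then show "a \<otimes> b \<in> N'"
        using hom[OF chi, of a b] insert.prems(3) by (auto simp: N'_def)
    qed (auto simp: N'_def)
    moreover have "N' \<subseteq> A"
      using insert.prems(3) by (auto simp: N'_def)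
    moreover have "f s' = 0" if f: "f \<in> F" "\<forall>x\<in>N'. f x = 0" for f
    proof -
      \<comment> \<open>A function vanishing on \<open>N'\<close> is corrected by the multiple of
        \<open>\<psi>\<close> that makes it vanish at \<open>r\<close> as well. It then vanishes on
        \<open>N\<close>, so the original hypothesis on \<open>s\<close> becomes applicable.\<close>
      define c where "c = - f r / \<psi> r"
      define g where "g = (\<lambda>x. f x + c * \<psi> x)"
      have g: "g \<in> F"
        unfolding g_def by (intro F f(1) chi)
      have gr: "g r = 0"
        using r by (simp add: g_def c_def)
      have "g x = 0" if x: "x \<in> N" for x
      proof -
        obtain k where k: "\<psi> x / \<psi> r = of_nat k"
          using surj_of_nat_mod_ring[of "\<psi> x / \<psi> r"] by blast
        define y where "y = r [^] k"
        have y: "y \<in> N" "y \<in> A" "\<psi> y = \<psi> x"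
          using subgroup_nat_pow_closed[OF insert.prems(2) r(1), of k] hom_pow[of r k] r insert.prems(3)
          by (auto simp: y_def simp flip: k)
        have "g y = 0"
        proof -
          have g_pow: "g (r [^] j) = of_nat j * g r" for j :: nat
          proof (induction j)
            case 0
            show ?case
              using F_one[OF g] by simp
          next
            case (Suc j)
            then show ?case
              using r insert.prems(3) subgroup_nat_pow_closed[OF A, of r j] hom[OF g, of "r [^] j" r]
              by (auto simp: gr)
          qed
          then show ?thesis
            by (simp add: y_def gr)
        qed
        have xA: "x \<in> A"
          using x insert.prems(3) by blast
        have "\<psi> (x \<otimes> inv y) = 0"
          using hom[OF chi xA, of "inv y"] chi_inv[OF y(2)] y by auto
        then have xy: "x \<otimes> inv y \<in> N'"
          using x y by (auto simp: N'_def)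
        then have "g (x \<otimes> inv y) = 0"
          using f(2) by (simp add: g_def N'_def)
        moreover have "g ((x \<otimes> inv y) \<otimes> y) = g (x \<otimes> inv y) + g y"
          using xA y by (intro hom[OF g]) auto
        ultimately show ?thesis
          using \<open>g y = 0\<close> x y by (simp add: m_assoc)
      qed
      then have "g s = 0"
        using insert.prems(5)[OF g] by blast
      moreover have "g t = 0"
        using \<open>\<And>x. x \<in> N \<Longrightarrow> g x = 0\<close> t by blast
      moreover have "g s = g s' + g t"
        unfolding s'(2) by (rule hom[OF g s'(1) tA(1)])
      ultimately have "g s' = 0"
        by simp
      moreover have "\<psi> s' = 0"
        using hom[OF chi s'(1) tA(1)] s'(2) t by simp
      ultimately show "f s' = 0"
        by (simp add: g_def)
    qed
    ultimately obtain x where x: "x \<in> N'" "\<forall>f\<in>X. f x = f s'"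
      using insert.IH[of N' s'] insert.prems(1) s'(1) by auto
    have "f (x \<otimes> t) = f s" if "f \<in> insert \<psi> X" for f
    proof -
      have fF: "f \<in> F"
        using that insert.prems(1) by blast
      have xA: "x \<in> A"
        using x insert.prems(3) by (auto simp: N'_def)
      have "f x = f s'"
        using x that hom[OF chi s'(1) tA(1)] s'(2) t by (auto simp: N'_def)
      then show ?thesis
        using hom[OF fF xA tA(1)] hom[OF fF s'(1) tA(1)] s'(2) by simp
    qed
    then show ?thesis
      using x t by (intro bexI[of _ "x \<otimes> t"]) (auto simp: N'_def)
  qed
qed

lemma rep_span_corner:
  assumes "group G" "topological_group G T" "f \<in> rep_span G T (Suc n) {n}" "n \<ge> 1"
  shows "f \<one>\<^bsub>G\<^esub> = 0"
proof -
  interpret topological_group G T by fact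
  show ?thesis
    using assms(3)
  proof induction
    case (entry \<rho> j)
    then show ?case
      using unipotent_repD(3)[OF entry(1)] assms(4) by simp
  qed auto
qed

context profinite_group
begin

lemma dd_rep_span:
  fixes f :: "'a \<Rightarrow> 'p::prime_card mod_ring"
  shows "f \<in> rep_span G T k {..<k} \<Longrightarrow> dd k f"
proof (induction rule: rep_span.induct)
  case (entry \<rho> j)
  then have "dd (Suc (j - 0)) (\<lambda>x. \<rho> x $$ (0, j))"
    by (intro dd_unipotent_entry) auto
  then show ?case
    by (rule dd_mono) (use entry in simp)
next
  case (scale f c)
  show ?case
    by (rule dd_additive_map[of "\<lambda>a. c * a"]) (use scale in \<open>auto simp: right_diff_distrib\<close>)
qed (auto intro: dd_zero dd_add)

lemma rep_span_mono: "f \<in> rep_span G T k J \<Longrightarrow> J \<subseteq> J' \<Longrightarrow> f \<in> rep_span G T k J'"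
  by (induction rule: rep_span.induct) (auto intro: rep_span.intros)

text \<open>The corner has degree at most \<open>n\<close>, and \<open>x\<close> lowers degrees by
  \<open>n\<close>, so \<open>left_diff G x f\<close> is constant, with value \<open>f x\<close> at
  1 because the corner of the identity matrix is 0. Only the left factor has to lie in the
  filtration term.\<close>

lemma corner_additive:
  fixes f :: "'a \<Rightarrow> 'p::prime_card mod_ring"
  assumes f: "f \<in> rep_span G T (Suc n) {n}" and n: "n \<ge> 1"
    and x: "x \<in> Z CARD('p) n" and s: "s \<in> carrier G"
  shows "f (x \<otimes> s) = f x + f s"
proof -
  have "dd (Suc n) f"
    by (rule dd_rep_span) (use rep_span_mono[OF f] in auto)
  then have "dd (Suc n - n) (left_diff G x f)"
    using cont_rep_span[OF f] x by (intro dd_zassenhaus)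
  then have "dd (Suc 0) (left_diff G x f)"
    by simp
  then have "left_diff G s (left_diff G x f) \<one> = 0"
    unfolding dd_Suc dd_0 using s by blast
  then show ?thesis
    using s x zassenhaus_subset[of "CARD('p)" n] rep_span_corner[OF is_group topological_group_axioms f n]
    by (auto simp: left_diff_def algebra_simps)
qed

end

section \<open>Free presentations and images of the filtration\<close>

locale free_presentation = S: free_profinite S TS B + G: profinite_group G TG
  for S :: "('s, 'k) monoid_scheme" and TS B and G :: "('a, 'm) monoid_scheme" and TG +
  fixes \<pi> :: "'s \<Rightarrow> 'a" and N :: "'s set"
  assumes pi_hom: "\<pi> \<in> hom S G" and pi_quotient: "quotient_map TS TG \<pi>"
    and normal_N: "N \<lhd> S" and kernel_pi: "s \<in> carrier S \<Longrightarrow> \<pi> s = \<one>\<^bsub>G\<^esub> \<longleftrightarrow> s \<in> N"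
begin

sublocale pi: group_hom S G \<pi>
  using pi_hom S.is_group G.is_group by (simp add: group_hom_def group_hom_axioms_def)

lemma pi_surj: "\<pi> ` carrier S = carrier G"
  using quotient_imp_surjective_map[OF pi_quotient] by simp

lemma pi_continuous: "continuous_map TS TG \<pi>"
  by (rule quotient_imp_continuous_map[OF pi_quotient])

lemma pi_eqD:
  assumes "s \<in> carrier S" "t \<in> carrier S" "\<pi> s = \<pi> t"
  shows "\<exists>x\<in>N. s = x \<otimes>\<^bsub>S\<^esub> t"
proof -
  have "\<pi> (s \<otimes>\<^bsub>S\<^esub> inv\<^bsub>S\<^esub> t) = \<one>\<^bsub>G\<^esub>"
    using assms by simp
  then have "s \<otimes>\<^bsub>S\<^esub> inv\<^bsub>S\<^esub> t \<in> N"
    using assms kernel_pi[of "s \<otimes>\<^bsub>S\<^esub> inv\<^bsub>S\<^esub> t"] by blast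
  moreover have "s = (s \<otimes>\<^bsub>S\<^esub> inv\<^bsub>S\<^esub> t) \<otimes>\<^bsub>S\<^esub> t"
    using assms by (simp add: S.m_assoc)
  ultimately show ?thesis
    by blast
qed

text \<open>Compactness makes \<open>\<pi>\<close> a closed map, so the image of a closed generated
  subgroup needs no further closure.\<close>

lemma image_csg:
  assumes "A \<subseteq> carrier S"
  shows "\<pi> ` S.csg A = G.csg (\<pi> ` A)"
proof
  have A: "\<pi> ` A \<subseteq> carrier G"
    using assms by auto
  have "subgroup {x \<in> carrier S. \<pi> x \<in> G.csg (\<pi> ` A)} S"
  proof -
    interpret C: subgroup "G.csg (\<pi> ` A)" G
      by (rule G.csg_subgroup[OF A])
    show ?thesis
      by (rule S.subgroupI) (auto intro: exI[of _ "\<one>\<^bsub>S\<^esub>"])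
  qed
  moreover have "closedin TS {x \<in> carrier S. \<pi> x \<in> G.csg (\<pi> ` A)}"
    using closedin_continuous_map_preimage[OF pi_continuous G.csg_closed[OF A]] by simp
  ultimately have "S.csg A \<subseteq> {x \<in> carrier S. \<pi> x \<in> G.csg (\<pi> ` A)}"
    using assms G.csg_subset[of "\<pi> ` A"] by (intro S.csg_minimal) auto
  then show "\<pi> ` S.csg A \<subseteq> G.csg (\<pi> ` A)"
    by auto
next
  have "closed_map TS TG \<pi>"
    by (rule continuous_imp_closed_map[OF pi_continuous S.compact G.Hausdorff])
  then have "closedin TG (\<pi> ` S.csg A)"
    using S.csg_closed[OF assms] by (simp add: closed_map_def)
  moreover have "subgroup (\<pi> ` S.csg A) G"
    using S.csg_subgroup[OF assms] by (rule pi.subgroup_img_is_subgroup)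
  ultimately show "G.csg (\<pi> ` A) \<subseteq> \<pi> ` S.csg A"
    by (intro G.csg_minimal image_mono S.csg_subset)
qed

lemma image_set_mult:
  assumes "A \<subseteq> carrier S" "C \<subseteq> carrier S"
  shows "\<pi> ` (A <#>\<^bsub>S\<^esub> C) = \<pi> ` A <#>\<^bsub>G\<^esub> \<pi> ` C"
proof -
  have eq: "\<pi> (a \<otimes>\<^bsub>S\<^esub> c) = \<pi> a \<otimes>\<^bsub>G\<^esub> \<pi> c" if "a \<in> A" "c \<in> C" for a c
    using that assms by (intro pi.hom_mult) auto
  have "\<pi> ` (A <#>\<^bsub>S\<^esub> C) = (\<Union>a\<in>A. \<Union>c\<in>C. {\<pi> (a \<otimes>\<^bsub>S\<^esub> c)})"
    by (auto simp: set_mult_def)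
  also have "\<dots> = (\<Union>a\<in>A. \<Union>c\<in>C. {\<pi> a \<otimes>\<^bsub>G\<^esub> \<pi> c})"
    using eq by auto
  also have "\<dots> = \<pi> ` A <#>\<^bsub>G\<^esub> \<pi> ` C"
    by (auto simp: set_mult_def)
  finally show ?thesis .
qed

lemma image_closed_power:
  assumes "A \<subseteq> carrier S"
  shows "\<pi> ` closed_power S TS A p = closed_power G TG (\<pi> ` A) p"
proof -
  have "\<pi> (h [^]\<^bsub>S\<^esub> p) = \<pi> h [^]\<^bsub>G\<^esub> p" if "h \<in> A" for h
    using that assms by (intro pi.hom_nat_pow) auto
  then have "\<pi> ` {h [^]\<^bsub>S\<^esub> p | h. h \<in> A} = {h [^]\<^bsub>G\<^esub> p | h. h \<in> \<pi> ` A}"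
    by (auto simp: image_iff) metis+
  then show ?thesis
    unfolding closed_power_def using assms by (subst image_csg) auto
qed

lemma image_closed_commutator:
  assumes "A \<subseteq> carrier S" "C \<subseteq> carrier S"
  shows "\<pi> ` closed_commutator S TS A C = closed_commutator G TG (\<pi> ` A) (\<pi> ` C)"
proof -
  let ?cS = "\<lambda>h k. h \<otimes>\<^bsub>S\<^esub> k \<otimes>\<^bsub>S\<^esub> inv\<^bsub>S\<^esub> h \<otimes>\<^bsub>S\<^esub> inv\<^bsub>S\<^esub> k"
  let ?cG = "\<lambda>h k. h \<otimes>\<^bsub>G\<^esub> k \<otimes>\<^bsub>G\<^esub> inv\<^bsub>G\<^esub> h \<otimes>\<^bsub>G\<^esub> inv\<^bsub>G\<^esub> k"
  have eq: "\<pi> (?cS h k) = ?cG (\<pi> h) (\<pi> k)" if "h \<in> A" "k \<in> C" for h k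
  proof -
    have "h \<in> carrier S" "k \<in> carrier S"
      using that assms by auto
    then show ?thesis
      by simp
  qed
  have image: "\<pi> ` {?cS h k | h k. h \<in> A \<and> k \<in> C} = {?cG h k | h k. h \<in> \<pi> ` A \<and> k \<in> \<pi> ` C}"
    (is "?L = ?R")
  proof (intro equalityI subsetI)
    fix y assume "y \<in> ?L"
    then obtain h k where hk: "h \<in> A" "k \<in> C" "y = \<pi> (?cS h k)"
      by blast
    then have "y = ?cG (\<pi> h) (\<pi> k)"
      by (simp only: eq)
    then show "y \<in> ?R"
      using hk(1,2) by blast
  next
    fix y assume "y \<in> ?R"
    then obtain h k where hk: "h \<in> A" "k \<in> C" "y = ?cG (\<pi> h) (\<pi> k)"
      by blast
    then have "y = \<pi> (?cS h k)"
      by (simp only: eq)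
    then show "y \<in> ?L"
      using hk(1,2) by blast
  qed
  have "{?cS h k | h k. h \<in> A \<and> k \<in> C} \<subseteq> carrier S"
  proof clarify
    fix h k assume "h \<in> A" "k \<in> C"
    then have "h \<in> carrier S" "k \<in> carrier S"
      using assms by auto
    then show "?cS h k \<in> carrier S"
      by simp
  qed
  from image_csg[OF this] show ?thesis
    unfolding closed_commutator_def image .
qed

lemma image_foldr:
  assumes "\<And>i. i \<in> set is \<Longrightarrow> F i \<subseteq> carrier S"
  shows "foldr (\<lambda>i A. F i <#>\<^bsub>S\<^esub> A) is {\<one>\<^bsub>S\<^esub>} \<subseteq> carrier S \<and>
    \<pi> ` foldr (\<lambda>i A. F i <#>\<^bsub>S\<^esub> A) is {\<one>\<^bsub>S\<^esub>} =
      foldr (\<lambda>i A. \<pi> ` F i <#>\<^bsub>G\<^esub> A) is {\<one>\<^bsub>G\<^esub>}"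
  using assms
proof (induction "is")
  case (Cons i "is")
  then show ?case
    using S.setmult_subset_G by (auto simp: image_set_mult)
qed simp

text \<open>Powers, commutators, products and closed generation all commute with
  \<open>\<pi>\<close>, so the recursion can be followed step by step.\<close>

lemma image_zassenhaus: "\<pi> ` S.Z p n = G.Z p n"
proof (induction n rule: less_induct)
  case (less n)
  show ?case
  proof (cases "n \<le> 1 \<or> p < 2")
    case True
    then show ?thesis
      using pi_surj by (simp add: zassenhaus.simps)
  next
    case False
    then have p: "2 \<le> p" "2 \<le> n"
      by auto
    let ?F = "\<lambda>i. closed_commutator S TS (S.Z p i) (S.Z p (n - i))"
    have F: "?F i \<subseteq> carrier S" for i
      using S.closed_normal_subset[OF S.closed_normal_commutator] S.normal_zassenhaus by blast
    have P: "closed_power S TS (S.Z p (S.ceil_div n p)) p \<subseteq> carrier S"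
      using S.closed_normal_subset[OF S.closed_normal_power] S.normal_zassenhaus by blast
    have "\<pi> ` S.Z p n = \<pi> ` closed_power S TS (S.Z p (S.ceil_div n p)) p <#>\<^bsub>G\<^esub>
        \<pi> ` foldr (\<lambda>i A. ?F i <#>\<^bsub>S\<^esub> A) [1..<n] {\<one>\<^bsub>S\<^esub>}"
      unfolding S.zassenhaus_rec[OF p] using P image_foldr[of "[1..<n]" ?F] F by (intro image_set_mult) auto
    also have "\<pi> ` closed_power S TS (S.Z p (S.ceil_div n p)) p = closed_power G TG (G.Z p (G.ceil_div n p)) p"
      using less.IH[OF S.ceil_div_bounds(2)[OF p]] S.zassenhaus_subset by (simp add: image_closed_power)
    also have "\<pi> ` foldr (\<lambda>i A. ?F i <#>\<^bsub>S\<^esub> A) [1..<n] {\<one>\<^bsub>S\<^esub>} =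
        foldr (\<lambda>i A. \<pi> ` ?F i <#>\<^bsub>G\<^esub> A) [1..<n] {\<one>\<^bsub>G\<^esub>}"
      using image_foldr[of "[1..<n]" ?F] F by blast
    also have "\<dots> = foldr (\<lambda>i A. closed_commutator G TG (G.Z p i) (G.Z p (n - i)) <#>\<^bsub>G\<^esub> A) [1..<n] {\<one>\<^bsub>G\<^esub>}"
      using less.IH S.zassenhaus_subset by (intro foldr_cong) (auto simp: image_closed_commutator)
    finally show ?thesis
      by (simp only: G.zassenhaus_rec[OF p])
  qed
qed

end

section \<open>Massey products\<close>

lemma sum_atLeastAtMost_ends:
  fixes f :: "nat \<Rightarrow> 'b::comm_monoid_add"
  assumes "i < j"
  shows "(\<Sum>r\<in>{i..j}. f r) = f i + (\<Sum>r\<in>{Suc i..<j}. f r) + f j"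
proof -
  have "{i..j} = insert i (insert j {Suc i..<j})"
    using assms by auto
  then show ?thesis
    using assms by (simp add: ac_simps)
qed

lemma compactin_finite_Inter_empty:
  assumes "compactin T K" "\<And>C. C \<in> \<U> \<Longrightarrow> closedin T C" "K \<inter> \<Inter>\<U> = {}"
  obtains \<F> where "finite \<F>" "\<F> \<subseteq> \<U>" "K \<inter> \<Inter>\<F> = {}"
  using assms unfolding compactin_fip by meson

lemma massey_tilde_apply:
  "massey_tilde c i j (x, y) = - (\<Sum>r\<in>{i..<j}. c i r x * c (Suc r) j y)"
  by (simp add: massey_tilde_def cup_def)

definition inflate1 ::
  "('a, 'm) monoid_scheme \<Rightarrow> 'a set \<Rightarrow> ('a set \<Rightarrow> 'b::zero) \<Rightarrow> 'a \<Rightarrow> 'b"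
  where "inflate1 G N c = (\<lambda>x. if x \<in> carrier G then c (N #>\<^bsub>G\<^esub> x) else 0)"

definition inflate2 ::
  "('a, 'm) monoid_scheme \<Rightarrow> 'a set \<Rightarrow> ('a set \<times> 'a set \<Rightarrow> 'b::zero) \<Rightarrow> 'a \<times> 'a \<Rightarrow> 'b"
  where "inflate2 G N f = (\<lambda>(\<sigma>, \<tau>).
    if \<sigma> \<in> carrier G \<and> \<tau> \<in> carrier G then f (N #>\<^bsub>G\<^esub> \<sigma>, N #>\<^bsub>G\<^esub> \<tau>) else 0)"

context topological_group
begin

lemma inflation_eq: "inflation G T N C = (\<Union>f\<in>C. H2_class G T (inflate2 G N f))"
  by (simp add: inflation_def inflate2_def)

lemma cont_comp_coset:
  assumes "c \<in> cochains1 (G Mod N) (quotient_topology G T N)"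
  shows "cont (\<lambda>x. c (N #> x))"
  using continuous_map_compose[OF quotient_imp_continuous_map[OF quotient_map_coset[of N]], of _ c] assms
  by (simp add: cochains1_def o_def)

lemma inflate1_cochain:
  assumes "c \<in> cochains1 (G Mod N) (quotient_topology G T N)"
  shows "inflate1 G N c \<in> cochains1 G T"
proof -
  have "cont (inflate1 G N c)"
    by (rule continuous_map_eq[OF cont_comp_coset[OF assms]]) (simp add: inflate1_def)
  then show ?thesis
    by (simp add: cochains1_iff inflate1_def)
qed

lemma coboundary_inflate1:
  assumes "N \<lhd> G"
  shows "coboundary G (inflate1 G N c) = inflate2 G N (coboundary (G Mod N) c)"
proof -
  interpret N: normal N G by fact
  show ?thesis
    by (auto simp: coboundary_def inflate1_def inflate2_def carrier_FactGroup N.rcos_sum fun_eq_iff)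
qed

lemma inflate2_add: "inflate2 G N (\<lambda>x. f x + g x) = (\<lambda>x. inflate2 G N f x + inflate2 G N g x)"
  for f g :: "'a set \<times> 'a set \<Rightarrow> 'c::monoid_add"
  by (auto simp: inflate2_def fun_eq_iff)

lemma inflate2_uminus: "inflate2 G N (\<lambda>x. - f x) = (\<lambda>x. - inflate2 G N f x)"
  for f :: "'a set \<times> 'a set \<Rightarrow> 'c::group_add"
  by (auto simp: inflate2_def fun_eq_iff)

text \<open>\<open>inflation\<close> is a union over all representatives of a class. Changing the
  representative by a coboundary changes the inflated cochain by an inflated coboundary, so testing
  one representative suffices.\<close>

lemma inflation_trivial_iff:
  fixes f :: "'a set \<times> 'a set \<Rightarrow> 'p::prime_card mod_ring"
  assumes N: "N \<lhd> G"
  shows "inflation G T N (H2_class (G Mod N) (quotient_topology G T N) f) = coboundaries2 G T \<longleftrightarrow>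
    (\<exists>h\<in>cochains1 G T. inflate2 G N f = coboundary G h)"
proof -
  let ?Q = "G Mod N" and ?U = "quotient_topology G T N"
  interpret Q: topological_group ?Q ?U
    by (rule topological_group_quotient[OF N])
  show ?thesis
  proof
    assume "inflation G T N (H2_class ?Q ?U f) = coboundaries2 G T"
    then have "inflate2 G N f \<in> coboundaries2 G T"
      unfolding inflation_eq using Q.H2_class_self[of f] H2_class_self[of "inflate2 G N f"] by blast
    then show "\<exists>h\<in>cochains1 G T. inflate2 G N f = coboundary G h"
      by (auto simp: coboundaries2_def)
  next
    assume "\<exists>h\<in>cochains1 G T. inflate2 G N f = coboundary G h"
    then obtain h where h: "h \<in> cochains1 G T" "inflate2 G N f = coboundary G h"
      by blast
    have "H2_class G T (inflate2 G N g) = coboundaries2 G T" if g: "g \<in> H2_class ?Q ?U f" for g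
    proof -
      obtain b where b: "b \<in> cochains1 ?Q ?U" "g = (\<lambda>x. coboundary ?Q b x + f x)"
        using g by (auto simp: Q.H2_class_iff)
      have "inflate2 G N g = coboundary G (\<lambda>x. inflate1 G N b x + h x)"
        unfolding b(2) inflate2_add coboundary_add coboundary_inflate1[OF N] h(2) ..
      then show ?thesis
        using H2_class_coboundary[OF cochains1_add[OF inflate1_cochain[OF b(1)] h(1)]] by simp
    qed
    then show "inflation G T N (H2_class ?Q ?U f) = coboundaries2 G T"
      unfolding inflation_eq using Q.H2_class_self[of f] by blast
  qed
qed

text \<open>A defining system provides every entry above the diagonal except the corner. A cochain
  whose coboundary is the inflated Massey cocycle is exactly what the corner of a homomorphism must
  be; with the sign in \<open>massey_tilde\<close> the equations become matrix multiplication
  without signs.\<close>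

lemma defining_system_rep:
  fixes c :: "nat \<Rightarrow> nat \<Rightarrow> 'a set \<Rightarrow> 'p::prime_card mod_ring"
  assumes N: "N \<lhd> G" and n: "n \<ge> 1"
    and c: "defining_system (G Mod N) (quotient_topology G T N) n c"
    and h: "cont h" "\<And>x y. x \<in> carrier G \<Longrightarrow> y \<in> carrier G \<Longrightarrow>
      h x + h y - h (x \<otimes> y) = massey_tilde c 1 n (N #> x, N #> y)"
  shows "\<exists>\<rho> \<in> unipotent_reps G T (Suc n). \<forall>x\<in>carrier G. \<rho> x $$ (0, n) = h x"
proof -
  interpret N: normal N G by fact
  let ?Q = "G Mod N" and ?U = "quotient_topology G T N"
  \<comment> \<open>Matrix rows start at 0 and defining systems at 1, whence
    \<open>c (Suc i) j\<close> in position \<open>(i, j)\<close>.\<close>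
  define e where "e i j x = (if i = 0 \<and> j = n then h x else c (Suc i) j (N #> x))" for i j x
  define \<rho> where "\<rho> x = mat (Suc n) (Suc n) (\<lambda>(i, j). if i = j then 1 else if j < i then 0 else e i j x)" for x
  have c': "c (Suc i) j \<in> cochains1 ?Q ?U" "coboundary ?Q (c (Suc i) j) = massey_tilde c (Suc i) j"
    if "i < j" "j \<le> n" "\<not> (i = 0 \<and> j = n)" for i j
    using c that unfolding defining_system_def by (metis One_nat_def Pair_inject Suc_inject Suc_leI le_add1 plus_1_eq_Suc)+
  have e: "e i j (x \<otimes> y) = e i j x + e i j y + (\<Sum>r\<in>{Suc i..<j}. e i r x * e r j y)"
    if xy: "x \<in> carrier G" "y \<in> carrier G" and ij: "i < j" "j \<le> n" for i j x y
  proof -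
    have "(\<Sum>r\<in>{Suc i..<j}. e i r x * e r j y) = - massey_tilde c (Suc i) j (N #> x, N #> y)"
      using ij by (auto simp: massey_tilde_apply e_def intro!: sum.cong)
    moreover have "e i j x + e i j y - e i j (x \<otimes> y) = massey_tilde c (Suc i) j (N #> x, N #> y)"
    proof (cases "i = 0 \<and> j = n")
      case True
      then show ?thesis
        using h(2)[OF xy] by (simp add: e_def)
    next
      case False
      have "coboundary ?Q (c (Suc i) j) (N #> x, N #> y) = massey_tilde c (Suc i) j (N #> x, N #> y)"
        using c'(2)[OF ij False] by simp
      then show ?thesis
        using xy False by (auto simp: coboundary_def e_def carrier_FactGroup N.rcos_sum)
    qed
    ultimately show ?thesis
      by (simp add: algebra_simps)
  qed
  have "\<rho> \<in> unipotent_reps G T (Suc n)"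
  proof (rule unipotent_repI)
    show "\<rho> x \<in> carrier (unipotent_group (Suc n))" if "x \<in> carrier G" for x
      unfolding unipotent_group_carrier_iff by (simp add: \<rho>_def)
    show "\<rho> (x \<otimes> y) $$ (i, j) = (\<Sum>r\<in>{i..j}. \<rho> x $$ (i, r) * \<rho> y $$ (r, j))"
      if xy: "x \<in> carrier G" "y \<in> carrier G" and ij: "i \<le> j" "j < Suc n" for x y i j
    proof (cases "i = j")
      case True
      then show ?thesis
        using ij by (simp add: \<rho>_def)
    next
      case False
      then have "i < j"
        using ij by simp
      have "(\<Sum>r\<in>{Suc i..<j}. \<rho> x $$ (i, r) * \<rho> y $$ (r, j)) = (\<Sum>r\<in>{Suc i..<j}. e i r x * e r j y)"
        using ij by (intro sum.cong) (auto simp: \<rho>_def)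
      then have "(\<Sum>r\<in>{i..j}. \<rho> x $$ (i, r) * \<rho> y $$ (r, j)) =
          e i j y + (\<Sum>r\<in>{Suc i..<j}. e i r x * e r j y) + e i j x"
        using ij \<open>i < j\<close> by (simp add: sum_atLeastAtMost_ends \<rho>_def)
      moreover have "\<rho> (x \<otimes> y) $$ (i, j) = e i j (x \<otimes> y)"
        using ij \<open>i < j\<close> by (simp add: \<rho>_def)
      ultimately show ?thesis
        using e[OF xy \<open>i < j\<close>] ij by (simp add: algebra_simps)
    qed
    show "cont (\<lambda>x. \<rho> x $$ (i, j))" if ij: "i \<le> j" "j < Suc n" for i j
    proof (cases "i = j")
      case False
      then have "i < j" "j \<le> n"
        using ij by simp_all
      then have "cont (e i j)"
        using h(1) cont_comp_coset[OF c'(1)[OF \<open>i < j\<close> \<open>j \<le> n\<close>]]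
        by (cases "i = 0 \<and> j = n") (simp_all add: e_def[abs_def])
      then show ?thesis
        using False ij by (simp add: \<rho>_def)
    qed (use ij in \<open>simp add: \<rho>_def\<close>)
  qed
  moreover have "\<rho> x $$ (0, n) = h x" for x
    using n by (simp add: \<rho>_def e_def)
  ultimately show ?thesis
    by blast
qed

end

context free_presentation
begin

lemma descend:
  fixes f :: "'s \<Rightarrow> 'c::zero"
  assumes "S.cont f" and inv: "\<And>x s. x \<in> N \<Longrightarrow> s \<in> carrier S \<Longrightarrow> f (x \<otimes>\<^bsub>S\<^esub> s) = f s"
  shows "\<exists>h. G.cont h \<and> (\<forall>s\<in>carrier S. h (\<pi> s) = f s) \<and> (\<forall>x. x \<notin> carrier G \<longrightarrow> h x = 0)"
proof -
  have "f s = f t" if st: "s \<in> topspace TS" "t \<in> topspace TS" "\<pi> s = \<pi> t" for s t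
  proof -
    obtain x where "x \<in> N" "s = x \<otimes>\<^bsub>S\<^esub> t"
      using pi_eqD[of s t] st by auto
    then show ?thesis
      using inv st by simp
  qed
  from quotient_map_factor_discrete[OF pi_quotient assms(1) this] show ?thesis
    unfolding S.topspace_carrier G.topspace_carrier .
qed

lemma rep_descend:
  fixes \<rho> :: "'s \<Rightarrow> 'p::prime_card mod_ring mat"
  assumes \<rho>: "\<rho> \<in> unipotent_reps S TS k" and trivial: "\<And>x. x \<in> N \<Longrightarrow> \<rho> x = 1\<^sub>m k"
  shows "\<exists>\<rho>' \<in> unipotent_reps G TG k. \<forall>s\<in>carrier S. \<rho>' (\<pi> s) = \<rho> s"
proof -
  note \<rho>D = S.unipotent_repD[OF \<rho>]
  define \<rho>' where "\<rho>' g = \<rho> (inv_into (carrier S) \<pi> g)" for g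
  have \<rho>': "\<rho>' (\<pi> s) = \<rho> s" if s: "s \<in> carrier S" for s
  proof -
    let ?t = "inv_into (carrier S) \<pi> (\<pi> s)"
    have t: "?t \<in> carrier S" "\<pi> ?t = \<pi> s"
      using s by (auto intro: inv_into_into f_inv_into_f)
    then obtain x where x: "x \<in> N" "?t = x \<otimes>\<^bsub>S\<^esub> s"
      using pi_eqD[OF t(1) s t(2)] by blast
    have "\<rho> ?t = 1\<^sub>m k * \<rho> s"
      unfolding x(2) using x(1) s S.normal_carrierD[OF normal_N] by (simp add: \<rho>D(2) trivial)
    also have "\<dots> = \<rho> s"
      using \<rho>D(1)[OF s] by (intro left_mult_one_mat[of _ k k]) (simp add: unipotent_group_carrier_iff)
    finally show ?thesis
      by (simp add: \<rho>'_def)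
  qed
  have "\<rho>' \<in> unipotent_reps G TG k"
  proof (rule G.unipotent_repI)
    fix x assume "x \<in> carrier G"
    then obtain s where "s \<in> carrier S" "x = \<pi> s"
      using pi_surj by auto
    then show "\<rho>' x \<in> carrier (unipotent_group k)"
      using \<rho>D(1) by (simp add: \<rho>')
  next
    fix x y i j assume "x \<in> carrier G" "y \<in> carrier G" and ij: "i \<le> j" "j < k"
    then obtain s t where st: "s \<in> carrier S" "x = \<pi> s" "t \<in> carrier S" "y = \<pi> t"
      using pi_surj by (metis imageE)
    then have "\<rho>' (x \<otimes>\<^bsub>G\<^esub> y) = \<rho>' (\<pi> (s \<otimes>\<^bsub>S\<^esub> t))"
      by simp
    also have "\<dots> = \<rho> s * \<rho> t"
      using st by (simp add: \<rho>' \<rho>D(2) del: pi.hom_mult)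
    finally show "\<rho>' (x \<otimes>\<^bsub>G\<^esub> y) $$ (i, j) = (\<Sum>r\<in>{i..j}. \<rho>' x $$ (i, r) * \<rho>' y $$ (r, j))"
      using unipotent_mult_entry_le[OF \<rho>D(1)[OF st(1)] \<rho>D(1)[OF st(3)] ij] st by (simp add: \<rho>')
  next
    fix i j
    have "S.cont ((\<lambda>x. \<rho>' x $$ (i, j)) \<circ> \<pi>)"
      by (rule continuous_map_eq[OF S.cont_unipotent_entry[OF \<rho>, of "(i, j)"]]) (simp add: \<rho>')
    then show "G.cont (\<lambda>x. \<rho>' x $$ (i, j))"
      by (rule continuous_compose_quotient_map[OF pi_quotient])
  qed
  then show ?thesis
    using \<rho>' by blast
qed

text \<open>Representations of \<open>S\<close> of size \<open>n\<close> kill \<open>S.Z n\<close>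
  and hence \<open>N\<close>, so they come from \<open>G\<close>; bordering them by zeros gives size
  \<open>Suc n\<close>, where the hypothesis applies.\<close>

lemma zassenhaus_if_killed:
  assumes n: "n \<ge> 1" and N: "N \<subseteq> S.Z CARD('p::prime_card) n" and s: "s \<in> carrier S"
    and killed: "\<And>\<rho> :: 'a \<Rightarrow> 'p mod_ring mat. \<rho> \<in> unipotent_reps G TG (Suc n) \<Longrightarrow> \<rho> (\<pi> s) = 1\<^sub>m (Suc n)"
  shows "s \<in> S.Z CARD('p) n"
proof (rule S.unipotent_kernel_subset_zassenhaus[OF n s])
  fix \<rho> :: "'s \<Rightarrow> 'p mod_ring mat" assume \<rho>: "\<rho> \<in> unipotent_reps S TS n"
  then obtain \<rho>' where \<rho>': "\<rho>' \<in> unipotent_reps G TG n" "\<forall>s\<in>carrier S. \<rho>' (\<pi> s) = \<rho> s"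
    using rep_descend S.zassenhaus_subset_kernel N by blast
  have one: "bordered_mat n (\<lambda>_. 0) (\<rho> s) = 1\<^sub>m (Suc n)"
    using killed[OF G.bordered_rep[OF \<rho>'(1)]] \<rho>'(2) s by simp
  have \<rho>s: "\<rho> s \<in> carrier_mat n n"
    using S.unipotent_repD(1)[OF \<rho> s] by (simp add: unipotent_group_carrier_iff)
  show "\<rho> s = 1\<^sub>m n"
  proof (rule eq_matI)
    fix i j assume ij: "i < dim_row (1\<^sub>m n :: 'p mod_ring mat)" "j < dim_col (1\<^sub>m n :: 'p mod_ring mat)"
    then have "\<rho> s $$ (i, j) = bordered_mat n (\<lambda>_. 0) (\<rho> s) $$ (Suc i, Suc j)"
      by simp
    also have "\<dots> = 1\<^sub>m n $$ (i, j)"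
      unfolding one using ij by simp
    finally show "\<rho> s $$ (i, j) = 1\<^sub>m n $$ (i, j)" .
  qed (use \<rho>s in auto)
qed

lemma quotient_map_coset_pi:
  "quotient_map TS (quotient_topology G TG M) (\<lambda>s. M #>\<^bsub>G\<^esub> \<pi> s)"
  using quotient_map_compose[OF pi_quotient G.quotient_map_coset[of M]] by (simp add: o_def)

lemma coset_pi_hom:
  assumes "M \<lhd> G"
  shows "(\<lambda>s. M #>\<^bsub>G\<^esub> \<pi> s) \<in> hom S (G Mod M)"
  using hom_compose[OF pi_hom normal.r_coset_hom_Mod[OF assms]] by (simp add: o_def)

lemma coset_pi_surj: "(\<lambda>s. M #>\<^bsub>G\<^esub> \<pi> s) ` carrier S = carrier (G Mod M)"
  unfolding carrier_FactGroup pi_surj[symmetric] by (simp add: image_image)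

text \<open>The kernel of the map from \<open>S\<close> to \<open>G/G_n\<close> is
  \<open>S_n\<close>, because \<open>N\<close> lies in \<open>S_n\<close> and \<open>\<pi>\<close>
  maps \<open>S_n\<close> onto \<open>G_n\<close>.\<close>

lemma coset_pi_eqD:
  assumes N: "N \<subseteq> S.Z p n" and st: "s \<in> carrier S" "t \<in> carrier S"
    and eq: "G.Z p n #>\<^bsub>G\<^esub> \<pi> s = G.Z p n #>\<^bsub>G\<^esub> \<pi> t"
  shows "\<exists>x\<in>S.Z p n. s = x \<otimes>\<^bsub>S\<^esub> t"
proof -
  interpret Z: normal "S.Z p n" S
    by (rule S.normal_zassenhaus)
  obtain m where "m \<in> G.Z p n" "\<pi> s = m \<otimes>\<^bsub>G\<^esub> \<pi> t"
    using eq st G.coset_eq_iff[OF normal_imp_subgroup[OF G.normal_zassenhaus]] by (metis pi.hom_closed)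
  moreover from this have "m \<in> \<pi> ` S.Z p n"
    by (simp add: image_zassenhaus)
  ultimately obtain x where x: "x \<in> S.Z p n" "\<pi> s = \<pi> x \<otimes>\<^bsub>G\<^esub> \<pi> t"
    by blast
  have xS: "x \<in> carrier S"
    using x by auto
  then have "\<pi> s = \<pi> (x \<otimes>\<^bsub>S\<^esub> t)"
    using x st by simp
  then obtain y where y: "y \<in> N" "s = y \<otimes>\<^bsub>S\<^esub> (x \<otimes>\<^bsub>S\<^esub> t)"
    using pi_eqD[of s "x \<otimes>\<^bsub>S\<^esub> t"] xS st by auto
  then have "y \<in> S.Z p n"
    using N by blast
  then have "y \<otimes>\<^bsub>S\<^esub> x \<in> S.Z p n" "s = (y \<otimes>\<^bsub>S\<^esub> x) \<otimes>\<^bsub>S\<^esub> t"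
    using x y st xS by (auto simp: S.m_assoc)
  then show ?thesis
    by blast
qed

lemma descend_quotient:
  fixes f :: "'s \<Rightarrow> 'p::prime_card mod_ring"
  assumes N: "N \<subseteq> S.Z p n" and "S.cont f"
    and inv: "\<And>x s. x \<in> S.Z p n \<Longrightarrow> s \<in> carrier S \<Longrightarrow> f (x \<otimes>\<^bsub>S\<^esub> s) = f s"
  shows "\<exists>c \<in> cochains1 (G Mod G.Z p n) (quotient_topology G TG (G.Z p n)).
    \<forall>s\<in>carrier S. c (G.Z p n #>\<^bsub>G\<^esub> \<pi> s) = f s"
proof -
  have "f s = f t" if st: "s \<in> topspace TS" "t \<in> topspace TS"
    "G.Z p n #>\<^bsub>G\<^esub> \<pi> s = G.Z p n #>\<^bsub>G\<^esub> \<pi> t" for s t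
  proof -
    obtain x where "x \<in> S.Z p n" "s = x \<otimes>\<^bsub>S\<^esub> t"
      using coset_pi_eqD[OF N, of s t] st by auto
    then show ?thesis
      using inv st by simp
  qed
  from quotient_map_factor_discrete[OF quotient_map_coset_pi assms(2) this]
  obtain c where "continuous_map (quotient_topology G TG (G.Z p n)) (discrete_topology UNIV) c"
    "\<forall>s\<in>carrier S. c (G.Z p n #>\<^bsub>G\<^esub> \<pi> s) = f s" "\<forall>x. x \<notin> carrier (G Mod G.Z p n) \<longrightarrow> c x = 0"
    unfolding G.topspace_quotient_topology S.topspace_carrier by blast
  then show ?thesis
    by (intro bexI[of _ c]) (simp_all add: cochains1_def)
qed

text \<open>
  The transgression of a coefficient homomorphism: it is a sum of Massey products because the
  entries of a representation modulo the upper right corner form a defining system. Matrix indices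
  start at 0, so \<open>c i j\<close> corresponds to the entry \<open>(i - 1, j)\<close>.
\<close>

lemma rep_span_transgression:
  fixes f :: "'s \<Rightarrow> 'p::prime_card mod_ring"
  assumes n: "n \<ge> 1" and N: "N \<subseteq> S.Z CARD('p) n" and f: "f \<in> rep_span S TS (Suc n) {n}"
  defines "M \<equiv> G.Z CARD('p) n"
  defines "Q \<equiv> G Mod M" and "U \<equiv> quotient_topology G TG M"
  shows "\<exists>\<alpha>\<in>cocycles2 Q U. H2_class Q U \<alpha> \<in> H2_Massey Q U n \<and>
    (\<forall>s\<in>carrier S. \<forall>t\<in>carrier S.
      \<alpha> (M #>\<^bsub>G\<^esub> \<pi> s, M #>\<^bsub>G\<^esub> \<pi> t) = f s + f t - f (s \<otimes>\<^bsub>S\<^esub> t))"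
proof -
  have M: "M \<lhd> G"
    unfolding M_def by (rule G.normal_zassenhaus)
  interpret Q: topological_group Q U
    unfolding Q_def U_def by (rule G.topological_group_quotient[OF M])
  let ?q = "\<lambda>s. M #>\<^bsub>G\<^esub> \<pi> s"
  have q_hom: "?q \<in> hom S Q" and q_surj: "?q ` carrier S = carrier Q"
    unfolding Q_def by (rule coset_pi_hom[OF M], rule coset_pi_surj)
  have q_mult: "?q (s \<otimes>\<^bsub>S\<^esub> t) = ?q s \<otimes>\<^bsub>Q\<^esub> ?q t" if "s \<in> carrier S" "t \<in> carrier S" for s t
    using q_hom that unfolding hom_def by blast
  define P where "P f \<longleftrightarrow> (\<exists>\<alpha>\<in>cocycles2 Q U. H2_class Q U \<alpha> \<in> H2_Massey Q U n \<and>
    (\<forall>s\<in>carrier S. \<forall>t\<in>carrier S. \<alpha> (?q s, ?q t) = f s + f t - f (s \<otimes>\<^bsub>S\<^esub> t)))"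
    for f :: "'s \<Rightarrow> 'p mod_ring"
  have P_zero: "P (\<lambda>_. 0)"
    unfolding P_def H2_Massey_def
  proof (intro bexI conjI ballI)
    have "\<one>\<^bsub>H2 Q U\<^esub> \<in> generate (H2 Q U) (massey_products Q U n :: ('a set \<times> 'a set \<Rightarrow> 'p mod_ring) set set)"
      by (rule generate.one)
    then show "H2_class Q U (\<lambda>_. 0) \<in>
        generate (H2 Q U) (massey_products Q U n :: ('a set \<times> 'a set \<Rightarrow> 'p mod_ring) set set)"
      by (simp only: Q.H2_class_zero Q.one_H2)
  qed (simp_all add: Q.cocycles2_zero)
  have P_add: "P (\<lambda>x. f x + g x)" if Pfg: "P f" "P g" for f g
  proof -
    obtain \<alpha> \<beta> where \<alpha>: "\<alpha> \<in> cocycles2 Q U" "H2_class Q U \<alpha> \<in> H2_Massey Q U n"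
        "\<forall>s\<in>carrier S. \<forall>t\<in>carrier S. \<alpha> (?q s, ?q t) = f s + f t - f (s \<otimes>\<^bsub>S\<^esub> t)"
      and \<beta>: "\<beta> \<in> cocycles2 Q U" "H2_class Q U \<beta> \<in> H2_Massey Q U n"
        "\<forall>s\<in>carrier S. \<forall>t\<in>carrier S. \<beta> (?q s, ?q t) = g s + g t - g (s \<otimes>\<^bsub>S\<^esub> t)"
      using Pfg unfolding P_def by blast
    have "H2_class Q U (\<lambda>x. \<alpha> x + \<beta> x) \<in> H2_Massey Q U n"
      unfolding Q.H2_class_add[OF \<alpha>(1) \<beta>(1)] H2_Massey_def
      by (rule generate.eng) (use \<alpha>(2) \<beta>(2) in \<open>simp_all add: H2_Massey_def\<close>)
    moreover have "(\<lambda>x. \<alpha> x + \<beta> x) \<in> cocycles2 Q U"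
      by (rule Q.cocycles2_add[OF \<alpha>(1) \<beta>(1)])
    ultimately show ?thesis
      unfolding P_def using \<alpha>(3) \<beta>(3) by (intro bexI[of _ "\<lambda>x. \<alpha> x + \<beta> x"]) auto
  qed
  have P_entry: "P (\<lambda>x. \<rho> x $$ (0, n))" if \<rho>: "\<rho> \<in> unipotent_reps S TS (Suc n)" for \<rho>
  proof -
    note \<rho>D = S.unipotent_repD[OF \<rho>]
    have "\<exists>c\<in>cochains1 Q U. \<forall>s\<in>carrier S. c (?q s) = \<rho> s $$ (i - 1, j)"
      if ij: "1 \<le> i" "i \<le> j" "j \<le> n" "(i, j) \<noteq> (1, n)" for i j
    proof -
      \<comment> \<open>The corner is the only entry of degree \<open>n\<close>. The others have
        smaller degree, so they are invariant under \<open>S_n\<close> and descend to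
        \<open>G/G_n\<close>.\<close>
      have "S.dd n (\<lambda>s. \<rho> s $$ (i - 1, j))"
      proof (rule S.dd_mono[OF S.dd_unipotent_entry[OF \<rho>]])
        show "Suc (j - (i - 1)) \<le> n"
          using ij by auto
      qed (use ij in auto)
      then have "\<rho> (x \<otimes>\<^bsub>S\<^esub> s) $$ (i - 1, j) = \<rho> s $$ (i - 1, j)"
        if "x \<in> S.Z CARD('p) n" "s \<in> carrier S" for x s
        using S.zassenhaus_left_invariant[OF that(1) S.cont_unipotent_entry[OF \<rho>] _ that(2)] by blast
      then show ?thesis
        unfolding Q_def U_def M_def
        by (intro descend_quotient[OF N S.cont_unipotent_entry[OF \<rho>]])
    qed
    then obtain c where c: "\<And>i j. 1 \<le> i \<Longrightarrow> i \<le> j \<Longrightarrow> j \<le> n \<Longrightarrow> (i, j) \<noteq> (1, n) \<Longrightarrow>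
        c i j \<in> cochains1 Q U \<and> (\<forall>s\<in>carrier S. c i j (?q s) = \<rho> s $$ (i - 1, j))"
      by metis
    have tilde: "massey_tilde c i j (?q s, ?q t) =
        \<rho> s $$ (i - 1, j) + \<rho> t $$ (i - 1, j) - \<rho> (s \<otimes>\<^bsub>S\<^esub> t) $$ (i - 1, j)"
      if ij: "1 \<le> i" "i \<le> j" "j \<le> n" and st: "s \<in> carrier S" "t \<in> carrier S" for i j s t
    proof -
      have "\<rho> (s \<otimes>\<^bsub>S\<^esub> t) $$ (i - 1, j) = (\<Sum>r\<in>{i - 1..j}. \<rho> s $$ (i - 1, r) * \<rho> t $$ (r, j))"
        unfolding \<rho>D(2)[OF st]
        by (rule unipotent_mult_entry_le[OF \<rho>D(1)[OF st(1)] \<rho>D(1)[OF st(2)]]) (use ij in auto)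
      also have "\<dots> = \<rho> s $$ (i - 1, i - 1) * \<rho> t $$ (i - 1, j) +
          (\<Sum>r\<in>{i..<j}. \<rho> s $$ (i - 1, r) * \<rho> t $$ (r, j)) + \<rho> s $$ (i - 1, j) * \<rho> t $$ (j, j)"
        using ij by (subst sum_atLeastAtMost_ends) auto
      also have "\<rho> s $$ (i - 1, i - 1) = 1"
        using \<rho>D(1)[OF st(1)] ij by (simp add: unipotent_group_carrier_iff)
      also have "\<rho> t $$ (j, j) = 1"
        using \<rho>D(1)[OF st(2)] ij by (simp add: unipotent_group_carrier_iff)
      also have "(\<Sum>r\<in>{i..<j}. \<rho> s $$ (i - 1, r) * \<rho> t $$ (r, j)) = - massey_tilde c i j (?q s, ?q t)"
        unfolding massey_tilde_apply using ij st c by (auto intro!: sum.cong)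
      finally show ?thesis
        by (simp add: algebra_simps)
    qed
    have cochain: "massey_tilde c i j \<in> cochains2 Q U" if "1 \<le> i" "i \<le> j" "j \<le> n" for i j
      using that c by (intro Q.massey_tilde_cochain) auto
    have "defining_system Q U n c"
      unfolding defining_system_def
    proof (intro allI impI conjI; elim conjE)
      fix i j assume ij: "1 \<le> i" "i \<le> j" "j \<le> n" "(i, j) \<noteq> (1, n)"
      note cij = c[OF ij]
      show "c i j \<in> cochains1 Q U"
        using cij by blast
      show "coboundary Q (c i j) = massey_tilde c i j"
      proof
        fix x :: "'a set \<times> 'a set"
        show "coboundary Q (c i j) x = massey_tilde c i j x"
        proof (cases "x \<in> carrier Q \<times> carrier Q")
          case True
          then obtain s t where st: "s \<in> carrier S" "t \<in> carrier S" "x = (?q s, ?q t)"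
            unfolding q_surj[symmetric] by blast
          have "?q s \<in> carrier Q" "?q t \<in> carrier Q"
            using st(1,2) q_surj by blast+
          then have "coboundary Q (c i j) x = c i j (?q s) + c i j (?q t) - c i j (?q (s \<otimes>\<^bsub>S\<^esub> t))"
            unfolding st(3) using q_mult[OF st(1,2)] by (simp add: coboundary_def)
          also have "\<dots> = massey_tilde c i j x"
          proof -
            have "c i j (?q u) = \<rho> u $$ (i - 1, j)" if "u \<in> carrier S" for u
              using cij that by blast
            note this[OF st(1)] this[OF st(2)] this[OF S.m_closed[OF st(1,2)]]
            then show ?thesis
              unfolding st(3) tilde[OF ij(1-3) st(1,2)] by (simp only:)
          qed
          finally show ?thesis .
        next
          case False
          then show ?thesis
            using cochain[OF ij(1-3)] by (cases x) (auto simp: coboundary_def cochains2_def)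
        qed
      qed
    qed
    then have "H2_class Q U (massey_tilde c 1 n) \<in> massey_products Q U n"
      by (auto simp: massey_products_def)
    then have "H2_class Q U (massey_tilde c 1 n) \<in> H2_Massey Q U n"
      unfolding H2_Massey_def by (rule generate.incl)
    moreover have pull: "massey_tilde c 1 n (?q s, ?q t) = \<rho> s $$ (0, n) + \<rho> t $$ (0, n) - \<rho> (s \<otimes>\<^bsub>S\<^esub> t) $$ (0, n)"
      if "s \<in> carrier S" "t \<in> carrier S" for s t
      using tilde[of 1 n s t] n that by simp
    \<comment> \<open>Pulled back to \<open>S\<close>, the Massey cochain is the coboundary of the
      corner entry.\<close>
    moreover have "massey_tilde c 1 n \<in> cocycles2 Q U"
      by (rule Q.cocycle_if_pullback_coboundary[OF S.is_group q_hom q_surj cochain pull]) (use n in simp_all)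
    ultimately show ?thesis
      unfolding P_def by blast
  qed
  have "P f"
    using f
  proof induction
    case (scale f c)
    show ?case
      using P_zero P_add[OF scale.IH] by (rule mod_ring_scale_closed)
  qed (use P_zero P_add P_entry in auto)
  then show ?thesis
    by (simp add: P_def)
qed

text \<open>The function descends to \<open>h\<close> on \<open>G\<close>, and its transgression
  \<open>\<alpha>\<close> dies in \<open>G\<close>. By the kernel condition \<open>\<alpha>\<close>
  is cohomologous to a sum of Massey cocycles that are trivialised by corners of representations of
  \<open>G\<close>, and these vanish at \<open>\<pi> s0\<close>. Comparing the two trivialisations
  shows that \<open>h\<close> vanishes there as well.\<close>

lemma corner_vanishes:
  fixes f :: "'s \<Rightarrow> 'p::prime_card mod_ring"
  assumes n: "n \<ge> 1" and N: "N \<subseteq> S.Z CARD('p) n"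
    and massey: "n \<ge> 2 \<longrightarrow> massey_kernel_condition TYPE('p) G TG n"
    and f: "f \<in> rep_span S TS (Suc n) {n}" "\<And>x. x \<in> N \<Longrightarrow> f x = 0"
    and s0: "s0 \<in> S.Z CARD('p) n"
    and killed: "\<And>\<rho> :: 'a \<Rightarrow> 'p mod_ring mat. \<rho> \<in> unipotent_reps G TG (Suc n) \<Longrightarrow> \<rho> (\<pi> s0) = 1\<^sub>m (Suc n)"
  shows "f s0 = 0"
proof -
  define M where "M = G.Z CARD('p) n"
  define Q where "Q = G Mod M"
  define U where "U = quotient_topology G TG M"
  let ?q = "\<lambda>s. M #>\<^bsub>G\<^esub> \<pi> s"
  have M: "M \<lhd> G"
    unfolding M_def by (rule G.normal_zassenhaus)
  interpret Q: topological_group Q U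
    unfolding Q_def U_def by (rule G.topological_group_quotient[OF M])
  interpret M: normal M G
    by (rule M)
  have s0S: "s0 \<in> carrier S"
    using s0 S.zassenhaus_subset by blast
  have f_one: "f \<one>\<^bsub>S\<^esub> = 0"
    by (rule rep_span_corner[OF S.is_group S.topological_group_axioms f(1) n])
  have "f (x \<otimes>\<^bsub>S\<^esub> s) = f s" if "x \<in> N" "s \<in> carrier S" for x s
    using S.corner_additive[OF f(1) n, of x s] that N f(2) by auto
  then obtain h where h: "G.cont h" "\<And>s. s \<in> carrier S \<Longrightarrow> h (\<pi> s) = f s" "\<And>x. x \<notin> carrier G \<Longrightarrow> h x = 0"
    using descend[OF S.cont_rep_span[OF f(1)]] by blast
  have h1: "h \<in> cochains1 G TG"
    using h by (simp add: G.cochains1_iff)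
  \<comment> \<open>Any trivialisation of a Massey cocycle is the corner of a representation of
    \<open>G\<close> of size \<open>Suc n\<close>, and such representations kill
    \<open>\<pi> s0\<close>.\<close>
  have massey_killed: "h' (\<pi> s0) = 0 \<and> h' \<one>\<^bsub>G\<^esub> = 0"
    if c: "defining_system Q U n c" and h': "G.cont h'"
      "\<And>x y. x \<in> carrier G \<Longrightarrow> y \<in> carrier G \<Longrightarrow>
        h' x + h' y - h' (x \<otimes>\<^bsub>G\<^esub> y) = massey_tilde c 1 n (M #>\<^bsub>G\<^esub> x, M #>\<^bsub>G\<^esub> y)"
    for c and h' :: "'a \<Rightarrow> 'p mod_ring"
  proof -
    obtain \<rho> where \<rho>: "\<rho> \<in> unipotent_reps G TG (Suc n)" "\<forall>x\<in>carrier G. \<rho> x $$ (0, n) = h' x"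
      using G.defining_system_rep[OF M n c[unfolded Q_def U_def] h'] by blast
    then have "h' (\<pi> s0) = 1\<^sub>m (Suc n) $$ (0, n)" "h' \<one>\<^bsub>G\<^esub> = 1\<^sub>m (Suc n) $$ (0, n)"
      using killed[OF \<rho>(1)] G.unipotent_repD(3)[OF \<rho>(1)] s0S by (metis pi.hom_closed, metis G.one_closed)
    then show ?thesis
      using n by simp
  qed
  show ?thesis
  proof (cases "n = 1")
    case True
    \<comment> \<open>For \<open>n = 1\<close> the function \<open>h\<close> is a homomorphism. The
      conditions on a defining system are void and its Massey cocycle is an empty sum, so
      \<open>h\<close> itself is a corner.\<close>
    have "h (\<pi> s0) = 0 \<and> h \<one>\<^bsub>G\<^esub> = 0"
    proof (rule massey_killed)
      show "defining_system Q U n (\<lambda>_ _ _. 0)"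
        using True by (auto simp: defining_system_def)
      fix x y assume "x \<in> carrier G" "y \<in> carrier G"
      then obtain s t where st: "s \<in> carrier S" "x = \<pi> s" "t \<in> carrier S" "y = \<pi> t"
        using pi_surj by (metis imageE)
      have "f (s \<otimes>\<^bsub>S\<^esub> t) = f s + f t"
        by (rule S.corner_additive[OF f(1) n _ st(3)]) (use st True S.zassenhaus_le_1 in simp)
      moreover have "h (x \<otimes>\<^bsub>G\<^esub> y) = f (s \<otimes>\<^bsub>S\<^esub> t)"
        using st h(2)[of "s \<otimes>\<^bsub>S\<^esub> t"] by simp
      ultimately show "h x + h y - h (x \<otimes>\<^bsub>G\<^esub> y) =
          massey_tilde (\<lambda>_ _ _. 0) 1 n (M #>\<^bsub>G\<^esub> x, M #>\<^bsub>G\<^esub> y)"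
        using st h(2) True by (simp add: massey_tilde_apply)
    qed (rule h(1))
    then show ?thesis
      using h(2)[OF s0S] by simp
  next
    case False
    then have n2: "n \<ge> 2"
      using n by simp
    obtain \<alpha> where \<alpha>: "\<alpha> \<in> cocycles2 Q U" "H2_class Q U \<alpha> \<in> H2_Massey Q U n"
      "\<forall>s\<in>carrier S. \<forall>t\<in>carrier S. \<alpha> (?q s, ?q t) = f s + f t - f (s \<otimes>\<^bsub>S\<^esub> t)"
      using rep_span_transgression[OF n N f(1), folded M_def, folded Q_def U_def] by blast
    have infl_\<alpha>: "inflate2 G M \<alpha> = coboundary G h"
    proof
      fix x :: "'a \<times> 'a"
      show "inflate2 G M \<alpha> x = coboundary G h x"
      proof (cases "x \<in> carrier G \<times> carrier G")
        case True
        then obtain s t where st: "s \<in> carrier S" "t \<in> carrier S" "x = (\<pi> s, \<pi> t)"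
          unfolding pi_surj[symmetric] by blast
        then have "h (\<pi> s \<otimes>\<^bsub>G\<^esub> \<pi> t) = f (s \<otimes>\<^bsub>S\<^esub> t)"
          using h(2)[of "s \<otimes>\<^bsub>S\<^esub> t"] by simp
        then show ?thesis
          using st \<alpha>(3) h(2) by (simp add: inflate2_def coboundary_def)
      qed (cases x, auto simp: inflate2_def coboundary_def)
    qed
    obtain A :: "('a set \<times> 'a set \<Rightarrow> 'p mod_ring) set set" where
      A: "A \<subseteq> massey_products Q U n"
        "kernel ((H2 Q U)\<lparr>carrier := H2_Massey Q U n\<rparr>) (H2 G TG) (inflation G TG M) = generate (H2 Q U) A"
      using massey n2 unfolding massey_kernel_condition_def Let_def M_def Q_def U_def by blast
    have "inflation G TG M (H2_class Q U \<alpha>) = coboundaries2 G TG"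
      unfolding Q_def U_def G.inflation_trivial_iff[OF M] using infl_\<alpha> h1 by blast
    then have gen: "H2_class Q U \<alpha> \<in> generate (H2 Q U) A"
      unfolding A(2)[symmetric] kernel_def using \<alpha>(2) by (simp add: G.one_H2)
    \<comment> \<open>Cocycles trivialised over \<open>G\<close> by a cochain vanishing at
      \<open>\<pi> s0\<close> and at 1. The property passes to sums and negatives, hence from
      \<open>A\<close> to representatives of the generated classes.\<close>
    define good where "good \<beta> \<longleftrightarrow> \<beta> \<in> cocycles2 Q U \<and>
        (\<exists>k\<in>cochains1 G TG. inflate2 G M \<beta> = coboundary G k \<and> k (\<pi> s0) = 0 \<and> k \<one>\<^bsub>G\<^esub> = 0)"
      for \<beta> :: "'a set \<times> 'a set \<Rightarrow> 'p mod_ring"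
    \<comment> \<open>An element of \<open>A\<close> lies in the kernel it helps to generate, so
      each Massey product in \<open>A\<close> becomes trivial in \<open>G\<close> on its
      own.\<close>
    have good_A: "\<exists>m. a = H2_class Q U m \<and> good m" if a: "a \<in> A" for a
    proof -
      obtain c where c: "defining_system Q U n c" "a = H2_class Q U (massey_tilde c 1 n)"
        using A(1) a by (auto simp: massey_products_def)
      let ?m = "massey_tilde c 1 n"
      have "a \<in> kernel ((H2 Q U)\<lparr>carrier := H2_Massey Q U n\<rparr>) (H2 G TG) (inflation G TG M)"
        unfolding A(2) using a by (rule generate.incl)
      then have "inflation G TG M (H2_class Q U ?m) = coboundaries2 G TG"
        unfolding kernel_def c(2) by (simp add: G.one_H2)
      then obtain k where k: "k \<in> cochains1 G TG" "inflate2 G M ?m = coboundary G k"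
        unfolding Q_def U_def G.inflation_trivial_iff[OF M] by blast
      have k_eq: "k x + k y - k (x \<otimes>\<^bsub>G\<^esub> y) = ?m (M #>\<^bsub>G\<^esub> x, M #>\<^bsub>G\<^esub> y)"
        if "x \<in> carrier G" "y \<in> carrier G" for x y
        using fun_cong[OF k(2), of "(x, y)"] that by (simp add: inflate2_def coboundary_def)
      have "k (\<pi> s0) = 0 \<and> k \<one>\<^bsub>G\<^esub> = 0"
        by (rule massey_killed[OF c(1) _ k_eq]) (use k(1) in \<open>simp_all add: G.cochains1_iff\<close>)
      moreover have "?m \<in> cocycles2 Q U"
      proof (rule Q.cocycle_if_pullback_coboundary[OF G.is_group])
        show "(\<lambda>x. M #>\<^bsub>G\<^esub> x) \<in> hom G Q"
          unfolding Q_def by (rule M.r_coset_hom_Mod)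
        show "(\<lambda>x. M #>\<^bsub>G\<^esub> x) ` carrier G = carrier Q"
          by (simp add: Q_def carrier_FactGroup)
        show "?m \<in> cochains2 Q U"
          using c(1) by (intro Q.massey_tilde_cochain) (auto simp: defining_system_def)
        show "?m (M #>\<^bsub>G\<^esub> x, M #>\<^bsub>G\<^esub> y) = k x + k y - k (x \<otimes>\<^bsub>G\<^esub> y)"
          if "x \<in> carrier G" "y \<in> carrier G" for x y
          using k_eq[OF that] by simp
      qed
      ultimately show ?thesis
        using c(2) k unfolding good_def by blast
    qed
    have "\<exists>\<beta>\<in>z. good \<beta>" if "z \<in> generate (H2 Q U) A" for z
      using that
    proof induction
      case one
      have "good (\<lambda>_. 0)"
        unfolding good_def
        by (intro conjI bexI[of _ "\<lambda>_. 0"])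
          (simp_all add: Q.cocycles2_zero G.cochains1_zero G.coboundary_zero inflate2_def fun_eq_iff)
      moreover have "(\<lambda>_. 0) \<in> (one (H2 Q U) :: ('a set \<times> 'a set \<Rightarrow> 'p mod_ring) set)"
        unfolding Q.one_H2 by (rule Q.coboundaries2_zero)
      ultimately show ?case
        by blast
    next
      case (incl a)
      then show ?case
        using good_A Q.H2_class_self by blast
    next
      case (inv a)
      then obtain m where m: "a = H2_class Q U m" "good m"
        using good_A by blast
      then obtain k where k: "m \<in> cocycles2 Q U" "k \<in> cochains1 G TG" "inflate2 G M m = coboundary G k"
        "k (\<pi> s0) = 0" "k \<one>\<^bsub>G\<^esub> = 0"
        unfolding good_def by blast
      have "good (\<lambda>x. - m x)"
        unfolding good_def
        by (intro conjI bexI[of _ "\<lambda>x. - k x"])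
          (use k in \<open>simp_all add: Q.cocycles2_uminus G.cochains1_uminus G.coboundary_uminus G.inflate2_uminus\<close>)
      then show ?case
        using Q.H2_inv_mem[OF k(1)] m(1) by blast
    next
      case (eng z1 z2)
      then obtain m1 m2 where m: "m1 \<in> z1" "good m1" "m2 \<in> z2" "good m2"
        by blast
      then obtain k1 k2 where k: "m1 \<in> cocycles2 Q U" "k1 \<in> cochains1 G TG" "inflate2 G M m1 = coboundary G k1"
        "k1 (\<pi> s0) = 0" "k1 \<one>\<^bsub>G\<^esub> = 0"
        "m2 \<in> cocycles2 Q U" "k2 \<in> cochains1 G TG" "inflate2 G M m2 = coboundary G k2"
        "k2 (\<pi> s0) = 0" "k2 \<one>\<^bsub>G\<^esub> = 0"
        unfolding good_def by blast
      have "good (\<lambda>x. m1 x + m2 x)"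
        unfolding good_def
        by (intro conjI bexI[of _ "\<lambda>x. k1 x + k2 x"])
          (use k in \<open>simp_all add: Q.cocycles2_add G.cochains1_add G.coboundary_add G.inflate2_add\<close>)
      then show ?case
        using Q.H2_mult_mem[OF m(1,3)] by blast
    qed
    then obtain \<beta> where \<beta>: "\<beta> \<in> H2_class Q U \<alpha>" "good \<beta>"
      using gen by blast
    then obtain k where k: "k \<in> cochains1 G TG" "inflate2 G M \<beta> = coboundary G k" "k (\<pi> s0) = 0" "k \<one>\<^bsub>G\<^esub> = 0"
      unfolding good_def by blast
    obtain b where b: "b \<in> cochains1 Q U" "\<beta> = (\<lambda>x. coboundary Q b x + \<alpha> x)"
      using \<beta>(1) by (auto simp: Q.H2_class_iff)
    \<comment> \<open>Both cochains compared here trivialise the inflation of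
      \<open>\<beta>\<close>, so their difference is a homomorphism to the prime field.\<close>
    define d where "d = (\<lambda>x. k x - (inflate1 G M b x + h x))"
    have d_add: "d (x \<otimes>\<^bsub>G\<^esub> y) = d x + d y" if xy: "x \<in> carrier G" "y \<in> carrier G" for x y
    proof -
      have "coboundary G k = (\<lambda>x. coboundary G (inflate1 G M b) x + coboundary G h x)"
        unfolding k(2)[symmetric] b(2) G.inflate2_add infl_\<alpha> G.coboundary_inflate1[OF M] Q_def ..
      from fun_cong[OF this, of "(x, y)"] show ?thesis
        using xy by (simp add: coboundary_def d_def algebra_simps)
    qed
    have d_cont: "G.cont d"
    proof -
      have "inflate1 G M b \<in> cochains1 G TG"
        using G.inflate1_cochain b(1) unfolding Q_def U_def by blast
      then have "G.cont (\<lambda>x. inflate1 G M b x + h x)"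
        using h1 by (intro continuous_map_discrete_compose2[where h = "(+)"]) (simp_all add: G.cochains1_iff)
      then show ?thesis
        unfolding d_def using k(1)
        by (intro continuous_map_discrete_compose2[where h = "(-)"]) (simp_all add: G.cochains1_iff)
    qed
    \<comment> \<open>A homomorphism has constant differences. As \<open>n \<ge> 2\<close>, its
      degree is less than \<open>n\<close>, so it is invariant under \<open>G_n\<close>, which
      contains \<open>\<pi> s0\<close>.\<close>
    have "G.dd 2 d"
    proof -
      have "G.dd (Suc 0) (left_diff G y d)" if "y \<in> carrier G" for y
      proof (subst G.dd_cong[where f' = "\<lambda>_. d y"])
        show "left_diff G y d x = d y" if "x \<in> carrier G" for x
          using d_add[OF \<open>y \<in> carrier G\<close> that] by (simp add: left_diff_def)
        show "G.dd (Suc 0) (\<lambda>_. d y)"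
          by (rule G.dd_const) simp
      qed
      then show ?thesis
        by (simp add: numeral_2_eq_2 G.dd_Suc[of "Suc 0"])
    qed
    then have "G.dd n d"
      by (rule G.dd_mono) (use n2 in simp)
    moreover have s0M: "\<pi> s0 \<in> G.Z CARD('p) n"
      using s0 image_zassenhaus by blast
    ultimately have "d (\<pi> s0 \<otimes>\<^bsub>G\<^esub> \<one>\<^bsub>G\<^esub>) = d \<one>\<^bsub>G\<^esub>"
      using d_cont by (intro G.zassenhaus_left_invariant) auto
    \<comment> \<open>The inflated cochain \<open>b\<close> takes the same value at
      \<open>\<pi> s0\<close> and at 1, so it cancels when \<open>d\<close> is compared at these
      points.\<close>
    moreover have "M #>\<^bsub>G\<^esub> \<pi> s0 = M #>\<^bsub>G\<^esub> \<one>\<^bsub>G\<^esub>"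
      using s0M G.coset_join2[OF _ M.subgroup_axioms, of "\<pi> s0"] s0S M.subset by (simp add: M_def)
    moreover have "h \<one>\<^bsub>G\<^esub> = 0"
      using h(2)[of "\<one>\<^bsub>S\<^esub>"] f_one by simp
    ultimately have "h (\<pi> s0) = 0"
      using k(3,4) s0S by (simp add: d_def inflate1_def)
    then show ?thesis
      using h(2)[OF s0S] by simp
  qed
qed

text \<open>
  The coefficient homomorphisms separate the points of the \<open>n\<close>-th graded piece of the
  free group, so an element annihilated by all combinations that vanish on \<open>N\<close> is in the closure
  of the image of \<open>N\<close>.
\<close>

lemma zassenhaus_Suc_if_killed:
  assumes n: "n \<ge> 1" and N: "N \<subseteq> S.Z CARD('p::prime_card) n" "closedin TS N"
    and massey: "n \<ge> 2 \<longrightarrow> massey_kernel_condition TYPE('p) G TG n"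
    and s: "s \<in> carrier S"
    and killed: "\<And>\<rho> :: 'a \<Rightarrow> 'p mod_ring mat. \<rho> \<in> unipotent_reps G TG (Suc n) \<Longrightarrow> \<rho> (\<pi> s) = 1\<^sub>m (Suc n)"
  shows "s \<in> N <#>\<^bsub>S\<^esub> S.Z CARD('p) (Suc n)"
proof (rule ccontr)
  let ?Z = "S.Z CARD('p)"
  let ?F = "rep_span S TS (Suc n) {n} :: ('s \<Rightarrow> 'p mod_ring) set"
  assume contra: "s \<notin> N <#>\<^bsub>S\<^esub> ?Z (Suc n)"
  have sZ: "s \<in> ?Z n"
    by (rule zassenhaus_if_killed[OF n N(1) s]) (rule killed)
  have "S.closed_normal (N <#>\<^bsub>S\<^esub> ?Z (Suc n))"
    using normal_N N(2) S.closed_normal_zassenhaus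
    by (intro S.closed_normal_set_mult) (simp_all add: S.closed_normal_def)
  then obtain V where V: "V \<lhd> S" "openin TS V"
    "\<forall>a\<in>N <#>\<^bsub>S\<^esub> ?Z (Suc n). V #>\<^bsub>S\<^esub> s \<noteq> V #>\<^bsub>S\<^esub> a"
    using S.separate_closed_subgroup[OF _ _ s contra] by (auto simp: S.closed_normal_def dest: normal_imp_subgroup)
  interpret V: normal V S
    by fact
  \<comment> \<open>An open neighbourhood of the next term. Removing it leaves a compact set on
    which every point is detected by some corner function.\<close>
  let ?W = "\<Union>z\<in>?Z (Suc n). V #>\<^bsub>S\<^esub> z"
  have "openin TS ?W"
    using S.zassenhaus_subset by (intro openin_Union) (auto intro!: S.openin_r_coset V(2))
  then have "closedin TS (?Z n - ?W)"
    using S.closed_zassenhaus by (intro closedin_diff) auto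
  then have compact: "compactin TS (?Z n - ?W)"
    using S.compact by (rule closedin_compact_space[rotated])
  let ?\<U> = "(\<lambda>f. {x \<in> carrier S. f x = 0}) ` ?F"
  have closed: "\<forall>C\<in>?\<U>. closedin TS C"
    using closedin_discrete_preimage[OF S.cont_rep_span, of _ _ _ "{0}"] by auto
  have empty: "(?Z n - ?W) \<inter> \<Inter>?\<U> = {}"
  proof -
    \<comment> \<open>For \<open>x\<close> in \<open>S_n\<close> the non-corner entries already
      agree with the identity matrix by degree; vanishing of the corners puts \<open>x\<close> into
      the kernel of all representations of size \<open>Suc n\<close>.\<close>
    have in_W: "x \<in> ?W" if x: "x \<in> ?Z n" "\<And>f. f \<in> ?F \<Longrightarrow> f x = 0" for x
    proof -
      have xS: "x \<in> carrier S"
        using x S.zassenhaus_subset by blast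
      have "x \<in> ?Z (Suc n)"
      proof (rule S.unipotent_kernel_subset_zassenhaus)
        fix \<rho> :: "'s \<Rightarrow> 'p mod_ring mat" assume \<rho>: "\<rho> \<in> unipotent_reps S TS (Suc n)"
        note \<rho>D = S.unipotent_repD[OF \<rho>]
        have upper: "\<rho> x $$ (i, j) = 1\<^sub>m (Suc n) $$ (i, j)" if ij: "i \<le> j" "j < Suc n" for i j
        proof (cases "i = 0 \<and> j = n")
          case True
          have "(\<lambda>x. \<rho> x $$ (0, n)) \<in> ?F"
            using \<rho> by (rule rep_span.entry) simp
          then show ?thesis
            using x(2) True n by auto
        next
          case False
          have "S.dd n (\<lambda>x. \<rho> x $$ (i, j))"
            by (rule S.dd_mono[OF S.dd_unipotent_entry[OF \<rho> ij]]) (use ij False in auto)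
          from S.zassenhaus_left_invariant[OF x(1) S.cont_unipotent_entry[OF \<rho>] this S.one_closed]
          show ?thesis
            using xS \<rho>D(3) by simp
        qed
        show "\<rho> x = 1\<^sub>m (Suc n)"
        proof (rule eq_matI)
          fix i j assume "i < dim_row (1\<^sub>m (Suc n) :: 'p mod_ring mat)" "j < dim_col (1\<^sub>m (Suc n) :: 'p mod_ring mat)"
          then show "\<rho> x $$ (i, j) = 1\<^sub>m (Suc n) $$ (i, j)"
            using upper[of i j] \<rho>D(1)[OF xS] by (cases "i \<le> j") (auto simp: unipotent_group_carrier_iff)
        qed (use \<rho>D(1)[OF xS] in \<open>auto simp: unipotent_group_carrier_iff\<close>)
      qed (use xS in simp_all)
      then show ?thesis
        using S.rcos_self[OF xS V.subgroup_axioms] by blast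
    qed
    show ?thesis
    proof (rule equals0I)
      fix x assume "x \<in> (?Z n - ?W) \<inter> \<Inter>?\<U>"
      then have xZ: "x \<in> ?Z n - ?W" and xU: "x \<in> \<Inter>?\<U>"
        by (rule IntD1, rule IntD2)
      have "f x = 0" if "f \<in> ?F" for f
      proof -
        have "x \<in> {x \<in> carrier S. f x = 0}"
          using InterD[OF xU imageI[OF that]] .
        then show ?thesis
          by simp
      qed
      then have "x \<in> ?W"
        by (rule in_W[OF DiffD1[OF xZ]])
      then show False
        by (rule DiffD2[OF xZ])
    qed
  qed
  obtain \<F> where \<F>: "finite \<F>" "\<F> \<subseteq> ?\<U>" "(?Z n - ?W) \<inter> \<Inter>\<F> = {}"
    by (rule compactin_finite_Inter_empty[OF compact bspec[OF closed] empty])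
  obtain X where X: "X \<subseteq> ?F" "finite X" "\<F> = (\<lambda>f. {x \<in> carrier S. f x = 0}) ` X"
    using finite_subset_image[OF \<F>(1,2)] by (elim exE conjE)
  have ZS: "subgroup (?Z n) S"
    using S.normal_zassenhaus by (rule normal_imp_subgroup)
  interpret Zn: subgroup "?Z n" S
    by (rule ZS)
  have additive: "f (a \<otimes>\<^bsub>S\<^esub> b) = f a + f b" if "f \<in> ?F" "a \<in> ?Z n" "b \<in> ?Z n" for f a b
    by (rule S.corner_additive[OF that(1) n that(2)]) (use that(3) in simp)
  \<comment> \<open>\<open>corner_vanishes\<close> is the annihilator condition of the duality;
    compactness has reduced the functions to the finite set \<open>X\<close>.\<close>
  have "\<exists>x\<in>N. \<forall>f\<in>X. f x = f s"
  proof (rule S.simultaneous_values[OF ZS _ _ additive X(2,1) normal_imp_subgroup[OF normal_N] N(1) sZ])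
    show "f s = 0" if "f \<in> ?F" "\<forall>x\<in>N. f x = 0" for f
      by (rule corner_vanishes[OF n N(1) massey that(1) _ sZ]) (use that(2) killed in auto)
  qed (auto intro: rep_span.add rep_span.scale)
  then obtain x where x: "x \<in> N" "\<forall>f\<in>X. f x = f s"
    by blast
  have xZ: "x \<in> ?Z n"
    using x N by blast
  \<comment> \<open>All functions in \<open>X\<close> vanish at \<open>y\<close>, so
    \<open>y\<close> lies in \<open>?W\<close>. Thus \<open>s\<close> agrees modulo \<open>V\<close>
    with an element of the product, against the choice of \<open>V\<close>.\<close>
  define y where "y = inv\<^bsub>S\<^esub> x \<otimes>\<^bsub>S\<^esub> s"
  have y: "y \<in> ?Z n" "s = x \<otimes>\<^bsub>S\<^esub> y"
    using xZ sZ s by (auto simp: y_def)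
  have "f y = 0" if "f \<in> X" for f
  proof -
    have "f s = f x + f y"
      unfolding y(2) using that X(1) xZ y(1) by (intro additive) auto
    moreover have "f x = f s"
      using x(2) that by blast
    ultimately show ?thesis
      by simp
  qed
  then have "y \<in> \<Inter>\<F>"
    unfolding X(3) using y(1) by auto
  then have "y \<in> ?W"
    using \<F>(3) y(1) by blast
  then obtain z where z: "z \<in> ?Z (Suc n)" "y \<in> V #>\<^bsub>S\<^esub> z"
    by blast
  then have zS: "z \<in> carrier S"
    using S.zassenhaus_subset by blast
  have xS: "x \<in> carrier S"
    using xZ by auto
  have "V #>\<^bsub>S\<^esub> z = V #>\<^bsub>S\<^esub> y"
    by (rule S.repr_independence[OF z(2) zS V.subgroup_axioms])
  then have "V #>\<^bsub>S\<^esub> (x \<otimes>\<^bsub>S\<^esub> z) = V #>\<^bsub>S\<^esub> s"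
    unfolding y(2) using xS zS y(1) V.rcos_sum[of x z, symmetric] V.rcos_sum[of x y] by auto
  moreover have "x \<otimes>\<^bsub>S\<^esub> z \<in> N <#>\<^bsub>S\<^esub> ?Z (Suc n)"
    using x(1) z(1) by (auto simp: set_mult_def)
  ultimately show False
    using V(3) by metis
qed

end

text \<open>One inclusion is \<open>zassenhaus_subset_kernel\<close>. For the other, a preimage of
  the element in \<open>S\<close> is a product of an element of \<open>N\<close>, which
  \<open>\<pi>\<close> kills, and one of the next filtration term of \<open>S\<close>, which
  \<open>\<pi>\<close> maps into that of \<open>G\<close>.\<close>

theorem theoremA:
  fixes p n :: nat
    and G :: "('a, 'm) monoid_scheme" and TG :: "'a topology"
    and S :: "('s, 'k) monoid_scheme" and TS :: "'s topology" and N :: "'s set"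
  assumes "p = CARD('p::prime_card)"
    and "n \<ge> 1"
    and "profinite_group G TG"
    and "free_profinite_group S TS"
    and "N \<lhd> S" and "closedin TS N"
    and "topological_group_iso G TG (S Mod N) (quotient_topology S TS N)"
    and "N \<subseteq> zassenhaus p S TS n"
    and "n \<ge> 2 \<longrightarrow> massey_kernel_condition TYPE('p) G TG n"
  shows "zassenhaus p G TG (n + 1) =
    (\<Inter>\<rho> \<in> continuous_hom G TG (unipotent_group (n + 1) :: 'p mod_ring mat monoid)
        (discrete_topology (carrier (unipotent_group (n + 1)))).
      kernel G (unipotent_group (n + 1)) \<rho>)"
proof -
  interpret G: profinite_group G TG
    by fact
  obtain B where B: "free_profinite_on B S TS"
    using assms(4) by (auto simp: free_profinite_group_def)
  then have "profinite_group S TS"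
    by (simp add: free_profinite_on_def)
  then interpret S: free_profinite S TS B
    by (rule free_profinite.intro) (rule free_profinite_axioms.intro[OF B])
  interpret N: normal N S
    by fact
  obtain \<phi> where \<phi>: "\<phi> \<in> iso G (S Mod N)" "homeomorphic_map TG (quotient_topology S TS N) \<phi>"
    using assms(7) by (auto simp: topological_group_iso_def)
  \<comment> \<open>The given isomorphism starts at \<open>G\<close>, whereas the presentation needs
    a map from \<open>S\<close> onto \<open>G\<close>, hence the inverse.\<close>
  define \<psi> where "\<psi> = inv_into (carrier G) \<phi>"
  define \<pi> where "\<pi> = (\<lambda>s. \<psi> (N #>\<^bsub>S\<^esub> s))"
  have \<psi>_iso: "\<psi> \<in> iso (S Mod N) G"
    unfolding \<psi>_def by (rule G.iso_set_sym[OF \<phi>(1)])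
  have pi_hom: "\<pi> \<in> hom S G"
    using hom_compose[OF N.r_coset_hom_Mod, of \<psi> G] \<psi>_iso by (simp add: \<pi>_def iso_def o_def)
  have "homeomorphic_map (quotient_topology S TS N) TG \<psi>"
  proof -
    obtain \<psi>' where \<psi>': "homeomorphic_maps TG (quotient_topology S TS N) \<phi> \<psi>'"
      using \<phi>(2) homeomorphic_map_maps by blast
    have "\<psi> X = \<psi>' X" if "X \<in> topspace (quotient_topology S TS N)" for X
    proof -
      have X: "\<psi>' X \<in> carrier G" "\<phi> (\<psi>' X) = X"
        using \<psi>' that by (auto simp: homeomorphic_maps_def continuous_map_def)
      have "inj_on \<phi> (carrier G)"
        using \<phi>(1) by (simp add: iso_def bij_betw_def)
      then show ?thesis
        unfolding \<psi>_def using inv_into_f_f[of \<phi> "carrier G" "\<psi>' X"] X by simp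
    qed
    moreover have "homeomorphic_map (quotient_topology S TS N) TG \<psi>'"
      using \<psi>' homeomorphic_maps_map by blast
    ultimately show ?thesis
      using homeomorphic_map_eq by metis
  qed
  then have pi_quotient: "quotient_map TS TG \<pi>"
    using quotient_map_compose[OF S.quotient_map_coset[of N], of TG \<psi>]
    by (simp add: \<pi>_def o_def homeomorphic_map_def)
  have kernel_pi: "\<pi> s = \<one>\<^bsub>G\<^esub> \<longleftrightarrow> s \<in> N" if s: "s \<in> carrier S" for s
  proof -
    interpret Q: group "S Mod N"
      by (rule N.factorgroup_is_group)
    have "inj_on \<psi> (carrier (S Mod N))" "\<psi> \<one>\<^bsub>S Mod N\<^esub> = \<one>\<^bsub>G\<^esub>"
      using \<psi>_iso hom_one[OF _ Q.is_group G.is_group] by (auto simp: iso_def bij_betw_def)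
    moreover have "N #>\<^bsub>S\<^esub> s \<in> carrier (S Mod N)" "\<one>\<^bsub>S Mod N\<^esub> \<in> carrier (S Mod N)"
      using s Q.one_closed by (auto simp: carrier_FactGroup)
    ultimately have "\<pi> s = \<one>\<^bsub>G\<^esub> \<longleftrightarrow> N #>\<^bsub>S\<^esub> s = N"
      by (metis \<pi>_def inj_on_eq_iff one_FactGroup)
    also have "\<dots> \<longleftrightarrow> s \<in> N"
      using S.coset_join1[OF _ s N.subgroup_axioms] S.coset_join2[OF s N.subgroup_axioms] by blast
    finally show ?thesis .
  qed
  interpret free_presentation S TS B G TG \<pi> N
    by unfold_locales (fact pi_hom, fact pi_quotient, rule kernel_pi)
  show ?thesis
  proof (intro equalityI subsetI)
    fix g assume "g \<in> zassenhaus p G TG (n + 1)"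
    then show "g \<in> (\<Inter>\<rho> \<in> unipotent_reps G TG (n + 1) :: ('a \<Rightarrow> 'p mod_ring mat) set.
        kernel G (unipotent_group (n + 1)) \<rho>)"
      using G.zassenhaus_subset_kernel G.zassenhaus_subset[of p "n + 1"]
      by (auto simp: kernel_def assms(1))
  next
    fix g assume g: "g \<in> (\<Inter>\<rho> \<in> unipotent_reps G TG (n + 1) :: ('a \<Rightarrow> 'p mod_ring mat) set.
        kernel G (unipotent_group (n + 1)) \<rho>)"
    interpret U: group "unipotent_group (n + 1) :: 'p mod_ring mat monoid"
      by (rule group_unipotent_group)
    \<comment> \<open>The intersection ranges over a nonempty family, so its elements lie in the
      carrier.\<close>
    have "(\<lambda>_. 1\<^sub>m (n + 1)) \<in> (unipotent_reps G TG (n + 1) :: ('a \<Rightarrow> 'p mod_ring mat) set)"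
      using U.one_closed by (auto simp: continuous_hom_def hom_def)
    then have "g \<in> carrier G"
      using g by (auto simp: kernel_def)
    then obtain s where s: "s \<in> carrier S" "g = \<pi> s"
      using pi_surj by blast
    have "s \<in> N <#>\<^bsub>S\<^esub> S.Z CARD('p) (Suc n)"
      using assms(2,6,8,9) s g
      by (intro zassenhaus_Suc_if_killed) (auto simp: kernel_def assms(1))
    then obtain x z where xz: "x \<in> N" "z \<in> S.Z CARD('p) (Suc n)" "s = x \<otimes>\<^bsub>S\<^esub> z"
      by (auto simp: set_mult_def)
    moreover have "x \<in> carrier S" "z \<in> carrier S"
      using xz S.zassenhaus_subset by auto
    ultimately have "g = \<pi> z"
      using s kernel_pi by simp
    then show "g \<in> zassenhaus p G TG (n + 1)"
      using xz(2) image_zassenhaus[of p "Suc n"] by (auto simp: assms(1))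
  qed
qed

end
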